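(* Let $V$ be an $n$-graded vector space. (1) For $K_i\in A^{(k_i,\kappa_i)}(V)$, $i=1,2$ (with $k_2\ge 0$), and homogeneous $X_l\in V^{x_l}$, $$(i(K_1)K_2)(X_0,\dots,X_{k_1+k_2})=\frac{1}{(k_1+1)!\,k_2!}\sum_{\sigma\in\mathcal S_{k_1+k_2+1}}\operatorname{sign}(\sigma,\mathbf x)\,(-1)^{\langle\kappa_1,\kappa_2\rangle}K_2\bigl(K_1(X_{\sigma 0},\dots,X_{\sigma k_1}),X_{\sigma(k_1+1)},\dots,X_{\sigma(k_1+k_2)}\bigr).$$ (2) $(A(V),[\ ,\ ]^{\wedge})$ is an $(n+1)$-graded Lie algebra. (3) If $\mu\in A^{(1,0,\dots,0)}(V)$, i.e. $\mu:V\times V\to V$ is a bilinear $n$-graded anticommutative map of weight $0\in\mathbb Z^n$, then $[\mu,\mu]^{\wedge}=0$ if and only if $(V,\mu)$ is an $n$-graded Lie algebra.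
   Context: All vector spaces are over a field $\mathbb K$ of characteristic $0$. For $x,y\in\mathbb Z^n$ put $\langle x,y\rangle=\sum_{i=1}^n x^iy^i$. An $n$-graded vector space is $V=\bigoplus_{x\in\mathbb Z^n}V^x$; the degree of a homogeneous element $X_i$ is denoted $x_i$. An $n$-graded Lie algebra is an $n$-graded vector space with a bilinear bracket such that $[\mathcal E^x,\mathcal E^y]\subseteq\mathcal E^{x+y}$ and, for homogeneous elements, $[X,Y]=-(-1)^{\langle x,y\rangle}[Y,X]$ and $[X,[Y,Z]]=[[X,Y],Z]+(-1)^{\langle x,y\rangle}[Y,[X,Z]]$. $M(V)=\bigoplus_{(k,\kappa)\in\mathbb Z\times\mathbb Z^n}M^{(k,\kappa)}(V)$, where $M^{(k,\kappa)}(V)$ is the space of $(k+1)$-linear maps $K:V\times\dots\times V\to V$ with $K(V^{x_0}\times\dots\times V^{x_k})\subseteq V^{x_0+\dots+x_k+\kappa}$ ($M^{(-1,\kappa)}(V)=V^\kappa$; $M^{(k,\kappa)}(V)=0$ for $k<-1$). For $K_i\in M^{(k_i,\kappa_i)}(V)$, $$(j(K_1)K_2)(X_0,\dots,X_{k_1+k_2})=\sum_{i=0}^{k_2}(-1)^{k_1i+\langle\kappa_1,\kappa_2+x_0+\dots+x_{i-1}\rangle}K_2(X_0,\dots,K_1(X_i,\dots,X_{i+k_1}),\dots,X_{k_1+k_2})$$ (zero if $k_2=-1$). Multigraded sign: for $\mathbf x=(x_0,\dots,x_k)\in(\mathbb Z^n)^{k+1}$ and a permutation $\sigma\in\mathcal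 S_{k+1}$ of $\{0,\dots,k\}$, $\operatorname{sign}(\sigma,\mathbf x)=\prod_{i<j,\ \sigma i>\sigma j}\bigl(-(-1)^{\langle x_{\sigma i},x_{\sigma j}\rangle}\bigr)$ (for a transposition $(i,i+1)$ this is $-(-1)^{\langle x_i,x_{i+1}\rangle}$). Multigraded alternator $\alpha:M(V)\to M(V)$: $(\alpha K)(X_0,\dots,X_k)=\frac1{(k+1)!}\sum_{\sigma\in\mathcal S_{k+1}}\operatorname{sign}(\sigma,\mathbf x)K(X_{\sigma0},\dots,X_{\sigma k})$ for $K\in M^{(k,\kappa)}(V)$, $X_i\in V^{x_i}$; it is a projection. $A^{(k,\kappa)}(V)=\alpha(M^{(k,\kappa)}(V))$ and $A(V)=\bigoplus_{(k,\kappa)}A^{(k,\kappa)}(V)$, with $(n+1)$-degree $(k,\kappa)$. For $K_i\in A^{(k_i,\kappa_i)}(V)$, $$i(K_1)K_2=\frac{(k_1+k_2+1)!}{(k_1+1)!(k_2+1)!}\,\alpha(j(K_1)K_2),\qquad [K_1,K_2]^{\wedge}=i(K_1)K_2-(-1)^{k_1k_2+\langle\kappa_1,\kappa_2\rangle}i(K_2)K_1,$$ where $i(K_1)K_2=0$ if $k_2=-1$. *)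

theory Defs
  imports Complex_Main "HOL-Library.Function_Algebras" "HOL-Combinatorics.Permutations"
begin

section \<open>Degrees and graded vector spaces\<close>

text \<open>
  Elements of \<open>\<int>\<^sup>n\<close> are functions \<^typ>\<open>nat \<Rightarrow> int\<close> vanishing at all indices \<open>i \<ge> n\<close>.  An element
  \<open>(k, \<kappa>)\<close> of \<open>\<int> \<times> \<int>\<^sup>n = \<int>\<^sup>n\<^sup>+\<^sup>1\<close> is the function \<open>p\<close> with \<open>p 0 = k\<close> and \<open>p \<circ> Suc = \<kappa>\<close>.  Degrees are
  added pointwise, by the instances of \<open>Function_Algebras\<close>.
\<close>

definition Zn :: "nat \<Rightarrow> (nat \<Rightarrow> int) set" where
  "Zn n = {x. \<forall>i\<ge>n. x i = 0}"

definition ip :: "nat \<Rightarrow> (nat \<Rightarrow> int) \<Rightarrow> (nat \<Rightarrow> int) \<Rightarrow> int" where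
  "ip n x y = (\<Sum>i<n. x i * y i)"

definition is_decomp ::
  "nat \<Rightarrow> ((nat \<Rightarrow> int) \<Rightarrow> 'v::ab_group_add set) \<Rightarrow> 'v \<Rightarrow> ((nat \<Rightarrow> int) \<Rightarrow> 'v) \<Rightarrow> bool" where
  "is_decomp n V v f \<longleftrightarrow>
     (\<forall>x\<in>Zn n. f x \<in> V x) \<and> (\<forall>x. x \<notin> Zn n \<longrightarrow> f x = 0) \<and>
     finite {x. f x \<noteq> 0} \<and> v = (\<Sum>x | f x \<noteq> 0. f x)"

text \<open>
  The subspace \<open>C\<close> of the ambient vector space is the (internal) direct sum of the subspaces \<open>V x\<close>,
  \<open>x \<in> \<int>\<^sup>n\<close>.  The values \<open>V x\<close> for \<open>x \<notin> Zn n\<close> are irrelevant.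
\<close>

definition graded_space ::
  "nat \<Rightarrow> ('k::field \<Rightarrow> 'v::ab_group_add \<Rightarrow> 'v) \<Rightarrow> 'v set \<Rightarrow> ((nat \<Rightarrow> int) \<Rightarrow> 'v set) \<Rightarrow> bool" where
  "graded_space n scale C V \<longleftrightarrow>
     vector_space scale \<and> module.subspace scale C \<and>
     (\<forall>x\<in>Zn n. module.subspace scale (V x) \<and> V x \<subseteq> C) \<and>
     (\<forall>v\<in>C. \<exists>!f. is_decomp n V v f)"

definition graded_Lie_algebra ::
  "nat \<Rightarrow> ('k::field \<Rightarrow> 'v::ab_group_add \<Rightarrow> 'v) \<Rightarrow> 'v set \<Rightarrow> ((nat \<Rightarrow> int) \<Rightarrow> 'v set)
     \<Rightarrow> ('v \<Rightarrow> 'v \<Rightarrow> 'v) \<Rightarrow> bool" where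
  "graded_Lie_algebra n scale C V b \<longleftrightarrow>
     graded_space n scale C V \<and>
     (\<forall>X\<in>C. \<forall>Y\<in>C. b X Y \<in> C) \<and>
     (\<forall>X\<in>C. \<forall>Y\<in>C. \<forall>Z\<in>C. b (X + Y) Z = b X Z + b Y Z \<and> b Z (X + Y) = b Z X + b Z Y) \<and>
     (\<forall>c. \<forall>X\<in>C. \<forall>Y\<in>C. b (scale c X) Y = scale c (b X Y) \<and> b X (scale c Y) = scale c (b X Y)) \<and>
     (\<forall>x\<in>Zn n. \<forall>y\<in>Zn n. \<forall>X\<in>V x. \<forall>Y\<in>V y. b X Y \<in> V (x + y)) \<and>
     (\<forall>x\<in>Zn n. \<forall>y\<in>Zn n. \<forall>X\<in>V x. \<forall>Y\<in>V y.
        b X Y = - scale ((- 1) powi ip n x y) (b Y X)) \<and>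
     (\<forall>x\<in>Zn n. \<forall>y\<in>Zn n. \<forall>z\<in>Zn n. \<forall>X\<in>V x. \<forall>Y\<in>V y. \<forall>Z\<in>V z.
        b X (b Y Z) = b (b X Y) Z + scale ((- 1) powi ip n x y) (b Y (b X Z)))"

text \<open>
  \<^term>\<open>hcomp n V v x\<close> is the component of \<open>v\<close> in \<open>V x\<close>.  If \<open>f xs Xs\<close> is given by a formula for
  homogeneous arguments \<open>Xs\<close> of degrees \<open>xs\<close>, then \<^term>\<open>homog_ext n V f\<close> is its multilinear
  extension to all arguments; the sum ranges over the degrees of the nonzero components only, hence
  is finite.
\<close>

definition hcomp :: "nat \<Rightarrow> ((nat \<Rightarrow> int) \<Rightarrow> 'v::ab_group_add set) \<Rightarrow> 'v \<Rightarrow> (nat \<Rightarrow> int) \<Rightarrow> 'v" where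
  "hcomp n V v = (THE f. is_decomp n V v f)"

definition homog_ext ::
  "nat \<Rightarrow> ((nat \<Rightarrow> int) \<Rightarrow> 'v::ab_group_add set) \<Rightarrow> ((nat \<Rightarrow> int) list \<Rightarrow> 'v list \<Rightarrow> 'v)
     \<Rightarrow> 'v list \<Rightarrow> 'v" where
  "homog_ext n V f Xs =
     (\<Sum>xs | list_all2 (\<lambda>x X. hcomp n V X x \<noteq> 0) xs Xs. f xs (map2 (\<lambda>x X. hcomp n V X x) xs Xs))"


section \<open>Multilinear maps\<close>

text \<open>
  A map \<open>V \<times> \<dots> \<times> V \<rightarrow> V\<close> of \<open>m\<close> arguments is a function on lists that is zero on all lists of length
  different from \<open>m\<close>.  So maps of different arity live in the one vector space \<^typ>\<open>'v list \<Rightarrow> 'v\<close>,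
  in which the direct sums over \<open>(k, \<kappa>)\<close> can be formed internally.
\<close>

definition fscale :: "('k \<Rightarrow> 'v \<Rightarrow> 'v) \<Rightarrow> 'k \<Rightarrow> ('a \<Rightarrow> 'v) \<Rightarrow> 'a \<Rightarrow> 'v" where
  "fscale scale c K = (\<lambda>a. scale c (K a))"

definition multilinear_map ::
  "('k \<Rightarrow> 'v \<Rightarrow> 'v) \<Rightarrow> nat \<Rightarrow> ('v::ab_group_add list \<Rightarrow> 'v) \<Rightarrow> bool" where
  "multilinear_map scale m K \<longleftrightarrow>
     (\<forall>Xs. length Xs \<noteq> m \<longrightarrow> K Xs = 0) \<and>
     (\<forall>Xs i X Y. length Xs = m \<and> i < m \<longrightarrow> K (Xs[i := X + Y]) = K (Xs[i := X]) + K (Xs[i := Y])) \<and>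
     (\<forall>Xs i c X. length Xs = m \<and> i < m \<longrightarrow> K (Xs[i := scale c X]) = scale c (K (Xs[i := X])))"

definition homog_list ::
  "nat \<Rightarrow> ((nat \<Rightarrow> int) \<Rightarrow> 'v set) \<Rightarrow> (nat \<Rightarrow> int) list \<Rightarrow> 'v list \<Rightarrow> bool" where
  "homog_list n V = list_all2 (\<lambda>x X. x \<in> Zn n \<and> X \<in> V x)"

definition M_space ::
  "nat \<Rightarrow> ('k \<Rightarrow> 'v \<Rightarrow> 'v) \<Rightarrow> ((nat \<Rightarrow> int) \<Rightarrow> 'v set) \<Rightarrow> int \<Rightarrow> (nat \<Rightarrow> int)
     \<Rightarrow> ('v::ab_group_add list \<Rightarrow> 'v) set" where
  "M_space n scale V k \<kappa> =
     (if k < - 1 then {0}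
      else {K. multilinear_map scale (nat (k + 1)) K \<and>
               (\<forall>xs Xs. homog_list n V xs Xs \<and> length Xs = nat (k + 1)
                  \<longrightarrow> K Xs \<in> V (sum_list xs + \<kappa>))})"

text \<open>\<^term>\<open>j_op n scale V k\<^sub>1 \<kappa>\<^sub>1 k\<^sub>2 \<kappa>\<^sub>2 K\<^sub>1 K\<^sub>2\<close> is \<open>j(K\<^sub>1)K\<^sub>2\<close> for \<open>K\<^sub>i\<close> homogeneous of degree \<open>(k\<^sub>i, \<kappa>\<^sub>i)\<close>.\<close>

definition j_op ::
  "nat \<Rightarrow> ('k::field \<Rightarrow> 'v \<Rightarrow> 'v) \<Rightarrow> ((nat \<Rightarrow> int) \<Rightarrow> 'v set)
     \<Rightarrow> int \<Rightarrow> (nat \<Rightarrow> int) \<Rightarrow> int \<Rightarrow> (nat \<Rightarrow> int)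
     \<Rightarrow> ('v::ab_group_add list \<Rightarrow> 'v) \<Rightarrow> ('v list \<Rightarrow> 'v) \<Rightarrow> 'v list \<Rightarrow> 'v" where
  "j_op n scale V k\<^sub>1 \<kappa>\<^sub>1 k\<^sub>2 \<kappa>\<^sub>2 K\<^sub>1 K\<^sub>2 Xs =
     (if k\<^sub>2 < 0 \<or> int (length Xs) \<noteq> k\<^sub>1 + k\<^sub>2 + 1 then 0
      else homog_ext n V
        (\<lambda>ys Ys. \<Sum>i\<le>nat k\<^sub>2.
           scale ((- 1) powi (k\<^sub>1 * int i + ip n \<kappa>\<^sub>1 (\<kappa>\<^sub>2 + sum_list (take i ys))))
             (K\<^sub>2 (take i Ys @ [K\<^sub>1 (take (nat (k\<^sub>1 + 1)) (drop i Ys))] @ drop (i + nat (k\<^sub>1 + 1)) Ys)))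
        Xs)"


section \<open>Alternating maps and the bracket\<close>

definition msign :: "nat \<Rightarrow> (nat \<Rightarrow> nat) \<Rightarrow> (nat \<Rightarrow> int) list \<Rightarrow> 'k::field" where
  "msign n \<sigma> xs =
     (\<Prod>(i, j) | i < j \<and> j < length xs \<and> \<sigma> i > \<sigma> j. - ((- 1) powi ip n (xs ! \<sigma> i) (xs ! \<sigma> j)))"

text \<open>
  The formula for \<open>\<alpha>K\<close> depends only on the number of arguments, so it defines \<open>\<alpha>\<close> on inhomogeneous
  \<open>K\<close> as well.  Note that \<^term>\<open>permute_list \<sigma> [X\<^sub>0, X\<^sub>1]\<close> is \<open>[X\<^bsub>\<sigma> 0\<^esub>, X\<^bsub>\<sigma> 1\<^esub>]\<close>, and likewise for longer lists.
\<close>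

definition alternator ::
  "nat \<Rightarrow> ('k::field_char_0 \<Rightarrow> 'v \<Rightarrow> 'v) \<Rightarrow> ((nat \<Rightarrow> int) \<Rightarrow> 'v set)
     \<Rightarrow> ('v::ab_group_add list \<Rightarrow> 'v) \<Rightarrow> 'v list \<Rightarrow> 'v" where
  "alternator n scale V K Xs =
     homog_ext n V
       (\<lambda>ys Ys. scale (1 / fact (length Ys))
          (\<Sum>\<sigma> | \<sigma> permutes {..<length Ys}. scale (msign n \<sigma> ys) (K (permute_list \<sigma> Ys))))
       Xs"

definition A_space ::
  "nat \<Rightarrow> ('k::field_char_0 \<Rightarrow> 'v \<Rightarrow> 'v) \<Rightarrow> ((nat \<Rightarrow> int) \<Rightarrow> 'v set) \<Rightarrow> int \<Rightarrow> (nat \<Rightarrow> int)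
     \<Rightarrow> ('v::ab_group_add list \<Rightarrow> 'v) set" where
  "A_space n scale V k \<kappa> = alternator n scale V ` M_space n scale V k \<kappa>"

definition A_grade ::
  "nat \<Rightarrow> ('k::field_char_0 \<Rightarrow> 'v \<Rightarrow> 'v) \<Rightarrow> ((nat \<Rightarrow> int) \<Rightarrow> 'v set) \<Rightarrow> (nat \<Rightarrow> int)
     \<Rightarrow> ('v::ab_group_add list \<Rightarrow> 'v) set" where
  "A_grade n scale V p = A_space n scale V (p 0) (p \<circ> Suc)"

definition A_total ::
  "nat \<Rightarrow> ('k::field_char_0 \<Rightarrow> 'v \<Rightarrow> 'v) \<Rightarrow> ((nat \<Rightarrow> int) \<Rightarrow> 'v set)
     \<Rightarrow> ('v::ab_group_add list \<Rightarrow> 'v) set" where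
  "A_total n scale V = module.span (fscale scale) (\<Union>p\<in>Zn (Suc n). A_grade n scale V p)"

text \<open>
  \<open>i(K\<^sub>1)K\<^sub>2\<close> for \<open>K\<^sub>i\<close> homogeneous of degree \<open>(k\<^sub>i, \<kappa>\<^sub>i)\<close>; it is zero for \<open>k\<^sub>2 = -1\<close> because \<open>j(K\<^sub>1)K\<^sub>2\<close> is.
\<close>

definition i_op ::
  "nat \<Rightarrow> ('k::field_char_0 \<Rightarrow> 'v \<Rightarrow> 'v) \<Rightarrow> ((nat \<Rightarrow> int) \<Rightarrow> 'v set)
     \<Rightarrow> int \<Rightarrow> (nat \<Rightarrow> int) \<Rightarrow> int \<Rightarrow> (nat \<Rightarrow> int)
     \<Rightarrow> ('v::ab_group_add list \<Rightarrow> 'v) \<Rightarrow> ('v list \<Rightarrow> 'v) \<Rightarrow> 'v list \<Rightarrow> 'v" where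
  "i_op n scale V k\<^sub>1 \<kappa>\<^sub>1 k\<^sub>2 \<kappa>\<^sub>2 K\<^sub>1 K\<^sub>2 =
     fscale scale (fact (nat (k\<^sub>1 + k\<^sub>2 + 1)) / (fact (nat (k\<^sub>1 + 1)) * fact (nat (k\<^sub>2 + 1))))
       (alternator n scale V (j_op n scale V k\<^sub>1 \<kappa>\<^sub>1 k\<^sub>2 \<kappa>\<^sub>2 K\<^sub>1 K\<^sub>2))"

definition hbracket ::
  "nat \<Rightarrow> ('k::field_char_0 \<Rightarrow> 'v \<Rightarrow> 'v) \<Rightarrow> ((nat \<Rightarrow> int) \<Rightarrow> 'v set)
     \<Rightarrow> int \<Rightarrow> (nat \<Rightarrow> int) \<Rightarrow> int \<Rightarrow> (nat \<Rightarrow> int)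
     \<Rightarrow> ('v::ab_group_add list \<Rightarrow> 'v) \<Rightarrow> ('v list \<Rightarrow> 'v) \<Rightarrow> 'v list \<Rightarrow> 'v" where
  "hbracket n scale V k\<^sub>1 \<kappa>\<^sub>1 k\<^sub>2 \<kappa>\<^sub>2 K\<^sub>1 K\<^sub>2 =
     i_op n scale V k\<^sub>1 \<kappa>\<^sub>1 k\<^sub>2 \<kappa>\<^sub>2 K\<^sub>1 K\<^sub>2
     - fscale scale ((- 1) powi (k\<^sub>1 * k\<^sub>2 + ip n \<kappa>\<^sub>1 \<kappa>\<^sub>2)) (i_op n scale V k\<^sub>2 \<kappa>\<^sub>2 k\<^sub>1 \<kappa>\<^sub>1 K\<^sub>2 K\<^sub>1)"

text \<open>The bilinear extension of \<^const>\<open>hbracket\<close> from homogeneous elements to \<open>A(V)\<close>.\<close>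

definition A_bracket ::
  "nat \<Rightarrow> ('k::field_char_0 \<Rightarrow> 'v \<Rightarrow> 'v) \<Rightarrow> ((nat \<Rightarrow> int) \<Rightarrow> 'v set)
     \<Rightarrow> ('v::ab_group_add list \<Rightarrow> 'v) \<Rightarrow> ('v list \<Rightarrow> 'v) \<Rightarrow> 'v list \<Rightarrow> 'v" where
  "A_bracket n scale V K L =
     homog_ext (Suc n) (A_grade n scale V)
       (\<lambda>ps Ks. hbracket n scale V ((ps ! 0) 0) (ps ! 0 \<circ> Suc) ((ps ! 1) 0) (ps ! 1 \<circ> Suc)
         (Ks ! 0) (Ks ! 1))
       [K, L]"

end

theory Submission
  imports Defs
begin

text \<open>
  The bracket on alternating maps is the image under alternation of a simpler bracket on all
  multilinear maps, and that one satisfies the Jacobi identity because inserting one map into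
  another is a pre-Lie product.

  \<^bold>\<open>Signs and maps are separated.\<close>  All combinatorics takes place on functions of lists of pairs
  (degree, vector).  There a permutation acts together with its sign, alternation is the average over
  this action, and \<open>insertion p K F\<close> sums the insertions of \<open>K\<close> into all slots of \<open>F\<close>; the identities
  are then statements about lists and signs, and of the maps they use only linearity in a slot and
  the number of arguments.  A multilinear map is determined by its values on homogeneous arguments, so an
  identity on lists of pairs is an identity between multilinear maps
  (\<open>multilinear_eq_0\<close>, \<open>ext_map_cong\<close>).

  \<^bold>\<open>Alternation is compatible with insertion.\<close>  Permuting the arguments of \<open>K\<close>, or the slots of \<open>F\<close>,
  changes the inserted map only by a signed permutation of all its arguments, which alternation does
  not see.  It suffices to treat adjacent transpositions, and the one case with content is that in
  which the block occupied by \<open>K\<close> trades places with a single argument: the sign of moving the block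
  differs from the product of the signs of moving its members by exactly the sign that \<open>K\<close> acquires
  in passing that argument (\<open>eps_block\<close>).  So \<open>K\<close> and \<open>F\<close> may be alternated or not before they are
  inserted, with the same result after alternation (\<open>alteq_insertion_alt_left\<close>,
  \<open>alteq_insertion_alt_right\<close>).

  \<^bold>\<open>Insertion is pre-Lie.\<close>  Inserting \<open>L\<close> and then \<open>K\<close> into \<open>F\<close> gives terms in which \<open>K\<close> lies left of
  \<open>L\<close>, inside \<open>L\<close>, or right of \<open>L\<close>.  In the graded commutator of the two insertions the terms with
  disjoint blocks cancel and the nested ones form the insertion of a commutator
  (\<open>insertion_pre_Lie\<close>), whence its Jacobi identity (\<open>commutator_Jacobi\<close>).  By compatibility, a double
  bracket of alternating maps is the alternation of a double commutator times a factor that is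
  symmetric in the three maps (\<open>hbracket_hbracket\<close>), so the Jacobi identity descends.

  \<^bold>\<open>The formula and the case of arity two.\<close>  If \<open>F\<close> is alternating, all slots contribute equally after
  alternation, and only the insertion into the first slot needs to be kept; this is the formula for
  \<open>i(K\<^sub>1)K\<^sub>2\<close>.  For an alternating bilinear \<open>\<mu>\<close> of weight \<open>0\<close> one has \<open>[\<mu>, \<mu>] = 2 i(\<mu>)\<mu>\<close>, and in the
  formula for \<open>i(\<mu>)\<mu>\<close> the six permutations coincide in pairs, leaving the three terms of the Jacobi
  identity of \<open>\<mu>\<close>.
\<close>

section \<open>Signs of permutations\<close>

text \<open>Degrees are functions, but should be treated by the simplifier as elements of a group.\<close>
declare plus_fun_apply [simp del] zero_fun_apply [simp del]

definition sg :: "nat \<Rightarrow> (nat \<Rightarrow> int) \<Rightarrow> (nat \<Rightarrow> int) \<Rightarrow> 'k::field" where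
  "sg n x y = (- 1) powi ip n x y"

lemma ip_commute: "ip n x y = ip n y x"
  by (simp add: ip_def mult.commute)

lemma ip_add_left: "ip n (x + y) z = ip n x z + ip n y z"
  by (simp add: ip_def distrib_right sum.distrib plus_fun_apply)

lemma ip_Suc: "ip (Suc n) p q = p 0 * q 0 + ip n (p \<circ> Suc) (q \<circ> Suc)"
  unfolding ip_def by (subst sum.lessThan_Suc_shift) simp

lemma minus_one_powi_square: "((- 1 :: 'k::field) powi a) * (- 1) powi a = 1"
  by (simp add: power_int_minus_one_mult_self)

lemma sg_commute: "sg n x y = sg n y x"
  by (simp add: sg_def ip_commute)

lemma sg_add_left: "sg n (x + y) z = sg n x z * sg n y z"
  by (simp add: sg_def ip_add_left power_int_add)

lemma sg_add_right: "sg n z (x + y) = sg n z x * sg n z y"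
  by (metis sg_add_left sg_commute)

lemma sg_square [simp]: "sg n x y * sg n x y = 1"
  unfolding sg_def by (rule minus_one_powi_square)

lemma sg_square' [simp]: "sg n x y * (sg n x y * c) = c"
  by (metis mult.assoc mult_1 sg_square)

lemma sg_zero [simp]: "sg n 0 y = 1" "sg n y 0 = 1"
  by (simp_all add: sg_def ip_def zero_fun_apply)

lemma sg_Suc: "sg (Suc n) p q = (- 1) powi (p 0 * q 0) * sg n (p \<circ> Suc) (q \<circ> Suc)"
  by (simp add: sg_def ip_Suc power_int_add)

text \<open>The sign of exchanging two neighbouring arguments of an alternating map.\<close>
definition eps :: "nat \<Rightarrow> (nat \<Rightarrow> int) \<Rightarrow> (nat \<Rightarrow> int) \<Rightarrow> 'k::field" where
  "eps n x y = - sg n x y"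

lemma eps_commute: "eps n x y = eps n y x"
  by (simp add: eps_def sg_commute)

lemma eps_square [simp]: "eps n x y * eps n x y = 1"
  by (simp add: eps_def)

lemma eps_mult_commuted [simp]: "eps n x y * eps n y x = 1"
  by (simp add: eps_commute[of n y x])

lemma msign_eq_prod:
  "msign n \<sigma> xs = (\<Prod>(i, j)\<in>{(i, j). i < j \<and> j < length xs}.
     if \<sigma> i > \<sigma> j then eps n (xs ! \<sigma> i) (xs ! \<sigma> j) else 1)"
proof -
  have fin: "finite {(i, j). i < j \<and> j < length xs}"
    by (rule finite_subset[of _ "{..<length xs} \<times> {..<length xs}"]) auto
  show ?thesis
    unfolding msign_def eps_def sg_def
    by (intro prod.mono_neutral_cong_left[OF fin]) (auto split: if_splits)
qed

text \<open>
  The sign of a permutation is a product over inversions, and it is multiplicative because it can be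
  read as a product over unordered pairs of positions: a pair is inverted by \<open>f \<circ> g\<close> iff exactly one
  of \<open>f\<close>, \<open>g\<close> inverts it at the moment it acts, and each factor squares to \<open>1\<close>.  The next lemma
  reindexes such a product.
\<close>
lemma prod_pairs_permute:
  fixes h :: "nat \<Rightarrow> nat \<Rightarrow> 'k::comm_monoid_mult"
  assumes g: "g permutes {..<m}"
  shows "(\<Prod>(i, j)\<in>{(i, j). i < j \<and> j < m}. h i j) =
         (\<Prod>(i, j)\<in>{(i, j). i < j \<and> j < m}. h (min (g i) (g j)) (max (g i) (g j)))"
proof -
  define T where "T = {(i, j). i < j \<and> j < m}"
  define S where "S f = (\<lambda>(i, j). (min (f i) (f j), max (f i) (f j)) :: nat \<times> nat)" for f :: "nat \<Rightarrow> nat"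
  have into: "S f ` T \<subseteq> T" if "f permutes {..<m}" for f
  proof -
    have "f i < m \<longleftrightarrow> i < m" for i
      using permutes_in_image[OF that, of i] by simp
    moreover have "f i \<noteq> f j" if "i \<noteq> j" for i j
      using permutes_inj[OF \<open>f permutes {..<m}\<close>] that by (auto dest: injD)
    ultimately show ?thesis
      unfolding S_def T_def
      by (auto simp: min_def max_def) (metis linorder_neq_iff order_less_trans not_le)+
  qed
  have inv: "S (inv g) (S g t) = t" if "t \<in> T" for t
    using that permutes_inverses[OF g] unfolding S_def T_def
    by (auto simp: min_def max_def)
  have inv': "S g (S (inv g) t) = t" if "t \<in> T" for t
    using that permutes_inverses[OF g] unfolding S_def T_def
    by (auto simp: min_def max_def)
  show ?thesis
    unfolding T_def[symmetric]
    by (rule prod.reindex_bij_witness[where i = "S g" and j = "S (inv g)"])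
      (use into[OF g] into[OF permutes_inv[OF g]] inv inv' in \<open>auto simp: S_def split: prod.splits\<close>)
qed

lemma msign_comp:
  fixes xs :: "(nat \<Rightarrow> int) list"
  assumes f: "f permutes {..<length xs}" and g: "g permutes {..<length xs}"
  shows "msign n (f \<circ> g) xs = (msign n f xs * msign n g (permute_list f xs) :: 'k::field)"
proof -
  define T where "T = {(i, j). i < j \<and> j < length xs}"
  have inj: "f i = f j \<longleftrightarrow> i = j" "g i = g j \<longleftrightarrow> i = j" for i j
    using permutes_inj[OF f] permutes_inj[OF g] by (auto dest: injD)
  have lt: "g i < length xs" if "i < length xs" for i
    using permutes_in_image[OF g, of i] that by simp
  define h where "h a b = (if f a > f b then eps n (xs ! f a) (xs ! f b) else (1::'k))" for a b
  have 1: "msign n f xs = (\<Prod>(i, j)\<in>T. h (min (g i) (g j)) (max (g i) (g j)))"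
    unfolding msign_eq_prod T_def h_def[symmetric] by (rule prod_pairs_permute[OF g])
  have 2: "msign n g (permute_list f xs) =
      (\<Prod>(i, j)\<in>T. if g i > g j then eps n (xs ! f (g i)) (xs ! f (g j)) else (1::'k))"
    unfolding msign_eq_prod length_permute_list T_def[symmetric]
    by (intro prod.cong refl) (auto simp: T_def lt permute_list_nth[OF f])
  have "h (min (g i) (g j)) (max (g i) (g j)) *
      (if g i > g j then eps n (xs ! f (g i)) (xs ! f (g j)) else 1) =
      (if (f \<circ> g) i > (f \<circ> g) j then eps n (xs ! (f \<circ> g) i) (xs ! (f \<circ> g) j) else 1)"
    if "i \<noteq> j" for i j
    using that inj(1)[of "g i" "g j"] inj(2)[of i j]
      eps_commute[of n "xs ! f (g i)" "xs ! f (g j)"]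
    by (auto simp: h_def min_def max_def)
  then show ?thesis
    unfolding 1 2 prod.distrib[symmetric] msign_eq_prod[of n "f \<circ> g"] T_def[symmetric]
    by (intro prod.cong refl) (auto simp: T_def)
qed

lemma permute_list_adjacent:
  "permute_list (transpose (length us) (Suc (length us))) (us @ a # b # vs) = us @ b # a # vs"
proof (rule nth_equalityI)
  fix i
  assume "i < length (permute_list (transpose (length us) (Suc (length us))) (us @ a # b # vs))"
  then have "permute_list (transpose (length us) (Suc (length us))) (us @ a # b # vs) ! i =
      (us @ a # b # vs) ! transpose (length us) (Suc (length us)) i"
    by (simp add: permute_list_def del: upt_Suc)
  also have "\<dots> = (us @ b # a # vs) ! i"
  proof -
    consider "i < length us" | "i = length us" | "i = Suc (length us)"
      | k where "i = Suc (Suc (length us + k))"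
      by (metis add_Suc_right less_imp_Suc_add not_less_eq linorder_neqE_nat)
    then show ?thesis
      by cases (auto simp: transpose_def nth_append)
  qed
  finally show "permute_list (transpose (length us) (Suc (length us))) (us @ a # b # vs) ! i =
      (us @ b # a # vs) ! i" .
qed simp

lemma transpose_adjacent_permutes: "Suc r < m \<Longrightarrow> transpose r (Suc r) permutes {..<m}"
  by (intro permutes_swap_id) auto

lemma msign_adjacent:
  "msign n (transpose (length us) (Suc (length us))) (us @ a # b # vs) = eps n a b"
proof -
  let ?r = "length us"
  have "{(i, j). i < j \<and> j < length (us @ a # b # vs) \<and>
      transpose ?r (Suc ?r) i > transpose ?r (Suc ?r) j} = {(?r, Suc ?r)}"
    by (auto simp: transpose_def split: if_splits)
  then show ?thesis
    by (simp add: msign_def eps_def sg_def nth_append ip_commute)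
qed

text \<open>Adjacent transpositions generate the symmetric group, so it suffices to compute signs for these.\<close>
lemma permutes_adjacent_induct [consumes 1, case_names id swap]:
  fixes m :: nat
  assumes \<sigma>: "\<sigma> permutes {..<m}" and id: "P id"
    and step: "\<And>r \<sigma>. Suc r < m \<Longrightarrow> \<sigma> permutes {..<m} \<Longrightarrow> P \<sigma> \<Longrightarrow> P (transpose r (Suc r) \<circ> \<sigma>)"
  shows "P \<sigma>"
proof -
  have far: "P (transpose a (a + Suc d) \<circ> \<sigma>)"
    if "a + Suc d < m" "\<sigma> permutes {..<m}" "P \<sigma>" for a d \<sigma>
    using that
  proof (induction d arbitrary: a \<sigma>)
    case 0
    then show ?case using step[of a \<sigma>] by (simp add: comp_def)
  next
    case (Suc d)
    let ?s = "transpose a (Suc a)" and ?t = "transpose (Suc a) (Suc a + Suc d)"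
    have s: "?s permutes {..<m}" and t: "?t permutes {..<m}"
      using Suc.prems by (auto intro!: permutes_swap_id)
    \<comment> \<open>A long transposition is a shorter one conjugated by an adjacent one.\<close>
    have "transpose a (a + Suc (Suc d)) = ?s \<circ> (?t \<circ> ?s)"
      by (auto simp: transpose_def fun_eq_iff)
    moreover have "P (?s \<circ> (?t \<circ> (?s \<circ> \<sigma>)))"
      using Suc.prems s t
      by (intro step Suc.IH permutes_compose[of "?s \<circ> \<sigma>"] permutes_compose[of \<sigma>]) auto
    ultimately show ?case by (simp add: comp_def)
  qed
  show ?thesis
    using \<sigma> finite_lessThan
  proof (induction rule: permutes_induct)
    case id
    show ?case by (rule \<open>P id\<close>)
  next
    case (swap a b p)
    have "P (transpose a b \<circ> p)" if "a < b" "b < m" for a b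
      using far[of a "b - Suc a" p] that swap.hyps swap.IH by simp
    from this[of a b] this[of b a] show ?case
      using swap.hyps by (metis lessThan_iff linorder_neqE_nat transpose_commute)
  qed
qed

section \<open>Alternation of functions on lists of graded arguments\<close>

type_synonym 'v graded_list = "((nat \<Rightarrow> int) \<times> 'v) list"

text \<open>
  A degree in \<open>\<int> \<times> \<int>\<^sup>n\<close> is kept as one function \<open>p\<close>, so that degrees of maps add; \<open>ar p\<close> is the
  number \<open>k + 1\<close> of arguments and \<open>wt p\<close> the weight \<open>\<kappa>\<close>.
\<close>
definition ar :: "(nat \<Rightarrow> int) \<Rightarrow> nat" where
  "ar p = nat (p 0 + 1)"

definition wt :: "(nat \<Rightarrow> int) \<Rightarrow> nat \<Rightarrow> int" where
  "wt p = p \<circ> Suc"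

locale signed_maps = vector_space scale
  for n :: nat and scale :: "'k::field_char_0 \<Rightarrow> 'v::ab_group_add \<Rightarrow> 'v"
begin

definition act :: "(nat \<Rightarrow> nat) \<Rightarrow> ('v graded_list \<Rightarrow> 'v) \<Rightarrow> 'v graded_list \<Rightarrow> 'v" where
  "act \<sigma> F zs = scale (msign n \<sigma> (map fst zs)) (F (permute_list \<sigma> zs))"

definition alt :: "('v graded_list \<Rightarrow> 'v) \<Rightarrow> 'v graded_list \<Rightarrow> 'v" where
  "alt F zs = scale (1 / fact (length zs)) (\<Sum>\<sigma> | \<sigma> permutes {..<length zs}. act \<sigma> F zs)"

lemma act_id [simp]: "act id F zs = F zs"
  by (simp add: act_def msign_eq_prod case_prod_unfold)

lemma act_act:
  assumes "\<sigma> permutes {..<length zs}" "\<tau> permutes {..<length zs}"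
  shows "act \<sigma> (act \<tau> F) zs = act (\<sigma> \<circ> \<tau>) F zs"
  using assms
  by (simp add: act_def msign_comp permute_list_compose permute_list_map)

lemma act_cong:
  "\<sigma> permutes {..<length zs} \<Longrightarrow> (\<And>ys. length ys = length zs \<Longrightarrow> set ys = set zs \<Longrightarrow> F ys = G ys)
    \<Longrightarrow> act \<sigma> F zs = act \<sigma> G zs"
  by (simp add: act_def)

lemma alt_cong:
  assumes "\<And>ys. length ys = length zs \<Longrightarrow> set ys = set zs \<Longrightarrow> F ys = G ys"
  shows "alt F zs = alt G zs"
  unfolding alt_def using assms by (intro arg_cong2[of _ _ _ _ scale] sum.cong act_cong) auto

lemma finite_perms [simp]: "finite {\<sigma>. \<sigma> permutes {..<m::nat}}"
  by (simp add: finite_permutations)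

lemma act_sum: "act \<sigma> (\<lambda>ys. \<Sum>a\<in>A. F a ys) zs = (\<Sum>a\<in>A. act \<sigma> (F a) zs)"
  by (simp add: act_def scale_sum_right)

lemma act_scale: "act \<sigma> (\<lambda>ys. scale c (F ys)) zs = scale c (act \<sigma> F zs)"
  by (simp add: act_def mult.commute)

lemma act_diff: "act \<sigma> (\<lambda>ys. F ys - G ys) zs = act \<sigma> F zs - act \<sigma> G zs"
  by (simp add: act_def scale_right_diff_distrib)

lemma alt_sum: "alt (\<lambda>ys. \<Sum>a\<in>A. F a ys) zs = (\<Sum>a\<in>A. alt (F a) zs)"
  unfolding alt_def act_sum
  by (subst sum.swap) (simp add: scale_sum_right)

lemma alt_scale: "alt (\<lambda>ys. scale c (F ys)) zs = scale c (alt F zs)"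
  by (simp add: alt_def act_scale scale_sum_right mult.commute)

lemma alt_diff: "alt (\<lambda>ys. F ys - G ys) zs = alt F zs - alt G zs"
  by (simp add: alt_def act_diff sum_subtractf scale_right_diff_distrib)

lemma alt_zero [simp]: "alt (\<lambda>ys. 0) zs = 0"
  by (simp add: alt_def act_def)

lemma alt_act:
  assumes "\<sigma> permutes {..<length zs}"
  shows "alt (act \<sigma> F) zs = alt F zs"
proof -
  have "(\<Sum>\<tau> | \<tau> permutes {..<length zs}. act \<tau> (act \<sigma> F) zs) =
      (\<Sum>\<tau> | \<tau> permutes {..<length zs}. act (\<tau> \<circ> \<sigma>) F zs)"
    by (intro sum.cong) (simp_all add: act_act assms)
  also have "\<dots> = (\<Sum>\<tau> | \<tau> permutes {..<length zs}. act \<tau> F zs)"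
    by (rule sum_permutations_compose_right[OF assms, symmetric])
  finally show ?thesis by (simp add: alt_def)
qed

lemma act_alt:
  assumes "\<sigma> permutes {..<length zs}"
  shows "act \<sigma> (alt F) zs = alt F zs"
proof -
  have "act \<sigma> (alt F) zs =
      scale (1 / fact (length zs)) (\<Sum>\<tau> | \<tau> permutes {..<length zs}. act \<sigma> (act \<tau> F) zs)"
    unfolding act_def alt_def
    by (simp add: scale_sum_right act_def mult.commute)
  also have "(\<Sum>\<tau> | \<tau> permutes {..<length zs}. act \<sigma> (act \<tau> F) zs) =
      (\<Sum>\<tau> | \<tau> permutes {..<length zs}. act (\<sigma> \<circ> \<tau>) F zs)"
    by (intro sum.cong) (simp_all add: act_act assms)
  also have "\<dots> = (\<Sum>\<tau> | \<tau> permutes {..<length zs}. act \<tau> F zs)"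
    by (rule setum_permutations_compose_left[OF assms, symmetric])
  finally show ?thesis by (simp only: alt_def[of F zs])
qed

lemma average_const:
  "scale (1 / fact m) (\<Sum>\<sigma> | \<sigma> permutes {..<m}. v) = v"
proof -
  have "(\<Sum>\<sigma> | \<sigma> permutes {..<m}. v) = scale (fact m) v"
    by (simp only: sum_constant_scale card_permutations[OF card_lessThan finite_lessThan] of_nat_fact)
  then show ?thesis by simp
qed

lemma alt_invariant:
  assumes "\<And>\<sigma>. \<sigma> permutes {..<length zs} \<Longrightarrow> act \<sigma> F zs = F zs"
  shows "alt F zs = F zs"
  using assms by (simp add: alt_def average_const del: sum_constant)

lemma alt_alt: "alt (alt F) zs = alt F zs"
  by (rule alt_invariant) (rule act_alt)

text \<open>
  Equality after alternation, for functions of \<open>m\<close> arguments: the relation modulo which permuting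
  arguments costs only a sign.
\<close>
definition alteq :: "nat \<Rightarrow> ('v graded_list \<Rightarrow> 'v) \<Rightarrow> ('v graded_list \<Rightarrow> 'v) \<Rightarrow> bool" where
  "alteq m F G \<longleftrightarrow> (\<forall>zs. length zs = m \<longrightarrow> alt F zs = alt G zs)"

lemma alteq_refl: "(\<And>zs. length zs = m \<Longrightarrow> F zs = G zs) \<Longrightarrow> alteq m F G"
  unfolding alteq_def by (auto intro: alt_cong)

lemma alteq_sym: "alteq m F G \<Longrightarrow> alteq m G F"
  by (simp add: alteq_def)

lemma alteq_trans [trans]: "alteq m F G \<Longrightarrow> alteq m G H \<Longrightarrow> alteq m F H"
  by (simp add: alteq_def)

lemma alteq_act: "\<sigma> permutes {..<m} \<Longrightarrow> alteq m (act \<sigma> F) F"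
  by (auto simp: alteq_def alt_act)

lemma alteq_average:
  assumes "\<And>\<sigma>. \<sigma> permutes {..<k} \<Longrightarrow> alteq m (F \<sigma>) G"
  shows "alteq m (\<lambda>zs. scale (1 / fact k) (\<Sum>\<sigma> | \<sigma> permutes {..<k}. F \<sigma> zs)) G"
  using assms
  by (auto simp: alteq_def alt_scale alt_sum average_const simp del: sum_constant)

lemma act_adjacent:
  "act (transpose (length us) (Suc (length us))) F (us @ a # b # vs) =
     scale (eps n (fst a) (fst b)) (F (us @ b # a # vs))"
  unfolding act_def permute_list_adjacent
  using msign_adjacent[of n "map fst us" "fst a" "fst b" "map fst vs", where ?'a = 'k]
  by simp

lemma act_adjacent_twice:
  assumes "Suc r < length zs"
  shows "act (transpose r (Suc r)) (act (transpose r (Suc r)) F) zs = F zs"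
  using assms by (simp add: act_act transpose_adjacent_permutes)

lemma list_split_adjacent:
  assumes "Suc r < length zs"
  obtains us a b vs where "zs = us @ a # b # vs" "length us = r"
proof
  show "zs = take r zs @ zs ! r # zs ! Suc r # drop (Suc (Suc r)) zs"
    using assms by (simp add: Cons_nth_drop_Suc)
  show "length (take r zs) = r" using assms by simp
qed

lemma alteq_swap:
  assumes "\<And>us a b vs. length us = r \<Longrightarrow> length us + 2 + length vs = m \<Longrightarrow>
      G (us @ a # b # vs) = scale (eps n (fst a) (fst b)) (F (us @ b # a # vs))"
    and r: "Suc r < m"
  shows "alteq m G F"
proof -
  have "alteq m G (act (transpose r (Suc r)) F)"
  proof (rule alteq_refl)
    fix zs :: "'v graded_list"
    assume "length zs = m"
    moreover from this r obtain us a b vs where "zs = us @ a # b # vs" "length us = r"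
      by (metis list_split_adjacent)
    ultimately show "G zs = act (transpose r (Suc r)) F zs"
      using assms(1)[of us vs a b] act_adjacent[of us F a b vs] by simp
  qed
  also have "alteq m \<dots> F" by (rule alteq_act[OF transpose_adjacent_permutes[OF r]])
  finally show ?thesis .
qed

text \<open>The argument \<open>z\<close> passes the members of the block one at a time, by adjacent transpositions.\<close>
lemma alteq_move:
  assumes "\<And>us ws z vs. length us = r \<Longrightarrow> length ws = k \<Longrightarrow> r + k + 1 + length vs = m \<Longrightarrow>
      G (us @ ws @ z # vs) =
        scale (\<Prod>w\<leftarrow>ws. eps n (fst w) (fst z)) (F (us @ z # ws @ vs))"
    and "r + k < m"
  shows "alteq m G F"
  using assms
proof (induction k arbitrary: r F)
  case 0
  show ?case
  proof (rule alteq_refl)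
    fix zs :: "'v graded_list"
    assume "length zs = m"
    then obtain us z vs where "zs = us @ z # vs" "length us = r"
      using 0(2) id_take_nth_drop[of r zs] by (metis add_0_right length_take min.absorb2 less_imp_le)
    then show "G zs = F zs" using 0(1)[of us "[]" vs z] \<open>length zs = m\<close> by simp
  qed
next
  case (Suc k)
  have r: "Suc r < m" using Suc.prems(2) by simp
  have "alteq m G (act (transpose r (Suc r)) F)"
  proof (rule Suc.IH[of "Suc r"])
    fix us ws vs :: "'v graded_list" and z :: "(nat \<Rightarrow> int) \<times> 'v"
    assume len: "length us = Suc r" "length ws = k" "Suc r + k + 1 + length vs = m"
    then obtain us' w where us: "us = us' @ [w]" "length us' = r"
      by (metis length_Suc_conv_rev)
    have "G (us @ ws @ z # vs) =
        scale (\<Prod>w\<leftarrow>w # ws. eps n (fst w) (fst z)) (F (us' @ z # (w # ws) @ vs))"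
      using Suc.prems(1)[of us' "w # ws" vs z] len us by simp
    also have "\<dots> = scale (\<Prod>w\<leftarrow>ws. eps n (fst w) (fst z))
        (act (transpose r (Suc r)) F (us @ z # ws @ vs))"
      using act_adjacent[of us' F w z "ws @ vs"] us by (simp add: mult.commute)
    finally show "G (us @ ws @ z # vs) = \<dots>" .
  qed (use Suc.prems(2) in simp)
  also have "alteq m \<dots> F" by (rule alteq_act[OF transpose_adjacent_permutes[OF r]])
  finally show ?case .
qed

section \<open>Insertion of one map into another\<close>

text \<open>The sign acquired by a map of degree \<open>p\<close> when it moves past an argument of degree \<open>x\<close>.\<close>
definition pass_sign :: "(nat \<Rightarrow> int) \<Rightarrow> (nat \<Rightarrow> int) \<Rightarrow> 'k" where
  "pass_sign p x = (- 1) powi p 0 * sg n (wt p) x"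

definition pass_signs :: "(nat \<Rightarrow> int) \<Rightarrow> 'v graded_list \<Rightarrow> 'k" where
  "pass_signs p us = (\<Prod>u\<leftarrow>us. pass_sign p (fst u))"

text \<open>
  A block of arguments with \<open>K\<close> applied to it, as one argument of the outer map.  Its degree is
  assigned by the rule for maps of degree \<open>p\<close>, whatever the value of \<open>K\<close>.
\<close>
definition block :: "(nat \<Rightarrow> int) \<Rightarrow> ('v graded_list \<Rightarrow> 'v) \<Rightarrow> 'v graded_list \<Rightarrow> (nat \<Rightarrow> int) \<times> 'v" where
  "block p K ws = (sum_list (map fst ws) + wt p, K ws)"

definition insert_at ::
  "(nat \<Rightarrow> int) \<Rightarrow> ('v graded_list \<Rightarrow> 'v) \<Rightarrow> nat \<Rightarrow> ('v graded_list \<Rightarrow> 'v) \<Rightarrow> 'v graded_list \<Rightarrow> 'v" where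
  "insert_at p K i F zs = scale (pass_signs p (take i zs))
     (F (take i zs @ block p K (take (ar p) (drop i zs)) # drop (i + ar p) zs))"

text \<open>
  This is \<open>j(K)F\<close> without the factor \<open>(-1)\<^sup>\<langle>\<^sup>\<kappa>\<^sub>1\<^sup>,\<^sup>\<kappa>\<^sub>2\<^sup>\<rangle>\<close>.  That factor is constant, and leaving it out makes
  the definition independent of the degree of \<open>F\<close>.
\<close>
definition insertion ::
  "(nat \<Rightarrow> int) \<Rightarrow> ('v graded_list \<Rightarrow> 'v) \<Rightarrow> ('v graded_list \<Rightarrow> 'v) \<Rightarrow> 'v graded_list \<Rightarrow> 'v" where
  "insertion p K F zs = (\<Sum>i | i + ar p \<le> length zs. insert_at p K i F zs)"

definition slot_linear :: "('v graded_list \<Rightarrow> 'v) \<Rightarrow> bool" where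
  "slot_linear F \<longleftrightarrow>
     (\<forall>us x X Y vs. F (us @ (x, X + Y) # vs) = F (us @ (x, X) # vs) + F (us @ (x, Y) # vs)) \<and>
     (\<forall>us x c X vs. F (us @ (x, scale c X) # vs) = scale c (F (us @ (x, X) # vs)))"

lemma pass_signs_Nil [simp]: "pass_signs p [] = 1"
  and pass_signs_Cons [simp]: "pass_signs p (u # us) = pass_sign p (fst u) * pass_signs p us"
  and pass_signs_append [simp]: "pass_signs p (us @ vs) = pass_signs p us * pass_signs p vs"
  by (simp_all add: pass_signs_def)

lemma insert_at_split:
  "length us = i \<Longrightarrow> length ws = ar p \<Longrightarrow>
    insert_at p K i F (us @ ws @ vs) = scale (pass_signs p us) (F (us @ block p K ws # vs))"
  by (simp add: insert_at_def)

lemma split_block: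
  assumes "i + k \<le> length zs"
  obtains us ws vs where "zs = us @ ws @ vs" "length us = i" "length ws = k"
proof
  show "zs = take i zs @ take k (drop i zs) @ drop (i + k) zs"
    by (metis append_take_drop_id drop_drop add.commute)
qed (use assms in auto)

lemma finite_slots [simp]: "finite {i. i + k \<le> (m::nat)}"
  by (rule finite_subset[of _ "{..m}"]) auto

lemma insertion_cong:
  assumes "\<And>ys. length ys + ar p = Suc (length zs) \<Longrightarrow> F ys = G ys"
  shows "insertion p K F zs = insertion p K G zs"
  unfolding insertion_def insert_at_def
  by (intro sum.cong refl arg_cong2[of _ _ _ _ scale] assms) auto

lemma prod_eps: "(\<Prod>w\<leftarrow>ws. eps n (fst w) z) =
    (- 1) ^ length ws * sg n (sum_list (map fst (ws :: 'v graded_list))) z"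
  by (induction ws) (simp_all add: eps_def sg_add_left)

text \<open>
  A block counts as one argument of the outer map and as \<open>k + 1\<close> arguments of the composite; the two
  exchange signs differ by the sign of moving \<open>K\<close> itself.  This is what the sign in the definition of
  \<open>j\<close> is made for.
\<close>
lemma eps_block:
  assumes "- 1 \<le> p 0" "length ws = ar p"
  shows "eps n (fst (block p K ws)) z = pass_sign p z * (\<Prod>w\<leftarrow>ws. eps n (fst w) z)"
proof -
  define a :: 'k where "a = (- 1) powi p 0"
  have a: "a * a = 1" unfolding a_def by (rule minus_one_powi_square)
  have "(- 1 :: 'k) ^ ar p = (- 1) powi (p 0 + 1)"
    using assms by (simp add: ar_def power_int_nonneg_exp)
  also have "\<dots> = - a"
    by (simp add: power_int_add a_def)
  finally have "pass_sign p z * (\<Prod>w\<leftarrow>ws. eps n (fst w) z) =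
      - ((a * a) * (sg n (sum_list (map fst ws)) z * sg n (wt p) z))"
    using assms by (simp add: prod_eps pass_sign_def mult_ac flip: a_def)
  also have "\<dots> = eps n (fst (block p K ws)) z"
    by (simp add: a block_def eps_def sg_add_left)
  finally show ?thesis ..
qed

text \<open>
  Exchanging slots \<open>r\<close> and \<open>r + 1\<close> of \<open>F\<close> amounts, if neither holds the block, to an adjacent
  transposition of the arguments, whose positions are shifted by \<open>ar p - 1\<close> if the block stands
  to their left.  Otherwise it carries the block from one of these slots to the other, past a single
  argument.
\<close>
lemma insert_at_swap:
  assumes p: "- 1 \<le> p 0" and r: "Suc r + ar p \<le> m" and i: "i + ar p \<le> m"
  shows "alteq m (insert_at p K i (act (transpose r (Suc r)) F)) (insert_at p K (transpose r (Suc r) i) F)"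
proof -
  let ?s = "transpose r (Suc r)"
  have move: "alteq m (insert_at p K r (act ?s F)) (insert_at p K (Suc r) F)" for F
  proof (rule alteq_move)
    fix us ws vs :: "'v graded_list" and z :: "(nat \<Rightarrow> int) \<times> 'v"
    assume len: "length us = r" "length ws = ar p" "r + ar p + 1 + length vs = m"
    have "insert_at p K r (act ?s F) (us @ ws @ z # vs) =
        scale (pass_signs p us * eps n (fst (block p K ws)) (fst z)) (F (us @ z # block p K ws # vs))"
      using len act_adjacent[of us F "block p K ws" z vs] by (simp add: insert_at_split)
    also have "\<dots> = scale (\<Prod>w\<leftarrow>ws. eps n (fst w) (fst z)) (insert_at p K (Suc r) F (us @ z # ws @ vs))"
      using len insert_at_split[of "us @ [z]" "Suc r" ws p K F vs] eps_block[OF p len(2)]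
      by (simp add: mult_ac)
    finally show "insert_at p K r (act ?s F) (us @ ws @ z # vs) = \<dots>" .
  qed (use r in simp)
  consider "i < r" | "i = r" | "i = Suc r" | "Suc r < i" by linarith
  then show ?thesis
  proof cases
    case 1
    have "alteq m (insert_at p K i (act ?s F)) (insert_at p K i F)"
    proof (rule alteq_swap)
      fix us vs :: "'v graded_list" and a b :: "(nat \<Rightarrow> int) \<times> 'v"
      assume len: "length us = r + ar p - 1" "length us + 2 + length vs = m"
      then have "i + ar p \<le> length us" using 1 by linarith
      then obtain us1 ws us2 where us: "us = us1 @ ws @ us2" "length us1 = i" "length ws = ar p"
        by (rule split_block)
      then have "length (us1 @ block p K ws # us2) = r" using len 1 by simp
      then show "insert_at p K i (act ?s F) (us @ a # b # vs) =
          scale (eps n (fst a) (fst b)) (insert_at p K i F (us @ b # a # vs))"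
        using us act_adjacent[of "us1 @ block p K ws # us2" F a b vs]
        by (simp add: insert_at_split mult.commute)
    qed (use 1 r in simp)
    with 1 show ?thesis by simp
  next
    case 2
    then show ?thesis using move by simp
  next
    case 3
    \<comment> \<open>The same move read backwards: exchanging the two slots twice gives \<open>F\<close> again.\<close>
    have "alteq m (insert_at p K r F) (insert_at p K r (act ?s (act ?s F)))"
    proof (rule alteq_refl)
      fix zs :: "'v graded_list"
      assume "length zs = m"
      then show "insert_at p K r F zs = insert_at p K r (act ?s (act ?s F)) zs"
        unfolding insert_at_def using r by (subst act_adjacent_twice) auto
    qed
    also have "alteq m \<dots> (insert_at p K (Suc r) (act ?s F))" by (rule move)
    finally show ?thesis using 3 by (simp add: alteq_sym)
  next
    case 4
    have "alteq m (insert_at p K i (act ?s F)) (insert_at p K i F)"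
    proof (rule alteq_swap)
      fix us vs :: "'v graded_list" and a b :: "(nat \<Rightarrow> int) \<times> 'v"
      assume len: "length us = r" "length us + 2 + length vs = m"
      then have "(i - r - 2) + ar p \<le> length vs" using 4 i by linarith
      then obtain vs1 ws vs2 where vs: "vs = vs1 @ ws @ vs2" "length vs1 = i - r - 2" "length ws = ar p"
        by (rule split_block)
      then show "insert_at p K i (act ?s F) (us @ a # b # vs) =
          scale (eps n (fst a) (fst b)) (insert_at p K i F (us @ b # a # vs))"
        using 4 len act_adjacent[of us F a b "vs1 @ block p K ws # vs2"]
          insert_at_split[of "us @ a # b # vs1" i ws p K "act ?s F" vs2]
          insert_at_split[of "us @ b # a # vs1" i ws p K F vs2]
        by (simp add: mult_ac)
    qed (use r 4 i in simp)
    with 4 show ?thesis by simp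
  qed
qed

lemma alteq_insertion_act:
  assumes p: "- 1 \<le> p 0" and m: "ar p \<le> m" and \<sigma>: "\<sigma> permutes {..<Suc (m - ar p)}"
  shows "alteq m (insertion p K (act \<sigma> F)) (insertion p K F)"
  using \<sigma>
proof (induction arbitrary: F rule: permutes_adjacent_induct)
  case id
  have "act id F = F" by (rule ext) (rule act_id)
  then show ?case by (metis alteq_refl)
next
  case (swap r \<sigma>)
  let ?s = "transpose r (Suc r)"
  have r: "Suc r + ar p \<le> m" using swap.hyps(1) m by simp
  have "alteq m (insertion p K (act (?s \<circ> \<sigma>) F)) (insertion p K (act ?s (act \<sigma> F)))"
  proof (intro alteq_refl insertion_cong)
    fix zs ys :: "'v graded_list"
    assume "length zs = m" "length ys + ar p = Suc (length zs)"
    then have "length ys = Suc (m - ar p)" using m by simp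
    then show "act (?s \<circ> \<sigma>) F ys = act ?s (act \<sigma> F) ys"
      using swap.hyps by (subst act_act) (simp_all add: transpose_adjacent_permutes)
  qed
  also have "alteq m (insertion p K (act ?s G)) (insertion p K G)" for G
  proof -
    have "alt (insertion p K (act ?s G)) zs = alt (insertion p K G) zs" if zs: "length zs = m" for zs
    proof -
      have insertion: "alt (insertion p K G) zs = (\<Sum>i | i + ar p \<le> m. alt (insert_at p K i G) zs)" for G
        unfolding alt_sum[symmetric] by (rule alt_cong) (simp add: insertion_def zs)
      have "(\<Sum>i | i + ar p \<le> m. alt (insert_at p K i (act ?s G)) zs) =
          (\<Sum>i | i + ar p \<le> m. alt (insert_at p K (?s i) G) zs)"
        using insert_at_swap[OF p r] zs by (intro sum.cong) (auto simp: alteq_def)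
      also have "\<dots> = (\<Sum>i | i + ar p \<le> m. alt (insert_at p K i G) zs)"
        by (rule sum.reindex_bij_witness[where i = ?s and j = ?s])
          (use r in \<open>auto simp: transpose_def\<close>)
      finally show ?thesis by (simp add: insertion)
    qed
    then show ?thesis by (simp add: alteq_def)
  qed
  also have "alteq m (insertion p K (act \<sigma> F)) (insertion p K F)" by (rule swap.IH)
  finally show ?case .
qed

text \<open>The outer map is only evaluated on lists of one length, so its alternation is one fixed average.\<close>
lemma insertion_average:
  assumes "ar p \<le> length zs"
  shows "insertion p K (alt F) zs = scale (1 / fact (Suc (length zs - ar p)))
    (\<Sum>\<sigma> | \<sigma> permutes {..<Suc (length zs - ar p)}. insertion p K (act \<sigma> F) zs)"
proof -
  let ?q = "Suc (length zs - ar p)"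
  have "insert_at p K i (alt F) zs =
      scale (1 / fact ?q) (\<Sum>\<sigma> | \<sigma> permutes {..<?q}. insert_at p K i (act \<sigma> F) zs)"
    if "i + ar p \<le> length zs" for i
  proof -
    have "length (take i zs @ block p K (take (ar p) (drop i zs)) # drop (i + ar p) zs) = ?q"
      using that by simp
    then show ?thesis
      unfolding insert_at_def alt_def
      by (simp add: scale_sum_right mult.commute del: length_append)
  qed
  then show ?thesis
    unfolding insertion_def by (subst sum.swap) (simp add: scale_sum_right)
qed

lemma alteq_insertion_alt_right:
  assumes "- 1 \<le> p 0" "ar p \<le> m"
  shows "alteq m (insertion p K (alt F)) (insertion p K F)"
proof -
  have "alteq m (insertion p K (alt F)) (\<lambda>zs. scale (1 / fact (Suc (m - ar p)))
    (\<Sum>\<sigma> | \<sigma> permutes {..<Suc (m - ar p)}. insertion p K (act \<sigma> F) zs))"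
    using assms by (intro alteq_refl) (simp add: insertion_average)
  also have "alteq m \<dots> (insertion p K F)"
    by (intro alteq_average alteq_insertion_act assms)
  finally show ?thesis .
qed

lemma slot_linear_add: "slot_linear F \<Longrightarrow> F (us @ (x, X + Y) # vs) = F (us @ (x, X) # vs) + F (us @ (x, Y) # vs)"
  and slot_linear_scale: "slot_linear F \<Longrightarrow> F (us @ (x, scale c X) # vs) = scale c (F (us @ (x, X) # vs))"
  by (simp_all add: slot_linear_def)

lemma slot_linear_zero: "slot_linear F \<Longrightarrow> F (us @ (x, 0) # vs) = 0"
  using slot_linear_scale[of F us x 0 0 vs] by simp

lemma slot_linear_diff:
  assumes "slot_linear F"
  shows "F (us @ (x, X - Y) # vs) = F (us @ (x, X) # vs) - F (us @ (x, Y) # vs)"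
  using slot_linear_add[OF assms, of us x "X - Y" Y vs] by simp

lemma slot_linear_sum:
  assumes "slot_linear F"
  shows "F (us @ (x, \<Sum>a\<in>A. X a) # vs) = (\<Sum>a\<in>A. F (us @ (x, X a) # vs))"
  by (induction A rule: infinite_finite_induct) (simp_all add: slot_linear_zero slot_linear_add assms)

text \<open>Permuting the arguments of the inner map permutes those of the composite inside the block.\<close>
lemma alteq_insert_at_act:
  assumes m: "i + ar p \<le> m" and F: "slot_linear F" and \<sigma>: "\<sigma> permutes {..<ar p}"
  shows "alteq m (insert_at p (act \<sigma> K) i F) (insert_at p K i F)"
  using \<sigma>
proof (induction arbitrary: K rule: permutes_adjacent_induct)
  case id
  have "act id K = K" by (rule ext) (rule act_id)
  then show ?case by (metis alteq_refl)
next
  case (swap r \<sigma>)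
  let ?s = "transpose r (Suc r)"
  have "alteq m (insert_at p (act (?s \<circ> \<sigma>) K) i F) (insert_at p (act ?s (act \<sigma> K)) i F)"
    using swap.hyps m
    by (intro alteq_refl) (simp add: insert_at_def block_def act_act transpose_adjacent_permutes)
  also have "alteq m (insert_at p (act ?s K) i F) (insert_at p K i F)" for K
  proof (rule alteq_swap)
    fix us vs :: "'v graded_list" and a b :: "(nat \<Rightarrow> int) \<times> 'v"
    assume len: "length us = i + r" "length us + 2 + length vs = m"
    obtain us1 us2 where us: "us = us1 @ us2" "length us1 = i" "length us2 = r"
      using len that by (metis append_take_drop_id length_drop length_take min.absorb2 add_diff_cancel_left' le_add1)
    have "length (drop (ar p - r - 2) vs) + (ar p - r - 2) = length vs"
      using len swap.hyps m by simp
    define vs1 vs2 where "vs1 = take (ar p - r - 2) vs" and "vs2 = drop (ar p - r - 2) vs"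
    have vs: "vs = vs1 @ vs2" "length vs1 = ar p - r - 2"
      using len swap.hyps m by (simp_all add: vs1_def vs2_def)
    have "insert_at p (act ?s K) i F (us @ a # b # vs) =
        scale (pass_signs p us1) (F (us1 @ block p (act ?s K) (us2 @ a # b # vs1) # vs2))"
      using insert_at_split[of us1 i "us2 @ a # b # vs1" p "act ?s K" F vs2] us vs swap.hyps by simp
    also have "\<dots> = scale (eps n (fst a) (fst b))
        (scale (pass_signs p us1) (F (us1 @ block p K (us2 @ b # a # vs1) # vs2)))"
      using act_adjacent[of us2 K a b vs1] us
      by (simp add: block_def slot_linear_scale[OF F] add_ac mult.commute)
    also have "scale (pass_signs p us1) (F (us1 @ block p K (us2 @ b # a # vs1) # vs2)) =
        insert_at p K i F (us @ b # a # vs)"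
      using insert_at_split[of us1 i "us2 @ b # a # vs1" p K F vs2] us vs swap.hyps by simp
    finally show "insert_at p (act ?s K) i F (us @ a # b # vs) =
        scale (eps n (fst a) (fst b)) (insert_at p K i F (us @ b # a # vs))" .
  qed (use swap.hyps m in simp)
  also have "alteq m (insert_at p (act \<sigma> K) i F) (insert_at p K i F)" by (rule swap.IH)
  finally show ?case .
qed

lemma alteq_insertion_alt_left:
  assumes "slot_linear F"
  shows "alteq m (insertion p (alt K) F) (insertion p K F)"
proof -
  have "alteq m (insert_at p (alt K) i F) (insert_at p K i F)" if "i + ar p \<le> m" for i
  proof -
    have "alteq m (insert_at p (alt K) i F) (\<lambda>zs. scale (1 / fact (ar p))
        (\<Sum>\<sigma> | \<sigma> permutes {..<ar p}. insert_at p (act \<sigma> K) i F zs))"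
      using that
      by (intro alteq_refl)
        (simp add: insert_at_def block_def alt_def slot_linear_scale slot_linear_sum assms scale_sum_right mult.commute)
    also have "alteq m \<dots> (insert_at p K i F)"
      by (intro alteq_average alteq_insert_at_act assms that)
    finally show ?thesis .
  qed
  then have "alt (insertion p (alt K) F) zs = alt (insertion p K F) zs" if "length zs = m" for zs
  proof -
    have insertion: "alt (insertion p K F) zs = (\<Sum>i | i + ar p \<le> m. alt (insert_at p K i F) zs)" for K
      unfolding alt_sum[symmetric] by (rule alt_cong) (simp add: insertion_def that)
    show ?thesis
      unfolding insertion using \<open>\<And>i. i + ar p \<le> m \<Longrightarrow> alteq m (insert_at p (alt K) i F) (insert_at p K i F)\<close> that
      by (intro sum.cong) (auto simp: alteq_def)
  qed
  then show ?thesis by (simp add: alteq_def)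
qed

lemma wt_add: "wt (p + q) = wt p + wt q"
  by (simp add: wt_def fun_eq_iff plus_fun_apply)

lemma pass_sign_add: "pass_sign (p + q) x = pass_sign p x * pass_sign q x"
  by (simp add: pass_sign_def wt_add sg_add_left power_int_add plus_fun_apply mult_ac)

lemma pass_signs_add: "pass_signs (p + q) us = pass_signs p us * pass_signs q us"
  by (induction us) (simp_all add: pass_sign_add mult_ac)

lemma pass_signs_eq: "pass_signs q ws = (- 1) powi (q 0 * int (length ws)) * sg n (wt q) (sum_list (map fst ws))"
  by (induction ws) (simp_all add: pass_sign_def sg_add_right power_int_add distrib_left mult_ac)

abbreviation csg :: "(nat \<Rightarrow> int) \<Rightarrow> (nat \<Rightarrow> int) \<Rightarrow> 'k" where
  "csg \<equiv> sg (Suc n)"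

section \<open>The pre-Lie identity\<close>

text \<open>
  Passing a block means passing the map in it and all its arguments, which produces the sign
  \<open>(-1)\<^sup>\<langle>\<^sup>p\<^sup>,\<^sup>q\<^sup>\<rangle>\<close> for the full degrees in \<open>\<int>\<^sup>n\<^sup>+\<^sup>1\<close>.
\<close>
lemma pass_sign_block:
  assumes "- 1 \<le> p 0" "length ws = ar p"
  shows "pass_sign q (fst (block p K ws)) = csg p q * pass_signs q ws"
proof -
  have "(- 1 :: 'k) powi q 0 = (- 1) powi (p 0 * q 0 + q 0 * int (ar p))"
    using assms by (auto simp: ar_def power_int_minus_left algebra_simps)
  then show ?thesis
    using assms
    by (simp add: pass_sign_def pass_signs_eq sg_Suc block_def sg_add_right power_int_add sg_commute[of n "wt p"] mult_ac
        flip: wt_def)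
qed

definition arity :: "nat \<Rightarrow> ('v graded_list \<Rightarrow> 'v) \<Rightarrow> bool" where
  "arity m K \<longleftrightarrow> (\<forall>zs. length zs \<noteq> m \<longrightarrow> K zs = 0)"

text \<open>
  One term of \<open>insertion p K (insertion q L F)\<close>: first \<open>K\<close> is applied to a block starting at
  position \<open>i\<close>, then \<open>L\<close> to a block starting at position \<open>j\<close> of the shortened list, in which the
  first block is a single entry.
\<close>
definition insert_twice where
  "insert_twice p K q L F zs i j = scale (pass_signs p (take i zs))
     (insert_at q L j F (take i zs @ block p K (take (ar p) (drop i zs)) # drop (i + ar p) zs))"

lemma insert_twice_split:
  assumes "length us = i" "length ws = ar p"
  shows "insert_twice p K q L F (us @ ws @ vs) i j = scale (pass_signs p us) (insert_at q L j F (us @ block p K ws # vs))"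
  using assms by (simp add: insert_twice_def)

text \<open>
  The three sums are over the terms in which the block of \<open>K\<close> lies to the left of the arguments of
  \<open>L\<close>, among them, or to their right.
\<close>
lemma insertion_insertion:
  "insertion p K (insertion q L F) zs =
    (\<Sum>(i, j)\<in>{(i, j). i + ar p \<le> length zs \<and> i < j \<and> j + ar p + ar q \<le> Suc (length zs)}. insert_twice p K q L F zs i j) +
    (\<Sum>(i, j)\<in>{(i, j). i + ar p \<le> length zs \<and> j \<le> i \<and> i < j + ar q \<and> j + ar p + ar q \<le> Suc (length zs)}. insert_twice p K q L F zs i j) +
    (\<Sum>(i, j)\<in>{(i, j). i + ar p \<le> length zs \<and> j + ar q \<le> i}. insert_twice p K q L F zs i j)"
  (is "_ = sum ?t ?A + sum ?t ?B + sum ?t ?C")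
proof -
  let ?S = "Sigma {i. i + ar p \<le> length zs} (\<lambda>i. {j. j + ar p + ar q \<le> Suc (length zs)})"
  have fin: "finite ?S"
    by (intro finite_SigmaI finite_slots) (simp add: add.assoc)
  have eq: "?S = (?A \<union> ?B) \<union> ?C" by auto
  have "insertion p K (insertion q L F) zs = sum ?t ?S"
    unfolding insertion_def
    by (subst sum.Sigma[symmetric])
      (auto simp: insert_twice_def insert_at_def[of p K] scale_sum_right add.assoc intro!: sum.cong)
  also have "\<dots> = sum ?t ?A + sum ?t ?B + sum ?t ?C"
    unfolding eq using fin[unfolded eq]
    by (subst sum.union_disjoint; (subst sum.union_disjoint)?) auto
  finally show ?thesis .
qed

text \<open>
  Terms with disjoint blocks occur for both orders of insertion.  If \<open>K\<close> stands on the left, then \<open>L\<close>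
  passes the block of \<open>K\<close> in one order but only its arguments in the other, which accounts for the
  sign; the position of \<open>L\<close> is \<open>j\<close> with the block counted as one entry and \<open>j + ar p - 1\<close> without.
\<close>
lemma insertion_insertion_apart:
  assumes p: "- 1 \<le> p 0"
  shows "(\<Sum>(i, j)\<in>{(i, j). i + ar p \<le> length zs \<and> i < j \<and> j + ar p + ar q \<le> Suc (length zs)}. insert_twice p K q L F zs i j) =
    scale (csg p q) (\<Sum>(i, j)\<in>{(i, j). i + ar q \<le> length zs \<and> j + ar p \<le> i}. insert_twice q L p K F zs i j)"
  unfolding scale_sum_right
proof (rule sum.reindex_bij_witness[where i = "\<lambda>(i, j). (j, Suc i - ar p)" and j = "\<lambda>(i, j). (j + ar p - 1, i)"],
    goal_cases)
  case (5 ij)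
  then obtain i j where ij: "ij = (i, j)" "i < j" "j + ar p + ar q \<le> Suc (length zs)" by auto
  define us where "us = take i zs"
  define ws where "ws = take (ar p) (drop i zs)"
  define ms where "ms = take (j - i - 1) (drop (i + ar p) zs)"
  define ws' where "ws' = take (ar q) (drop (j + ar p - 1) zs)"
  define vs where "vs = drop (j + ar p - 1 + ar q) zs"
  have len: "length us = i" "length ws = ar p" "length ms = j - i - 1" "length ws' = ar q"
    using ij by (simp_all add: us_def ws_def ms_def ws'_def)
  have zs: "zs = us @ ws @ ms @ ws' @ vs"
  proof -
    have "drop (j + ar p - 1) zs = ws' @ vs"
      unfolding ws'_def vs_def by (metis append_take_drop_id drop_drop add.commute)
    moreover have "drop (i + ar p) zs = ms @ drop (j + ar p - 1) zs"
    proof -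
      have "drop (j - i - 1) (drop (i + ar p) zs) = drop (j + ar p - 1) zs"
        using ij by (simp add: add.commute)
      then show ?thesis unfolding ms_def by (metis append_take_drop_id)
    qed
    moreover have "zs = us @ ws @ drop (i + ar p) zs"
      unfolding us_def ws_def by (metis append_take_drop_id drop_drop add.commute)
    ultimately show ?thesis by simp
  qed
  have lenb: "length (us @ block p K ws # ms) = j" "length (us @ ws @ ms) = j + ar p - 1"
    using ij len by simp_all
  have "insert_twice p K q L F zs i j = scale (pass_signs p us) (insert_at q L j F ((us @ block p K ws # ms) @ ws' @ vs))"
    unfolding zs using insert_twice_split[OF len(1,2), of K q L F "ms @ ws' @ vs"] by simp
  also have "\<dots> = scale (csg p q) (scale (pass_signs q us * pass_signs q ws * pass_signs q ms)
      (scale (pass_signs p us) (F (us @ block p K ws # ms @ block q L ws' # vs))))"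
    unfolding insert_at_split[OF lenb(1) len(4)] using pass_sign_block[OF p len(2)]
    by (simp add: mult_ac)
  also have "\<dots> = scale (csg p q) (insert_twice q L p K F zs (j + ar p - 1) i)"
    unfolding zs using insert_twice_split[OF lenb(2) len(4), of L p K F vs]
      insert_at_split[OF len(1,2), of K F "ms @ block q L ws' # vs"]
    by (simp add: mult.assoc)
  finally show ?case using ij by simp
qed auto

text \<open>
  If \<open>K\<close> falls among the arguments of \<open>L\<close>, the composite of the two is itself inserted into \<open>F\<close>, at
  the position of \<open>L\<close>.  For a constant \<open>L\<close> both sides vanish for lack of a slot.
\<close>
lemma insertion_insertion_nested:
  assumes p: "- 1 \<le> p 0" and q: "- 1 \<le> q 0" and F: "slot_linear F"
    and L: "arity (ar q) L"
  shows "(\<Sum>(i, j)\<in>{(i, j). i + ar p \<le> length zs \<and> j \<le> i \<and> i < j + ar q \<and> j + ar p + ar q \<le> Suc (length zs)}. insert_twice p K q L F zs i j) =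
    insertion (p + q) (insertion p K L) F zs"
proof (cases "ar q = 0")
  case True
  have "insertion p K L ws = 0" for ws
    by (simp add: insertion_def insert_at_def True L[unfolded arity_def])
  then have "insertion (p + q) (insertion p K L) F zs = 0"
    by (simp add: insertion_def[of "p + q"] insert_at_def[of "p + q"] block_def slot_linear_zero[OF F])
  moreover have "{(i, j). i + ar p \<le> length zs \<and> j \<le> i \<and> i < j + ar q \<and> j + ar p + ar q \<le> Suc (length zs)} = {}"
    using True by auto
  ultimately show ?thesis by (simp only: sum.empty)
next
  case False
  then have ar: "ar (p + q) = ar p + ar q - 1"
    using p q by (simp add: ar_def plus_fun_apply)
  let ?t = "\<lambda>j k. scale (pass_signs (p + q) (take j zs)) (F (take j zs @
      (sum_list (map fst (take (ar (p + q)) (drop j zs))) + wt (p + q),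
       insert_at p K k L (take (ar (p + q)) (drop j zs))) # drop (j + ar (p + q)) zs))"
  have "insertion (p + q) (insertion p K L) F zs =
      (\<Sum>j | j + ar (p + q) \<le> length zs. \<Sum>k | k + ar p \<le> ar (p + q). ?t j k)"
    unfolding insertion_def[of "p + q"] insert_at_def[of "p + q"] block_def[of "p + q"]
    by (intro sum.cong refl) (simp add: insertion_def slot_linear_sum[OF F] scale_sum_right)
  also have "\<dots> = (\<Sum>(j, k)\<in>Sigma {j. j + ar (p + q) \<le> length zs} (\<lambda>j. {k. k + ar p \<le> ar (p + q)}). ?t j k)"
    by (rule sum.Sigma) auto
  also have "\<dots> = (\<Sum>(i, j)\<in>{(i, j). i + ar p \<le> length zs \<and> j \<le> i \<and> i < j + ar q \<and> j + ar p + ar q \<le> Suc (length zs)}. insert_twice p K q L F zs i j)"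
  proof (rule sum.reindex_bij_witness[where j = "\<lambda>(j, k). (j + k, j)" and i = "\<lambda>(i, j). (j, i - j)"],
      goal_cases)
    case (5 jk)
    then obtain j k where jk: "jk = (j, k)" "j + (ar p + ar q - 1) \<le> length zs" "k + ar p \<le> ar p + ar q - 1"
      by (auto simp: ar)
    obtain us w vs where zs: "zs = us @ w @ vs" "length us = j" "length w = ar p + ar q - 1"
      using jk(2) by (rule split_block)
    have "k + ar p \<le> length w" using jk zs by simp
    then obtain ws1 ws ws2 where w: "w = ws1 @ ws @ ws2" "length ws1 = k" "length ws = ar p"
      by (rule split_block)
    have lenb: "length (us @ ws1) = j + k" "length (ws1 @ block p K ws # ws2) = ar q"
      using zs w False jk by simp_all
    have t: "?t j k = scale (pass_signs (p + q) us) (F (us @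
      (sum_list (map fst w) + wt (p + q), insert_at p K k L w) # vs))"
      using zs by (simp add: ar)
    have "insert_twice p K q L F zs (j + k) j =
        scale (pass_signs p us * pass_signs p ws1) (insert_at q L j F (us @ (ws1 @ block p K ws # ws2) @ vs))"
      using insert_twice_split[OF lenb(1) w(3), of K q L F "ws2 @ vs" j] zs w by simp
    also have "\<dots> = scale (pass_signs (p + q) us) (scale (pass_signs p ws1) (F (us @ block q L (ws1 @ block p K ws # ws2) # vs)))"
      unfolding insert_at_split[OF zs(2) lenb(2)] by (simp add: pass_signs_add mult_ac)
    also have "\<dots> = ?t j k"
      unfolding t unfolding w(1) insert_at_split[OF w(2,3)]
      by (simp add: block_def slot_linear_scale[OF F] wt_add add_ac)
    finally show ?case using jk by simp
  qed (use False in \<open>auto simp: ar\<close>)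
  finally show ?thesis ..
qed

definition commutator ::
  "(nat \<Rightarrow> int) \<Rightarrow> ('v graded_list \<Rightarrow> 'v) \<Rightarrow> (nat \<Rightarrow> int) \<Rightarrow> ('v graded_list \<Rightarrow> 'v) \<Rightarrow> 'v graded_list \<Rightarrow> 'v" where
  "commutator p K q L zs = insertion p K L zs - scale (csg p q) (insertion q L K zs)"

lemma insertion_diff_left:
  assumes "slot_linear F"
  shows "insertion p (\<lambda>zs. K zs - L zs) F zs = insertion p K F zs - insertion p L F zs"
  by (simp add: insertion_def insert_at_def block_def slot_linear_diff[OF assms] scale_right_diff_distrib sum_subtractf)

lemma insertion_scale_left:
  assumes "slot_linear F"
  shows "insertion p (\<lambda>zs. scale c (K zs)) F zs = scale c (insertion p K F zs)"
  by (simp add: insertion_def insert_at_def block_def slot_linear_scale[OF assms] scale_sum_right mult.commute)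

lemma insertion_diff_right: "insertion p K (\<lambda>zs. F zs - G zs) zs = insertion p K F zs - insertion p K G zs"
  by (simp add: insertion_def insert_at_def scale_right_diff_distrib sum_subtractf)

lemma insertion_scale_right: "insertion p K (\<lambda>zs. scale c (F zs)) zs = scale c (insertion p K F zs)"
  by (simp add: insertion_def insert_at_def scale_sum_right mult.commute)

text \<open>The disjoint terms cancel, and only the nested ones survive.\<close>
lemma insertion_pre_Lie:
  assumes p: "- 1 \<le> p 0" and q: "- 1 \<le> q 0" and F: "slot_linear F"
    and K: "arity (ar p) K"
    and L: "arity (ar q) L"
  shows "insertion (p + q) (commutator p K q L) F zs =
    insertion p K (insertion q L F) zs - scale (csg p q) (insertion q L (insertion p K F) zs)"
proof -
  have "insertion (p + q) (commutator p K q L) F zs =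
      insertion (p + q) (insertion p K L) F zs - scale (csg p q) (insertion (p + q) (insertion q L K) F zs)"
    unfolding commutator_def by (simp add: insertion_diff_left[OF F] insertion_scale_left[OF F])
  moreover have "insertion (p + q) (insertion q L K) F zs = insertion (q + p) (insertion q L K) F zs"
    by (simp add: add.commute)
  ultimately show ?thesis
    unfolding insertion_insertion[of p] insertion_insertion[of q] insertion_insertion_apart[of p, OF p] insertion_insertion_apart[of q, OF q]
      insertion_insertion_nested[where p = p and q = q and L = L, OF p q F L]
      insertion_insertion_nested[where p = q and q = p and L = K, OF q p F K]
    by (simp add: scale_right_distrib sg_commute[of "Suc n" q p])
qed

text \<open>
  The commutator of a pre-Lie product satisfies the Jacobi identity: expand all double commutators
  into double insertions, each of which then occurs twice with opposite signs.
\<close>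
lemma commutator_Jacobi:
  assumes deg: "- 1 \<le> p 0" "- 1 \<le> q 0" "- 1 \<le> r 0"
    and K: "arity (ar p) K" "slot_linear K"
    and L: "arity (ar q) L" "slot_linear L"
    and M: "arity (ar r) M" "slot_linear M"
  shows "commutator p K (q + r) (commutator q L r M) zs =
    commutator (p + q) (commutator p K q L) r M zs + scale (csg p q) (commutator q L (p + r) (commutator p K r M) zs)"
proof -
  have *: "insertion p' K' (commutator q' L' r' M') zs =
      insertion p' K' (insertion q' L' M') zs - scale (csg q' r') (insertion p' K' (insertion r' M' L') zs)" for p' K' q' L' r' M'
    unfolding commutator_def[of q'] by (simp add: insertion_diff_right insertion_scale_right)
  show ?thesis
    unfolding commutator_def[of p K "q + r"] commutator_def[of "p + q"] commutator_def[of q L "p + r"]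
      insertion_pre_Lie[where p = q and q = r and K = L and L = M, OF deg(2,3) K(2) L(1) M(1)]
      insertion_pre_Lie[where p = p and q = q and K = K and L = L, OF deg(1,2) M(2) K(1) L(1)]
      insertion_pre_Lie[where p = p and q = r and K = K and L = M, OF deg(1,3) L(2) K(1) M(1)] *
    by (simp add: algebra_simps sg_add_right sg_add_left sg_commute[of "Suc n" q p]
       )
qed

section \<open>Linearity of alternation and insertion in each slot\<close>

definition is_linear :: "('v \<Rightarrow> 'v) \<Rightarrow> bool" where
  "is_linear g \<longleftrightarrow> (\<forall>X Y. g (X + Y) = g X + g Y) \<and> (\<forall>c X. g (scale c X) = scale c (g X))"

lemma slot_linear_iff_is_linear: "slot_linear F \<longleftrightarrow> (\<forall>us x vs. is_linear (\<lambda>X. F (us @ (x, X) # vs)))"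
  by (auto simp: slot_linear_def is_linear_def)

lemma slot_linearD: "slot_linear F \<Longrightarrow> is_linear (\<lambda>X. F (us @ (x, X) # vs))"
  by (simp add: slot_linear_iff_is_linear)

lemma is_linear_sum: "(\<And>a. a \<in> A \<Longrightarrow> is_linear (g a)) \<Longrightarrow> is_linear (\<lambda>X. \<Sum>a\<in>A. g a X)"
  by (simp add: is_linear_def sum.distrib scale_sum_right)

lemma is_linear_scale: "is_linear g \<Longrightarrow> is_linear (\<lambda>X. scale c (g X))"
  by (simp add: is_linear_def scale_right_distrib mult.commute)

lemma is_linear_diff: "is_linear g \<Longrightarrow> is_linear h \<Longrightarrow> is_linear (\<lambda>X. g X - h X)"
  by (simp add: is_linear_def scale_right_diff_distrib)

lemma is_linear_comp: "is_linear g \<Longrightarrow> is_linear h \<Longrightarrow> is_linear (\<lambda>X. g (h X))"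
  by (simp add: is_linear_def)

lemma slot_linear_update:
  assumes "slot_linear F" "i < length zs"
  shows "is_linear (\<lambda>X. F (zs[i := (x, X)]))"
  using slot_linearD[OF assms(1), of "take i zs" x "drop (Suc i) zs"] assms(2)
  by (simp add: upd_conv_take_nth_drop)

lemma permute_list_update:
  assumes \<sigma>: "\<sigma> permutes {..<length zs}" and i: "i < length zs"
  shows "permute_list \<sigma> (zs[i := z]) = (permute_list \<sigma> zs)[inv \<sigma> i := z]"
proof (rule nth_equalityI)
  fix j assume j: "j < length (permute_list \<sigma> (zs[i := z]))"
  have "inv \<sigma> i = j \<longleftrightarrow> \<sigma> j = i" using permutes_inv_eq[OF \<sigma>] by auto
  then show "permute_list \<sigma> (zs[i := z]) ! j = (permute_list \<sigma> zs)[inv \<sigma> i := z] ! j"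
    using \<sigma> i j permutes_in_image[OF \<sigma>, of j]
    by (auto simp: permute_list_nth nth_list_update)
qed simp

lemma slot_linear_alt:
  assumes F: "slot_linear F"
  shows "slot_linear (alt F)"
  unfolding slot_linear_iff_is_linear
proof (intro allI)
  fix us vs :: "'v graded_list" and x
  define zs where "zs = us @ (x, 0) # vs"
  have upd: "us @ (x, X) # vs = zs[length us := (x, X)]" for X by (simp add: zs_def)
  have len: "length us < length zs" by (simp add: zs_def)
  have "is_linear (\<lambda>X. act \<sigma> F (zs[length us := (x, X)]))" if \<sigma>: "\<sigma> permutes {..<length zs}" for \<sigma>
  proof -
    have "inv \<sigma> (length us) < length (permute_list \<sigma> zs)"
      using permutes_in_image[OF permutes_inv[OF \<sigma>], of "length us"] len by simp
    then have "is_linear (\<lambda>X. F ((permute_list \<sigma> zs)[inv \<sigma> (length us) := (x, X)]))"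
      by (rule slot_linear_update[OF F])
    moreover have "permute_list \<sigma> (zs[length us := (x, X)]) =
        (permute_list \<sigma> zs)[inv \<sigma> (length us) := (x, X)]" for X
      by (rule permute_list_update[OF \<sigma> len])
    moreover have "map fst (zs[length us := (x, X)]) = map fst zs" for X
      by (simp add: zs_def)
    ultimately show ?thesis by (simp only: act_def is_linear_scale)
  qed
  then show "is_linear (\<lambda>X. alt F (us @ (x, X) # vs))"
    unfolding alt_def upd length_list_update
    by (intro is_linear_scale is_linear_sum) simp
qed

text \<open>The varying argument lies right of the block, in it, or left of it.\<close>
lemma slot_linear_insertion:
  assumes K: "slot_linear K" and F: "slot_linear F"
  shows "slot_linear (insertion p K F)"
  unfolding slot_linear_iff_is_linear
proof (intro allI)
  fix us vs :: "'v graded_list" and x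
  have "is_linear (\<lambda>X. insert_at p K i F (us @ (x, X) # vs))" if i: "i + ar p \<le> length us + Suc (length vs)" for i
  proof -
    consider "i + ar p \<le> length us" | "i \<le> length us" "length us < i + ar p" | "length us < i"
      by linarith
    then show ?thesis
    proof cases
      case 1
      then obtain u1 ws u2 where us: "us = u1 @ ws @ u2" "length u1 = i" "length ws = ar p"
        by (rule split_block)
      then show ?thesis
        using slot_linearD[OF F, of "u1 @ block p K ws # u2" x vs]
        by (simp add: insert_at_split is_linear_scale)
    next
      case 2
      define u1 u2 where "u1 = take i us" and "u2 = drop i us"
      define v1 v2 where "v1 = take (i + ar p - Suc (length us)) vs" and "v2 = drop (i + ar p - Suc (length us)) vs"
      have us: "us = u1 @ u2" "length u1 = i" and vs: "vs = v1 @ v2"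
        and len: "length (u2 @ (x, X) # v1) = ar p" for X
        using 2 i by (simp_all add: u1_def u2_def v1_def v2_def)
      have "insert_at p K i F (us @ (x, X) # vs) =
          scale (pass_signs p u1) (F (u1 @ (sum_list (map fst (u2 @ (x, 0) # v1)) + wt p, K (u2 @ (x, X) # v1)) # v2))" for X
        using insert_at_split[OF us(2) len, of K F X v2] us vs by (simp add: block_def)
      then show ?thesis
        using is_linear_comp[OF slot_linearD[OF F] slot_linearD[OF K]] by (simp add: is_linear_scale)
    next
      case 3
      then have "(i - Suc (length us)) + ar p \<le> length vs" using i by simp
      then obtain v1 ws v2 where vs: "vs = v1 @ ws @ v2" "length v1 = i - Suc (length us)" "length ws = ar p"
        by (rule split_block)
      have "insert_at p K i F (us @ (x, X) # vs) =
          scale (pass_signs p (us @ (x, 0) # v1)) (F (us @ (x, X) # v1 @ block p K ws # v2))" for X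
        using insert_at_split[of "us @ (x, X) # v1" i ws p K F v2] vs 3 by simp
      then show ?thesis
        using slot_linearD[OF F] by (simp add: is_linear_scale)
    qed
  qed
  then show "is_linear (\<lambda>X. insertion p K F (us @ (x, X) # vs))"
    unfolding insertion_def by (auto intro!: is_linear_sum)
qed

section \<open>Alternated insertions\<close>

lemma alt_add: "alt (\<lambda>ys. F ys + G ys) zs = alt F zs + alt G zs"
  by (simp add: alt_def act_def sum.distrib scale_right_distrib)

lemma insertion_add_left:
  assumes "slot_linear F"
  shows "insertion p (\<lambda>zs. K zs + L zs) F zs = insertion p K F zs + insertion p L F zs"
  by (simp add: insertion_def insert_at_def block_def slot_linear_add[OF assms] scale_right_distrib sum.distrib)

lemma insertion_add_right: "insertion p K (\<lambda>zs. F zs + G zs) zs = insertion p K F zs + insertion p K G zs"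
  by (simp add: insertion_def insert_at_def scale_right_distrib sum.distrib)

lemma insertion_arity_zero:
  assumes "arity (ar q) F" "ar q = 0"
  shows "insertion p K F zs = 0"
  using assms by (simp add: insertion_def insert_at_def arity_def)

lemma commutator_anticommute: "commutator p K q L zs = - scale (csg p q) (commutator q L p K zs)"
  by (simp add: commutator_def scale_right_diff_distrib sg_commute[of "Suc n" q p])

text \<open>Both parts of the commutator absorb the inner alternation, one on each side of the insertion.\<close>
lemma alt_commutator_alt:
  assumes p: "- 1 \<le> p 0" and K: "slot_linear K"
  shows "alt (commutator p K r (alt B)) zs = alt (commutator p K r B) zs"
proof -
  have "alt (insertion p K (alt B)) zs = alt (insertion p K B) zs"
  proof (cases "ar p \<le> length zs")
    case True
    then show ?thesis using alteq_insertion_alt_right[where p = p, OF p] by (simp add: alteq_def)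
  next
    case False
    then show ?thesis by (intro alt_cong) (simp add: insertion_def)
  qed
  moreover have "alt (insertion r (alt B) K) zs = alt (insertion r B K) zs"
    using alteq_insertion_alt_left[OF K] by (simp add: alteq_def)
  ultimately show ?thesis by (simp add: commutator_def[abs_def] alt_diff alt_scale)
qed

text \<open>
  For alternating \<open>F\<close> the block can be carried from any slot to the first, since exchanging two slots
  does not change \<open>F\<close>.
\<close>
lemma alteq_insertion_alternating:
  assumes p: "- 1 \<le> p 0" "ar p \<le> m"
    and F: "\<And>\<sigma> zs. length zs = Suc (m - ar p) \<Longrightarrow> \<sigma> permutes {..<length zs} \<Longrightarrow> act \<sigma> F zs = F zs"
  shows "alteq m (insertion p K F) (\<lambda>zs. scale (of_nat (Suc (m - ar p))) (insert_at p K 0 F zs))"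
proof -
  have slot: "alteq m (insert_at p K i F) (insert_at p K 0 F)" if "i + ar p \<le> m" for i
    using that
  proof (induction i)
    case 0
    show ?case by (rule alteq_refl) (rule refl)
  next
    case (Suc i)
    have "alteq m (insert_at p K i (act (transpose i (Suc i)) F)) (insert_at p K (transpose i (Suc i) i) F)"
      by (rule insert_at_swap[where p = p, OF p(1)]) (use Suc.prems in simp_all)
    then have "alteq m (insert_at p K (Suc i) F) (insert_at p K i (act (transpose i (Suc i)) F))"
      unfolding transpose_apply_first by (rule alteq_sym)
    also have "alteq m \<dots> (insert_at p K i F)"
    proof (rule alteq_refl)
      fix zs :: "'v graded_list" assume zs: "length zs = m"
      have "act (transpose i (Suc i)) F (take i zs @ block p K (take (ar p) (drop i zs)) # drop (i + ar p) zs) =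
          F (take i zs @ block p K (take (ar p) (drop i zs)) # drop (i + ar p) zs)"
        by (rule F; (rule permutes_swap_id)?) (use zs Suc.prems in simp_all)
      then show "insert_at p K i (act (transpose i (Suc i)) F) zs = insert_at p K i F zs"
        by (simp add: insert_at_def)
    qed
    also have "alteq m \<dots> (insert_at p K 0 F)" by (rule Suc.IH) (use Suc.prems in simp)
    finally show ?case .
  qed
  have "alt (insertion p K F) zs = alt (\<lambda>zs. scale (of_nat (Suc (m - ar p))) (insert_at p K 0 F zs)) zs"
    if zs: "length zs = m" for zs
  proof -
    have "alt (insertion p K F) zs = (\<Sum>i | i + ar p \<le> m. alt (insert_at p K i F) zs)"
      unfolding alt_sum[symmetric] by (rule alt_cong) (simp add: insertion_def zs)
    also have "\<dots> = (\<Sum>i | i + ar p \<le> m. alt (insert_at p K 0 F) zs)"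
    proof (rule sum.cong)
      fix i assume "i \<in> {i. i + ar p \<le> m}"
      then have "alteq m (insert_at p K i F) (insert_at p K 0 F)" by (intro slot) simp
      with zs show "alt (insert_at p K i F) zs = alt (insert_at p K 0 F) zs" by (simp only: alteq_def)
    qed (rule refl)
    also have "\<dots> = scale (of_nat (card {i. i + ar p \<le> m})) (alt (insert_at p K 0 F) zs)"
      by (rule sum_constant_scale)
    also have "card {i. i + ar p \<le> m} = Suc (m - ar p)"
    proof -
      have "{i. i + ar p \<le> m} = {..<Suc (m - ar p)}" using p(2) by auto
      then show ?thesis by (simp only: card_lessThan)
    qed
    finally show ?thesis by (simp only: alt_scale)
  qed
  then show ?thesis by (simp add: alteq_def)
qed

text \<open>
  The six permutations as products of \<open>(0 1)\<close> and \<open>(1 2)\<close>.  The terms are grouped in pairs that agree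
  when \<open>F\<close> is antisymmetric in its first two arguments.
\<close>
lemma alt_three:
  "scale 6 (alt F [a, b, c]) = F [a, b, c] + scale (eps n (fst a) (fst b)) (F [b, a, c])
    + scale (eps n (fst b) (fst c)) (F [a, c, b] + scale (eps n (fst a) (fst c)) (F [c, a, b]))
    + scale (eps n (fst a) (fst b) * eps n (fst a) (fst c)) (F [b, c, a] + scale (eps n (fst b) (fst c)) (F [c, b, a]))"
proof -
  let ?s = "transpose 0 (Suc 0) :: nat \<Rightarrow> nat" and ?t = "transpose (Suc 0) 2 :: nat \<Rightarrow> nat"
  have s: "?s permutes {..<3}" and t: "?t permutes {..<3}" by (auto intro!: permutes_swap_id)
  have s_act: "act ?s G [x, y, z] = scale (eps n (fst x) (fst y)) (G [y, x, z])" for G x y z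
    using act_adjacent[of "[]" G x y "[z]"] by simp
  have t_act: "act ?t G [x, y, z] = scale (eps n (fst y) (fst z)) (G [x, z, y])" for G x y z
    using act_adjacent[of "[x]" G y z "[]"] by (simp add: numeral_2_eq_2)
  have comp: "act (\<sigma> \<circ> \<tau>) F [x, y, z] = act \<sigma> (act \<tau> F) [x, y, z]"
    if "\<sigma> permutes {..<3}" "\<tau> permutes {..<3}" for \<sigma> \<tau> x y z
    using act_act[of \<sigma> "[x, y, z]" \<tau> F] that by (simp add: numeral_3_eq_3)
  define perms where "perms = [id, ?s, ?t, ?t \<circ> ?s, ?s \<circ> ?t, ?s \<circ> (?t \<circ> ?s)]"
  \<comment> \<open>Six different permutations of three positions are all of them.\<close>
  have "map (\<lambda>\<sigma>. map \<sigma> [0, 1, 2]) perms =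
      [[0, 1, 2], [1, 0, 2], [0, 2, 1], [2, 0, 1], [1, 2, 0], [2, 1, 0]]"
    by (simp add: transpose_def perms_def)
  then have "distinct (map (\<lambda>\<sigma>. map \<sigma> [0, 1, 2]) perms)"
    by simp
  then have distinct: "distinct perms" by (simp only: distinct_map)
  have sub: "set perms \<subseteq> {\<sigma>. \<sigma> permutes {..<3}}"
    using s t by (auto simp: perms_def intro!: permutes_compose permutes_id)
  have "card {\<sigma>. \<sigma> permutes {..<3::nat}} = fact 3"
    by (rule card_permutations) simp_all
  moreover have "card (set perms) = 6"
    unfolding distinct_card[OF distinct] by (simp add: perms_def)
  ultimately have perms: "{\<sigma>. \<sigma> permutes {..<3}} = set perms"
    using card_subset_eq[OF finite_perms sub] by (simp add: fact_numeral)
  have "(\<Sum>\<sigma> | \<sigma> permutes {..<3}. act \<sigma> F [a, b, c]) = (\<Sum>\<sigma>\<leftarrow>perms. act \<sigma> F [a, b, c])"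
    unfolding perms by (rule sum.distinct_set_conv_list[OF distinct])
  also have "\<dots> = act id F [a, b, c] + act ?s F [a, b, c] + act ?t F [a, b, c] + act (?t \<circ> ?s) F [a, b, c]
      + act (?s \<circ> ?t) F [a, b, c] + act (?s \<circ> (?t \<circ> ?s)) F [a, b, c]"
    by (simp only: perms_def list.map sum_list.Cons sum_list.Nil add.assoc add_0_right)
  also have "\<dots> = F [a, b, c] + scale (eps n (fst a) (fst b)) (F [b, a, c])
      + scale (eps n (fst b) (fst c)) (F [a, c, b] + scale (eps n (fst a) (fst c)) (F [c, a, b]))
      + scale (eps n (fst a) (fst b) * eps n (fst a) (fst c)) (F [b, c, a] + scale (eps n (fst b) (fst c)) (F [c, b, a]))"
    unfolding comp[OF t s] comp[OF s t] comp[OF s permutes_compose[OF s t]] act_id s_act t_act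
      comp[OF t s] s_act t_act
    by (simp add: scale_right_distrib add_ac mult.assoc)
  finally show ?thesis by (simp add: alt_def numeral_3_eq_3 fact_numeral)
qed

end

section \<open>Homogeneous components and extension from homogeneous arguments\<close>

locale graded = vector_space scale
  for scale :: "'k::field \<Rightarrow> 'v::ab_group_add \<Rightarrow> 'v" +
  fixes n :: nat and C :: "'v set" and V :: "(nat \<Rightarrow> int) \<Rightarrow> 'v set"
  assumes graded_space: "graded_space n scale C V"

lemma Zn_add: "x \<in> Zn n \<Longrightarrow> y \<in> Zn n \<Longrightarrow> x + y \<in> Zn n"
  by (simp add: Zn_def plus_fun_apply)

lemma Zn_zero: "0 \<in> Zn n"
  by (simp add: Zn_def zero_fun_apply)

lemma Zn_sum_list: "set xs \<subseteq> Zn n \<Longrightarrow> sum_list xs \<in> Zn n"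
  by (induction xs) (auto intro: Zn_add Zn_zero)

lemma is_decomp_sum:
  assumes "is_decomp n V v f" "finite S" "{x. f x \<noteq> 0} \<subseteq> S"
  shows "v = sum f S"
  using assms unfolding is_decomp_def
  by (metis (mono_tags, lifting) DiffD2 mem_Collect_eq sum.mono_neutral_left)

lemma is_decompI:
  assumes "\<And>x. x \<in> Zn n \<Longrightarrow> f x \<in> V x" "\<And>x. x \<notin> Zn n \<Longrightarrow> f x = 0"
    and "finite S" "{x. f x \<noteq> 0} \<subseteq> S" "v = sum f S"
  shows "is_decomp n V v f"
  unfolding is_decomp_def
  using assms finite_subset[OF assms(4,3)]
  by (auto intro!: sum.mono_neutral_right)

context vector_space
begin

lemma is_decomp_add:
  assumes V: "\<And>x. x \<in> Zn n \<Longrightarrow> subspace (V x)"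
    and "is_decomp n V v f" "is_decomp n V w g"
  shows "is_decomp n V (v + w) (\<lambda>x. f x + g x)"
proof (rule is_decompI)
  let ?S = "{x. f x \<noteq> 0} \<union> {x. g x \<noteq> 0}"
  show fin: "finite ?S" using assms by (simp add: is_decomp_def)
  show "v + w = (\<Sum>x\<in>?S. f x + g x)"
    using is_decomp_sum[OF assms(2) fin] is_decomp_sum[OF assms(3) fin] by (simp add: sum.distrib)
qed (use assms in \<open>auto simp: is_decomp_def intro: subspace_add\<close>)

lemma is_decomp_scale:
  assumes V: "\<And>x. x \<in> Zn n \<Longrightarrow> subspace (V x)"
    and "is_decomp n V v f"
  shows "is_decomp n V (scale c v) (\<lambda>x. scale c (f x))"
proof (rule is_decompI)
  let ?S = "{x. f x \<noteq> 0}"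
  show fin: "finite ?S" using assms by (simp add: is_decomp_def)
  show "scale c v = (\<Sum>x\<in>?S. scale c (f x))"
    using is_decomp_sum[OF assms(2) fin] by (simp add: scale_sum_right)
qed (use assms in \<open>auto simp: is_decomp_def intro: subspace_scale\<close>)

lemma is_decomp_homogeneous:
  assumes V: "\<And>x. x \<in> Zn n \<Longrightarrow> subspace (V x)"
    and "x \<in> Zn n" "X \<in> V x"
  shows "is_decomp n V X (\<lambda>y. if y = x then X else 0)"
  by (rule is_decompI[where S = "{x}"]) (use assms in \<open>auto intro: subspace_0\<close>)

end

text \<open>
  Linearity in every argument of a formula that is given on homogeneous arguments only.  The degrees
  are separate parameters, since a vector such as \<open>0\<close> can have several.
\<close>
definition hmultilinear ::
  "nat \<Rightarrow> ('k \<Rightarrow> 'v \<Rightarrow> 'v) \<Rightarrow> ((nat \<Rightarrow> int) \<Rightarrow> 'v set) \<Rightarrow> nat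
     \<Rightarrow> ((nat \<Rightarrow> int) list \<Rightarrow> 'v list \<Rightarrow> 'v::ab_group_add) \<Rightarrow> bool" where
  "hmultilinear n scale V m f \<longleftrightarrow>
     (\<forall>xs Xs i X Y. homog_list n V xs Xs \<and> length Xs = m \<and> i < m \<and> X \<in> V (xs ! i) \<and> Y \<in> V (xs ! i) \<longrightarrow>
        f xs (Xs[i := X + Y]) = f xs (Xs[i := X]) + f xs (Xs[i := Y])) \<and>
     (\<forall>xs Xs i X c. homog_list n V xs Xs \<and> length Xs = m \<and> i < m \<and> X \<in> V (xs ! i) \<longrightarrow>
        f xs (Xs[i := scale c X]) = scale c (f xs (Xs[i := X])))"

lemma homog_list_length: "homog_list n V xs Xs \<Longrightarrow> length xs = length Xs"
  by (auto simp: homog_list_def dest: list_all2_lengthD)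

lemma homog_ext_cong:
  assumes "\<And>xs Ys. length xs = length Xs \<Longrightarrow> length Ys = length Xs \<Longrightarrow> f xs Ys = g xs Ys"
  shows "homog_ext n V f Xs = homog_ext n V g Xs"
  unfolding homog_ext_def
  by (intro sum.cong refl assms) (auto dest: list_all2_lengthD)

context graded
begin

lemma subspace_V: "x \<in> Zn n \<Longrightarrow> subspace (V x)"
  and V_subset: "x \<in> Zn n \<Longrightarrow> V x \<subseteq> C"
  and subspace_C: "subspace C"
  and ex1_decomp: "v \<in> C \<Longrightarrow> \<exists>!f. is_decomp n V v f"
  using graded_space by (auto simp: graded_space_def)

lemma decomp_hcomp: "v \<in> C \<Longrightarrow> is_decomp n V v (hcomp n V v)"
  unfolding hcomp_def using theI'[OF ex1_decomp] .

lemma hcomp_eqI: "v \<in> C \<Longrightarrow> is_decomp n V v f \<Longrightarrow> hcomp n V v = f"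
  using ex1_decomp decomp_hcomp by blast

lemma hcomp_add: "v \<in> C \<Longrightarrow> w \<in> C \<Longrightarrow> hcomp n V (v + w) = (\<lambda>x. hcomp n V v x + hcomp n V w x)"
  by (intro hcomp_eqI is_decomp_add subspace_V decomp_hcomp subspace_add[OF subspace_C])

lemma hcomp_scale: "v \<in> C \<Longrightarrow> hcomp n V (scale c v) = (\<lambda>x. scale c (hcomp n V v x))"
  by (intro hcomp_eqI is_decomp_scale subspace_V decomp_hcomp subspace_scale[OF subspace_C])

lemma hcomp_homogeneous:
  "x \<in> Zn n \<Longrightarrow> X \<in> V x \<Longrightarrow> hcomp n V X = (\<lambda>y. if y = x then X else 0)"
  using V_subset by (intro hcomp_eqI is_decomp_homogeneous subspace_V) auto

lemma hcomp_in: "v \<in> C \<Longrightarrow> x \<in> Zn n \<Longrightarrow> hcomp n V v x \<in> V x"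
  and hcomp_outside: "v \<in> C \<Longrightarrow> x \<notin> Zn n \<Longrightarrow> hcomp n V v x = 0"
  and finite_hcomp: "v \<in> C \<Longrightarrow> finite {x. hcomp n V v x \<noteq> 0}"
  and sum_hcomp: "v \<in> C \<Longrightarrow> (\<Sum>x | hcomp n V v x \<noteq> 0. hcomp n V v x) = v"
  using decomp_hcomp by (auto simp: is_decomp_def)

lemma hcomp_zero: "hcomp n V 0 = (\<lambda>x. 0)"
  using hcomp_homogeneous[OF Zn_zero subspace_0[OF subspace_V[OF Zn_zero]]] by auto

text \<open>The component of the sum in degree \<open>d s\<close> is \<open>Y s\<close>, by uniqueness of components.\<close>
lemma sum_homogeneous_eq_0:
  assumes S: "finite S" and d: "inj_on d S" "d ` S \<subseteq> Zn n"
    and Y: "\<And>s. s \<in> S \<Longrightarrow> Y s \<in> V (d s)" and sum: "(\<Sum>s\<in>S. Y s) = 0" and s: "s \<in> S"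
  shows "Y s = 0"
proof -
  have C: "Y t \<in> C" if "t \<in> S" for t using that d Y V_subset by blast
  have "hcomp n V (\<Sum>t\<in>T. Y t) x = (\<Sum>t\<in>T. hcomp n V (Y t) x)" if "T \<subseteq> S" for T x
    using finite_subset[OF that S] that
  proof (induction T rule: finite_induct)
    case empty
    then show ?case by (simp add: hcomp_zero)
  next
    case (insert t T)
    then show ?case using C by (simp add: hcomp_add subspace_sum[OF subspace_C] subset_iff)
  qed
  from this[of S "d s"] have "0 = (\<Sum>t\<in>S. hcomp n V (Y t) (d s))"
    by (simp add: sum hcomp_zero)
  also have "\<dots> = (\<Sum>t\<in>S. if t = s then Y s else 0)"
    using d s by (intro sum.cong refl) (auto simp: hcomp_homogeneous[OF _ Y] inj_on_def image_subset_iff)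
  finally show ?thesis using S s by simp
qed

abbreviation "comps xs Xs \<equiv> map2 (\<lambda>x X. hcomp n V X x) xs Xs"

lemma homog_list_comps:
  "set xs \<subseteq> Zn n \<Longrightarrow> set Xs \<subseteq> C \<Longrightarrow> length xs = length Xs \<Longrightarrow> homog_list n V xs (comps xs Xs)"
  by (auto simp: homog_list_def list_all2_conv_all_nth intro!: hcomp_in)

lemma hmultilinear_zero:
  assumes "hmultilinear n scale V m f" "homog_list n V xs Xs" "length Xs = m" "0 \<in> set Xs"
  shows "f xs Xs = 0"
proof -
  obtain i where i: "i < m" "Xs ! i = 0" using assms by (metis in_set_conv_nth)
  moreover have "0 \<in> V (xs ! i)"
    using assms(2,3) i by (auto simp: homog_list_def list_all2_conv_all_nth intro: subspace_0 subspace_V)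
  ultimately have "f xs (Xs[i := scale 0 0]) = scale 0 (f xs (Xs[i := 0]))"
    using assms by (simp only: hmultilinear_def)
  with i show ?thesis by (metis list_update_id scale_zero_left)
qed

text \<open>
  The degrees over which the extension sums depend on the arguments.  Terms with a zero component
  vanish, so the sum may run over any common finite set of degrees, and additivity can be checked
  term by term.
\<close>
lemma homog_ext_eq_sum:
  assumes f: "hmultilinear n scale V m f" and Xs: "set Xs \<subseteq> C" "length Xs = m"
    and S: "finite S" "S \<subseteq> Zn n" "\<And>X. X \<in> set Xs \<Longrightarrow> {x. hcomp n V X x \<noteq> 0} \<subseteq> S"
  shows "homog_ext n V f Xs = (\<Sum>xs | set xs \<subseteq> S \<and> length xs = m. f xs (comps xs Xs))"
  unfolding homog_ext_def
proof (rule sum.mono_neutral_left)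
  show "finite {xs. set xs \<subseteq> S \<and> length xs = m}" by (rule finite_lists_length_eq[OF S(1)])
  show "{xs. list_all2 (\<lambda>x X. hcomp n V X x \<noteq> 0) xs Xs} \<subseteq> {xs. set xs \<subseteq> S \<and> length xs = m}"
    using S(3) Xs(2)
    by (auto simp: list_all2_conv_all_nth in_set_conv_nth) (metis (mono_tags, lifting) mem_Collect_eq nth_mem subsetD)
  show "\<forall>xs\<in>{xs. set xs \<subseteq> S \<and> length xs = m} - {xs. list_all2 (\<lambda>x X. hcomp n V X x \<noteq> 0) xs Xs}.
      f xs (comps xs Xs) = 0"
  proof
    fix xs assume xs: "xs \<in> {xs. set xs \<subseteq> S \<and> length xs = m} - {xs. list_all2 (\<lambda>x X. hcomp n V X x \<noteq> 0) xs Xs}"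
    then obtain i where i: "i < m" "hcomp n V (Xs ! i) (xs ! i) = 0"
      using Xs by (auto simp: list_all2_conv_all_nth)
    have "0 \<in> set (comps xs Xs)"
      unfolding in_set_conv_nth using i xs Xs by (intro exI[of _ i]) auto
    then show "f xs (comps xs Xs) = 0"
      using xs Xs S by (intro hmultilinear_zero[OF f] homog_list_comps) auto
  qed
qed

lemma ex_common_support:
  assumes "set Xs \<subseteq> C"
  obtains S where "finite S" "S \<subseteq> Zn n" "\<And>X. X \<in> set Xs \<Longrightarrow> {x. hcomp n V X x \<noteq> 0} \<subseteq> S"
proof
  show "finite (\<Union>X\<in>set Xs. {x. hcomp n V X x \<noteq> 0})" using assms finite_hcomp by auto
  show "(\<Union>X\<in>set Xs. {x. hcomp n V X x \<noteq> 0}) \<subseteq> Zn n" using assms hcomp_outside by blast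
qed auto

lemma comps_update:
  "length xs = length Xs \<Longrightarrow> i < length Xs \<Longrightarrow>
    comps xs (Xs[i := X]) = (comps xs Xs)[i := hcomp n V X (xs ! i)]"
  by (rule nth_equalityI) (auto simp: nth_list_update)

lemma homog_ext_update:
  assumes f: "hmultilinear n scale V m f" and Xs: "set Xs \<subseteq> C" "length Xs = m" "i < m" and Z: "Z \<in> C"
    and S: "finite S" "S \<subseteq> Zn n" "\<And>X. X \<in> insert Z (set Xs) \<Longrightarrow> {x. hcomp n V X x \<noteq> 0} \<subseteq> S"
  shows "homog_ext n V f (Xs[i := Z]) = (\<Sum>xs | set xs \<subseteq> S \<and> length xs = m.
    f xs ((comps xs Xs)[i := hcomp n V Z (xs ! i)]))"
proof -
  have sub: "set (Xs[i := Z]) \<subseteq> insert Z (set Xs)" by (rule set_update_subset_insert)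
  have "homog_ext n V f (Xs[i := Z]) = (\<Sum>xs | set xs \<subseteq> S \<and> length xs = m. f xs (comps xs (Xs[i := Z])))"
  proof (rule homog_ext_eq_sum[OF f _ _ S(1,2)])
    show "set (Xs[i := Z]) \<subseteq> C" using sub Xs(1) Z by blast
    show "\<And>W. W \<in> set (Xs[i := Z]) \<Longrightarrow> {x. hcomp n V W x \<noteq> 0} \<subseteq> S"
      by (rule S(3)) (use sub in blast)
  qed (use Xs in simp)
  also have "\<dots> = (\<Sum>xs | set xs \<subseteq> S \<and> length xs = m. f xs ((comps xs Xs)[i := hcomp n V Z (xs ! i)]))"
    using Xs by (intro sum.cong refl) (simp add: comps_update)
  finally show ?thesis .
qed

lemma homog_ext_add:
  assumes f: "hmultilinear n scale V m f" and Xs: "set Xs \<subseteq> C" "length Xs = m" "i < m"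
    and XY: "X \<in> C" "Y \<in> C"
  shows "homog_ext n V f (Xs[i := X + Y]) = homog_ext n V f (Xs[i := X]) + homog_ext n V f (Xs[i := Y])"
proof -
  have C: "X + Y \<in> C" using XY by (rule subspace_add[OF subspace_C])
  have "set (X # Y # (X + Y) # Xs) \<subseteq> C" using Xs XY C by simp
  then obtain S where S: "finite S" "S \<subseteq> Zn n"
    "\<And>Z. Z \<in> set (X # Y # (X + Y) # Xs) \<Longrightarrow> {x. hcomp n V Z x \<noteq> 0} \<subseteq> S"
    using ex_common_support by blast
  have *: "homog_ext n V f (Xs[i := Z]) = (\<Sum>xs | set xs \<subseteq> S \<and> length xs = m.
      f xs ((comps xs Xs)[i := hcomp n V Z (xs ! i)]))" if "Z \<in> {X, Y, X + Y}" for Z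
    by (rule homog_ext_update[OF f Xs _ S(1,2) S(3)]) (use that XY C in auto)
  have "f xs ((comps xs Xs)[i := hcomp n V (X + Y) (xs ! i)]) =
      f xs ((comps xs Xs)[i := hcomp n V X (xs ! i)]) + f xs ((comps xs Xs)[i := hcomp n V Y (xs ! i)])"
    if xs: "set xs \<subseteq> S" "length xs = m" for xs
  proof -
    have "xs ! i \<in> Zn n" using xs Xs S(2) nth_mem by blast
    moreover have "homog_list n V xs (comps xs Xs)" using xs Xs S(2) by (intro homog_list_comps) auto
    ultimately show ?thesis
      using f xs Xs XY by (simp add: hmultilinear_def hcomp_add hcomp_in)
  qed
  then show ?thesis by (simp add: * sum.distrib[symmetric])
qed

lemma homog_ext_scale:
  assumes f: "hmultilinear n scale V m f" and Xs: "set Xs \<subseteq> C" "length Xs = m" "i < m"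
    and X: "X \<in> C"
  shows "homog_ext n V f (Xs[i := scale c X]) = scale c (homog_ext n V f (Xs[i := X]))"
proof -
  have C: "scale c X \<in> C" using X by (rule subspace_scale[OF subspace_C])
  have "set (X # scale c X # Xs) \<subseteq> C" using Xs X C by simp
  then obtain S where S: "finite S" "S \<subseteq> Zn n"
    "\<And>Z. Z \<in> set (X # scale c X # Xs) \<Longrightarrow> {x. hcomp n V Z x \<noteq> 0} \<subseteq> S"
    using ex_common_support by blast
  have *: "homog_ext n V f (Xs[i := Z]) = (\<Sum>xs | set xs \<subseteq> S \<and> length xs = m.
      f xs ((comps xs Xs)[i := hcomp n V Z (xs ! i)]))" if "Z \<in> {X, scale c X}" for Z
    by (rule homog_ext_update[OF f Xs _ S(1,2) S(3)]) (use that X C in auto)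
  have "f xs ((comps xs Xs)[i := hcomp n V (scale c X) (xs ! i)]) =
      scale c (f xs ((comps xs Xs)[i := hcomp n V X (xs ! i)]))"
    if xs: "set xs \<subseteq> S" "length xs = m" for xs
  proof -
    have "xs ! i \<in> Zn n" using xs Xs S(2) nth_mem by blast
    moreover have "homog_list n V xs (comps xs Xs)" using xs Xs S(2) by (intro homog_list_comps) auto
    ultimately show ?thesis
      using f xs Xs X by (simp add: hmultilinear_def hcomp_scale hcomp_in)
  qed
  then show ?thesis by (simp add: * scale_sum_right)
qed

text \<open>
  If all arguments are nonzero, a single term remains; if one is zero, the sum is empty, and the
  formula vanishes too by linearity.
\<close>
lemma homog_ext_homogeneous:
  assumes f: "hmultilinear n scale V m f" and Xs: "homog_list n V xs Xs" "length Xs = m"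
  shows "homog_ext n V f Xs = f xs Xs"
proof (cases "0 \<in> set Xs")
  case True
  then obtain i where i: "i < length Xs" "Xs ! i = 0" unfolding in_set_conv_nth by blast
  have "\<not> list_all2 (\<lambda>x X. hcomp n V X x \<noteq> 0) ys Xs" for ys
    using list_all2_nthD2[of "\<lambda>x X. hcomp n V X x \<noteq> 0" ys Xs i] i by (auto simp: hcomp_zero)
  then have "{ys. list_all2 (\<lambda>x X. hcomp n V X x \<noteq> 0) ys Xs} = {}" by blast
  then show ?thesis
    using hmultilinear_zero[OF f Xs True] by (simp only: homog_ext_def sum.empty)
next
  case False
  have h: "xs ! i \<in> Zn n \<and> Xs ! i \<in> V (xs ! i) \<and> Xs ! i \<noteq> 0" if "i < m" for i
  proof -
    have "list_all2 (\<lambda>x X. x \<in> Zn n \<and> X \<in> V x) xs Xs" using Xs(1) by (simp add: homog_list_def)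
    then have "xs ! i \<in> Zn n \<and> Xs ! i \<in> V (xs ! i)"
      by (rule list_all2_nthD2) (simp add: Xs that)
    moreover have "Xs ! i \<noteq> 0" using nth_mem[of i Xs] False Xs(2) that by metis
    ultimately show ?thesis by simp
  qed
  have hc: "hcomp n V (Xs ! i) y = (if y = xs ! i then Xs ! i else 0)" if "i < m" for i y
  proof -
    have "xs ! i \<in> Zn n" "Xs ! i \<in> V (xs ! i)" using h[OF that] by simp_all
    then show ?thesis by (simp only: hcomp_homogeneous)
  qed
  have len: "length xs = m" using homog_list_length[OF Xs(1)] Xs(2) by simp
  have "ys = xs" if "list_all2 (\<lambda>x X. hcomp n V X x \<noteq> 0) ys Xs" for ys
  proof (rule nth_equalityI)
    have ys: "length ys = m" using list_all2_lengthD[OF that] Xs(2) by simp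
    then show "length ys = length xs" by (simp add: len)
    show "ys ! i = xs ! i" if i: "i < length ys" for i
      using list_all2_nthD[OF \<open>list_all2 _ ys Xs\<close> i] i by (simp add: ys hc split: if_splits)
  qed
  moreover have "list_all2 (\<lambda>x X. hcomp n V X x \<noteq> 0) xs Xs"
    using h by (auto simp: list_all2_conv_all_nth len Xs(2) hc)
  ultimately have "{ys. list_all2 (\<lambda>x X. hcomp n V X x \<noteq> 0) ys Xs} = {xs}" by blast
  moreover have "comps xs Xs = Xs"
    by (rule nth_equalityI) (simp_all add: len Xs(2) hc)
  ultimately show ?thesis unfolding homog_ext_def by simp
qed

end

lemma (in vector_space) vector_space_fscale: "vector_space (fscale scale)"
  by unfold_locales (simp_all add: fscale_def fun_eq_iff plus_fun_apply algebra_simps)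

section \<open>Graded multilinear maps as functions on lists of pairs\<close>

locale graded_maps = signed_maps n scale
  for n :: nat and scale :: "'k::field_char_0 \<Rightarrow> 'v::ab_group_add \<Rightarrow> 'v" +
  fixes V :: "(nat \<Rightarrow> int) \<Rightarrow> 'v set"
  assumes graded_V: "graded_space n scale UNIV V"
begin

sublocale graded scale n UNIV V
  by unfold_locales (rule graded_V)

definition homogeneous :: "'v graded_list \<Rightarrow> bool" where
  "homogeneous zs \<longleftrightarrow> (\<forall>z\<in>set zs. fst z \<in> Zn n \<and> snd z \<in> V (fst z))"

lemma homogeneous_simps [simp]: "homogeneous []" "homogeneous (z # zs) \<longleftrightarrow> (fst z \<in> Zn n \<and> snd z \<in> V (fst z)) \<and> homogeneous zs"
  "homogeneous (us @ vs) \<longleftrightarrow> homogeneous us \<and> homogeneous vs"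
  by (auto simp: homogeneous_def)

lemma homogeneous_set_eq: "set ys = set zs \<Longrightarrow> homogeneous ys = homogeneous zs"
  by (simp add: homogeneous_def)

lemma homog_list_iff: "homog_list n V xs Xs \<longleftrightarrow> length xs = length Xs \<and> homogeneous (zip xs Xs)"
  by (auto simp: homog_list_def list_all2_iff homogeneous_def)

lemma homogeneous_Zn: "homogeneous zs \<Longrightarrow> sum_list (map fst zs) \<in> Zn n"
  by (rule Zn_sum_list) (auto simp: homogeneous_def)

lemma homogeneous_zip_iff: "homogeneous zs \<longleftrightarrow> homog_list n V (map fst zs) (map snd zs)"
  by (simp add: homog_list_iff zip_map_fst_snd)

definition lift :: "('v list \<Rightarrow> 'v) \<Rightarrow> 'v graded_list \<Rightarrow> 'v" where
  "lift K zs = K (map snd zs)"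

text \<open>The counterpart of \<open>M\<^sup>(\<^sup>k\<^sup>,\<^sup>\<kappa>\<^sup>)(V)\<close> for functions of lists of pairs.\<close>
definition graded_map :: "(nat \<Rightarrow> int) \<Rightarrow> ('v graded_list \<Rightarrow> 'v) \<Rightarrow> bool" where
  "graded_map p F \<longleftrightarrow> slot_linear F \<and> arity (ar p) F \<and>
     (\<forall>zs. homogeneous zs \<and> length zs = ar p \<longrightarrow> F zs \<in> V (sum_list (map fst zs) + wt p))"

lemma graded_map_slot_linear: "graded_map p F \<Longrightarrow> slot_linear F"
  and graded_map_arity: "graded_map p F \<Longrightarrow> arity (ar p) F"
  and graded_map_in: "graded_map p F \<Longrightarrow> homogeneous zs \<Longrightarrow> length zs = ar p \<Longrightarrow> F zs \<in> V (sum_list (map fst zs) + wt p)"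
  by (simp_all add: graded_map_def)

lemma wt_Zn: "p \<in> Zn (Suc n) \<Longrightarrow> wt p \<in> Zn n"
  by (simp add: wt_def Zn_def)

lemma homogeneous_block:
  assumes "graded_map p K" "p \<in> Zn (Suc n)" "homogeneous ws" "length ws = ar p"
  shows "fst (block p K ws) \<in> Zn n" "snd (block p K ws) \<in> V (fst (block p K ws))"
  using assms by (auto simp: block_def graded_map_in intro!: Zn_add homogeneous_Zn wt_Zn)

lemma graded_map_alt:
  assumes F: "graded_map p F" and p: "p \<in> Zn (Suc n)"
  shows "graded_map p (alt F)"
  unfolding graded_map_def
proof (intro conjI allI impI)
  show "slot_linear (alt F)" by (rule slot_linear_alt[OF graded_map_slot_linear[OF F]])
  show "arity (ar p) (alt F)"
    using graded_map_arity[OF F] by (simp add: arity_def alt_def act_def)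
  fix zs assume zs: "homogeneous zs \<and> length zs = ar p"
  have sub: "subspace (V (sum_list (map fst zs) + wt p))"
    using zs p by (intro subspace_V Zn_add homogeneous_Zn wt_Zn) auto
  have "act \<sigma> F zs \<in> V (sum_list (map fst zs) + wt p)" if \<sigma>: "\<sigma> permutes {..<length zs}" for \<sigma>
  proof -
    have "homogeneous (permute_list \<sigma> zs)" using zs set_permute_list[OF \<sigma>] by (metis homogeneous_set_eq)
    then have "F (permute_list \<sigma> zs) \<in> V (sum_list (map fst (permute_list \<sigma> zs)) + wt p)"
      using zs by (intro graded_map_in[OF F]) auto
    moreover have "sum_list (map fst (permute_list \<sigma> zs)) = sum_list (map fst zs)"
      using mset_permute_list[OF \<sigma>] by (metis mset_map sum_mset_sum_list)
    ultimately show ?thesis by (simp add: act_def subspace_scale[OF sub])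
  qed
  then show "alt F zs \<in> V (sum_list (map fst zs) + wt p)"
    unfolding alt_def by (intro subspace_scale[OF sub] subspace_sum[OF sub]) simp
qed

lemma ar_add:
  assumes "- 1 \<le> p 0" "- 1 \<le> q 0" "ar q \<noteq> 0"
  shows "ar (p + q) = ar p + ar q - 1"
  using assms by (simp add: ar_def plus_fun_apply)

lemma graded_map_insertion:
  assumes K: "graded_map p K" and F: "graded_map q F"
    and p: "p \<in> Zn (Suc n)" "- 1 \<le> p 0" and q: "q \<in> Zn (Suc n)" "- 1 \<le> q 0"
  shows "graded_map (p + q) (insertion p K F)"
  unfolding graded_map_def
proof (intro conjI allI impI)
  show "slot_linear (insertion p K F)" by (rule slot_linear_insertion[OF graded_map_slot_linear[OF K] graded_map_slot_linear[OF F]])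
  have 0: "F ys = 0" if "length ys \<noteq> ar q" for ys
    using graded_map_arity[OF F] that by (simp add: arity_def)
  show "arity (ar (p + q)) (insertion p K F)"
    unfolding arity_def
  proof (intro allI impI)
    fix zs :: "'v graded_list"
    assume len: "length zs \<noteq> ar (p + q)"
    have "insert_at p K i F zs = 0" if "i + ar p \<le> length zs" for i
    proof -
      have "length (take i zs @ block p K (take (ar p) (drop i zs)) # drop (i + ar p) zs) \<noteq> ar q"
        using that len ar_add[of p q] p(2) q(2) by auto
      then show ?thesis by (simp add: insert_at_def 0 del: length_append)
    qed
    then show "insertion p K F zs = 0" by (simp add: insertion_def)
  qed
  fix zs assume zs: "homogeneous zs \<and> length zs = ar (p + q)"
  have sub: "subspace (V (sum_list (map fst zs) + wt (p + q)))"
    using zs p q by (intro subspace_V Zn_add homogeneous_Zn wt_Zn) auto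
  have "insert_at p K i F zs \<in> V (sum_list (map fst zs) + wt (p + q))" if i: "i + ar p \<le> length zs" for i
  proof -
    obtain us ws vs where s: "zs = us @ ws @ vs" "length us = i" "length ws = ar p"
      using i by (rule split_block)
    have "F (us @ block p K ws # vs) \<in> V (sum_list (map fst zs) + wt (p + q))"
    proof (cases "length (us @ block p K ws # vs) = ar q")
      case True
      have "F (us @ block p K ws # vs) \<in> V (sum_list (map fst (us @ block p K ws # vs)) + wt q)"
        using True zs s homogeneous_block[OF K p(1), of ws] by (intro graded_map_in[OF F]) auto
      also have "sum_list (map fst (us @ block p K ws # vs)) + wt q = sum_list (map fst zs) + wt (p + q)"
        by (simp add: s block_def wt_add add_ac)
      finally show ?thesis .
    qed (simp only: 0 subspace_0[OF sub] not_False_eq_True)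
    then have "scale (pass_signs p us) (F (us @ block p K ws # vs)) \<in> V (sum_list (map fst zs) + wt (p + q))"
      by (rule subspace_scale[OF sub])
    then show ?thesis unfolding s(1) insert_at_split[OF s(2,3)] .
  qed
  then show "insertion p K F zs \<in> V (sum_list (map fst zs) + wt (p + q))"
    unfolding insertion_def by (intro subspace_sum[OF sub]) simp
qed

lemma graded_map_scale: "p \<in> Zn (Suc n) \<Longrightarrow> graded_map p F \<Longrightarrow> graded_map p (\<lambda>zs. scale c (F zs))"
  unfolding graded_map_def slot_linear_iff_is_linear
  by (auto simp: arity_def is_linear_scale intro!: subspace_scale subspace_V Zn_add homogeneous_Zn wt_Zn)

lemma graded_map_diff:
  "p \<in> Zn (Suc n) \<Longrightarrow> graded_map p F \<Longrightarrow> graded_map p G \<Longrightarrow> graded_map p (\<lambda>zs. F zs - G zs)"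
  unfolding graded_map_def slot_linear_iff_is_linear
  by (auto simp: arity_def is_linear_diff intro!: subspace_diff subspace_V Zn_add homogeneous_Zn wt_Zn)

abbreviation "Msp p \<equiv> M_space n scale V (p 0) (wt p)"

text \<open>
  The way back from functions of lists of pairs to multilinear maps; \<open>lift\<close> is inverse to it on
  homogeneous arguments only, because \<open>lift K\<close> does not see the degrees.
\<close>
definition ext_map :: "('v graded_list \<Rightarrow> 'v) \<Rightarrow> 'v list \<Rightarrow> 'v" where
  "ext_map F = homog_ext n V (\<lambda>xs Xs. F (zip xs Xs))"

lemma hmultilinear_zip:
  assumes "slot_linear F"
  shows "hmultilinear n scale V m (\<lambda>xs Xs. F (zip xs Xs))"
proof -
  have "is_linear (\<lambda>X. F (zip xs (Xs[i := X])))" if "homog_list n V xs Xs" "i < length Xs" for xs Xs i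
  proof -
    have "length xs = length Xs" using that homog_list_length by blast
    then have "zip xs (Xs[i := X]) = (zip xs Xs)[i := (xs ! i, X)]" for X
      using update_zip[of xs Xs i "(xs ! i, X)"] by simp
    then show ?thesis using slot_linear_update[OF assms, of i "zip xs Xs" "xs ! i"] that \<open>length xs = length Xs\<close> by simp
  qed
  then show ?thesis unfolding hmultilinear_def is_linear_def by blast
qed

lemma lift_ext_map:
  assumes "slot_linear F" "homogeneous zs"
  shows "lift (ext_map F) zs = F zs"
  using homog_ext_homogeneous[OF hmultilinear_zip[OF assms(1)], of "map fst zs" "map snd zs"] assms(2)
  by (simp add: lift_def ext_map_def homogeneous_zip_iff zip_map_fst_snd)

lemma homog_ext_zero: "homog_ext n V (\<lambda>xs Xs. 0) Xs = 0"
  by (simp add: homog_ext_def)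

lemma ext_map_in_M:
  assumes F: "graded_map p F" and p: "- 1 \<le> p 0"
  shows "ext_map F \<in> Msp p"
proof -
  have is_linear: "slot_linear F" by (rule graded_map_slot_linear[OF F])
  have m: "nat (p 0 + 1) = ar p" by (simp add: ar_def)
  have "ext_map F Xs = 0" if "length Xs \<noteq> ar p" for Xs
  proof -
    have "ext_map F Xs = homog_ext n V (\<lambda>xs Xs. 0) Xs"
      unfolding ext_map_def
      using graded_map_arity[OF F] that by (intro homog_ext_cong) (simp add: arity_def)
    then show ?thesis by (simp add: homog_ext_zero)
  qed
  moreover have "ext_map F (Xs[i := X + Y]) = ext_map F (Xs[i := X]) + ext_map F (Xs[i := Y])"
    if "length Xs = ar p" "i < ar p" for Xs i X Y
    unfolding ext_map_def by (rule homog_ext_add[OF hmultilinear_zip[OF is_linear, of "ar p"]]) (use that in auto)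
  moreover have "ext_map F (Xs[i := scale c X]) = scale c (ext_map F (Xs[i := X]))"
    if "length Xs = ar p" "i < ar p" for Xs i X c
    unfolding ext_map_def by (rule homog_ext_scale[OF hmultilinear_zip[OF is_linear, of "ar p"]]) (use that in auto)
  moreover have "ext_map F Xs \<in> V (sum_list xs + wt p)" if "homog_list n V xs Xs" "length Xs = ar p" for xs Xs
  proof -
    have len: "length xs = length Xs" using that(1) by (simp add: homog_list_iff)
    have "lift (ext_map F) (zip xs Xs) = F (zip xs Xs)"
      using that(1) by (intro lift_ext_map is_linear) (simp add: homog_list_iff)
    moreover have "F (zip xs Xs) \<in> V (sum_list (map fst (zip xs Xs)) + wt p)"
      using that len by (intro graded_map_in[OF F]) (simp_all add: homog_list_iff)
    ultimately show ?thesis using len by (simp add: lift_def)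
  qed
  ultimately show ?thesis
    using p by (simp add: M_space_def multilinear_map_def m)
qed

lemma M_multilinear: "K \<in> Msp p \<Longrightarrow> - 1 \<le> p 0 \<Longrightarrow> multilinear_map scale (ar p) K"
  by (simp add: M_space_def ar_def)

lemma slot_linear_lift:
  assumes "multilinear_map scale m K"
  shows "slot_linear (lift K)"
  unfolding slot_linear_def
proof (intro conjI allI)
  fix us vs :: "'v graded_list" and x X Y c
  let ?Xs = "map snd us @ 0 # map snd vs"
  have upd: "lift K (us @ (x, X) # vs) = K (?Xs[length us := X])" for X
    by (simp add: lift_def list_update_append)
  have len: "K (?Xs[length us := X]) = 0" if "length us + Suc (length vs) \<noteq> m" for X
    using assms that by (simp add: multilinear_map_def)
  show "lift K (us @ (x, X + Y) # vs) = lift K (us @ (x, X) # vs) + lift K (us @ (x, Y) # vs)"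
    unfolding upd
  proof (cases "length us + Suc (length vs) = m")
    case True
    then have "length ?Xs = m" "length us < m" by simp_all
    with assms show "K (?Xs[length us := X + Y]) = K (?Xs[length us := X]) + K (?Xs[length us := Y])"
      unfolding multilinear_map_def by blast
  next
    case False
    show "K (?Xs[length us := X + Y]) = K (?Xs[length us := X]) + K (?Xs[length us := Y])"
      by (simp only: len[OF False] add_0_left)
  qed
  show "lift K (us @ (x, scale c X) # vs) = scale c (lift K (us @ (x, X) # vs))"
    unfolding upd
  proof (cases "length us + Suc (length vs) = m")
    case True
    then have "length ?Xs = m" "length us < m" by simp_all
    with assms show "K (?Xs[length us := scale c X]) = scale c (K (?Xs[length us := X]))"
      unfolding multilinear_map_def by blast
  next
    case False
    show "K (?Xs[length us := scale c X]) = scale c (K (?Xs[length us := X]))"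
      by (simp only: len[OF False] scale_zero_right)
  qed
qed

lemma graded_map_lift:
  assumes K: "K \<in> Msp p" and p: "- 1 \<le> p 0"
  shows "graded_map p (lift K)"
  unfolding graded_map_def
proof (intro conjI allI impI)
  show "slot_linear (lift K)" by (rule slot_linear_lift[OF M_multilinear[OF K p]])
  show "arity (ar p) (lift K)"
    using M_multilinear[OF K p] by (simp add: arity_def lift_def multilinear_map_def)
  fix zs assume "homogeneous zs \<and> length zs = ar p"
  then show "lift K zs \<in> V (sum_list (map fst zs) + wt p)"
    using K p by (simp add: M_space_def lift_def homogeneous_zip_iff ar_def)
qed

text \<open>
  Homogeneous arguments span.  The induction replaces the arguments by homogeneous ones starting from
  the right: at stage \<open>j\<close> those at positions \<open>\<ge> j\<close> are homogeneous.
\<close>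
lemma multilinear_eq_0:
  assumes K: "multilinear_map scale m K" and 0: "\<And>zs. homogeneous zs \<Longrightarrow> length zs = m \<Longrightarrow> lift K zs = 0"
  shows "K = 0"
proof -
  have is_linear: "slot_linear (lift K)" by (rule slot_linear_lift[OF K])
  have "K Xs = 0" if "length Xs = m" "j \<le> m" "\<And>i. j \<le> i \<Longrightarrow> i < m \<Longrightarrow> \<exists>x\<in>Zn n. Xs ! i \<in> V x" for j Xs
    using that
  proof (induction j arbitrary: Xs)
    case 0
    then have "\<forall>i<m. \<exists>x. x \<in> Zn n \<and> Xs ! i \<in> V x" by blast
    then obtain d where d: "\<And>i. i < m \<Longrightarrow> d i \<in> Zn n \<and> Xs ! i \<in> V (d i)" by metis
    let ?zs = "zip (map d [0..<m]) Xs"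
    have "homogeneous ?zs" using d 0(1) by (auto simp: homogeneous_def set_zip)
    moreover have "map snd ?zs = Xs" using 0(1) by simp
    ultimately show ?case using assms(2)[of ?zs] 0(1) by (simp add: lift_def)
  next
    case (Suc j)
    let ?S = "{x. hcomp n V (Xs ! j) x \<noteq> 0}"
    let ?zs = "map (\<lambda>X. (undefined, X)) Xs"
    have snd: "map snd (?zs[j := (undefined, X)]) = Xs[j := X]" for X
      by (simp add: map_update comp_def)
    have "K Xs = K (Xs[j := \<Sum>x\<in>?S. hcomp n V (Xs ! j) x])"
      by (simp only: sum_hcomp[OF UNIV_I] list_update_id)
    also have "\<dots> = lift K (?zs[j := (undefined, \<Sum>x\<in>?S. hcomp n V (Xs ! j) x)])"
      by (simp only: lift_def snd)
    also have "\<dots> = (\<Sum>x\<in>?S. lift K (?zs[j := (undefined, hcomp n V (Xs ! j) x)]))"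
      using slot_linear_sum[OF is_linear, of "take j ?zs" undefined _ ?S "drop (Suc j) ?zs"] Suc.prems
      by (simp add: upd_conv_take_nth_drop)
    also have "\<dots> = (\<Sum>x\<in>?S. K (Xs[j := hcomp n V (Xs ! j) x]))"
      by (simp only: lift_def snd)
    also have "\<dots> = 0"
    proof (rule sum.neutral, rule ballI, rule Suc.IH)
      fix x i assume x: "x \<in> ?S" and i: "j \<le> i" "i < m"
      have "x \<in> Zn n" "hcomp n V (Xs ! j) x \<in> V x"
        using x hcomp_outside hcomp_in by (auto intro: ccontr)
      then show "\<exists>y\<in>Zn n. Xs[j := hcomp n V (Xs ! j) x] ! i \<in> V y"
        using Suc.prems i by (cases "i = j") auto
    qed (use Suc.prems in auto)
    finally show ?case .
  qed
  from this[of _ m] have "K Xs = 0" for Xs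
    using K by (cases "length Xs = m") (auto simp: multilinear_map_def)
  then show ?thesis by (simp add: fun_eq_iff zero_fun_apply)
qed

sublocale fs: vector_space "fscale scale :: 'k \<Rightarrow> ('v list \<Rightarrow> 'v) \<Rightarrow> 'v list \<Rightarrow> 'v"
  by (rule vector_space_fscale)

lemma lift_add: "lift (K + L) = (\<lambda>zs. lift K zs + lift L zs)"
  and lift_fscale: "lift (fscale scale c K) = (\<lambda>zs. scale c (lift K zs))"
  and lift_zero: "lift 0 = (\<lambda>zs. 0)"
  by (simp_all add: lift_def fun_eq_iff plus_fun_apply fscale_def zero_fun_apply)

lemma subspace_M:
  assumes p: "p \<in> Zn (Suc n)"
  shows "fs.subspace (Msp p)"
proof (cases "p 0 < - 1")
  case True
  then show ?thesis by (simp add: M_space_def)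
next
  case False
  have sub: "subspace (V (sum_list xs + wt p))" if "homog_list n V xs Xs" for xs Xs
  proof -
    have "homogeneous (zip xs Xs)" "length xs = length Xs" using that by (simp_all add: homog_list_iff)
    then have "sum_list xs \<in> Zn n" using homogeneous_Zn[of "zip xs Xs"] by simp
    then show ?thesis using p by (intro subspace_V Zn_add wt_Zn)
  qed
  show ?thesis
    unfolding M_space_def multilinear_map_def
    using False
    by (intro fs.subspaceI)
      (auto simp: zero_fun_apply plus_fun_apply fscale_def scale_right_distrib add_ac mult.commute
        intro: subspace_0[OF sub] subspace_add[OF sub] subspace_scale[OF sub])
qed

lemma M_eq_0I:
  assumes "K \<in> Msp p" "- 1 \<le> p 0" "\<And>zs. homogeneous zs \<Longrightarrow> length zs = ar p \<Longrightarrow> lift K zs = 0"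
  shows "K = 0"
  using multilinear_eq_0[OF M_multilinear[OF assms(1,2)] assms(3)] .

lemma M_eqI:
  assumes p: "p \<in> Zn (Suc n)" "- 1 \<le> p 0" and KL: "K \<in> Msp p" "L \<in> Msp p"
    and eq: "\<And>zs. homogeneous zs \<Longrightarrow> length zs = ar p \<Longrightarrow> lift K zs = lift L zs"
  shows "K = L"
proof -
  have "K - L = 0"
    by (rule M_eq_0I[OF fs.subspace_diff[OF subspace_M[OF p(1)] KL] p(2)])
      (use eq in \<open>simp add: lift_def\<close>)
  then show ?thesis by simp
qed

text \<open>Only components enter the extension, and these are homogeneous.\<close>
lemma ext_map_cong:
  assumes "\<And>zs. homogeneous zs \<Longrightarrow> F zs = G zs"
  shows "ext_map F = ext_map G"
proof
  fix Xs
  show "ext_map F Xs = ext_map G Xs"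
    unfolding ext_map_def homog_ext_def
  proof (intro sum.cong refl)
    fix xs assume "xs \<in> {xs. list_all2 (\<lambda>x X. hcomp n V X x \<noteq> 0) xs Xs}"
    then have xs: "list_all2 (\<lambda>x X. hcomp n V X x \<noteq> 0) xs Xs" by simp
    then have "set xs \<subseteq> Zn n"
      using hcomp_outside by (fastforce simp: list_all2_conv_all_nth in_set_conv_nth)
    then have "homog_list n V xs (comps xs Xs)"
      using xs by (intro homog_list_comps) (auto dest: list_all2_lengthD)
    then show "F (zip xs (comps xs Xs)) = G (zip xs (comps xs Xs))"
      by (intro assms) (simp add: homog_list_iff)
  qed
qed

lemma ext_map_add: "ext_map (\<lambda>zs. F zs + G zs) = ext_map F + ext_map G"
  and ext_map_diff: "ext_map (\<lambda>zs. F zs - G zs) = ext_map F - ext_map G"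
  and ext_map_scale: "ext_map (\<lambda>zs. scale c (F zs)) = fscale scale c (ext_map F)"
  and ext_map_zero: "ext_map (\<lambda>zs. 0) = 0"
  by (simp_all add: ext_map_def homog_ext_def fun_eq_iff plus_fun_apply zero_fun_apply fscale_def
      sum.distrib sum_subtractf scale_sum_right)

section \<open>Alternating maps\<close>

lemma alternator_eq: "alternator n scale V K = ext_map (alt (lift K))"
proof
  fix Xs
  show "alternator n scale V K Xs = ext_map (alt (lift K)) Xs"
    unfolding alternator_def ext_map_def
  proof (rule homog_ext_cong)
    fix ys :: "(nat \<Rightarrow> int) list" and Ys :: "'v list"
    assume len: "length ys = length Xs" "length Ys = length Xs"
    have "map snd (permute_list \<sigma> (zip ys Ys)) = permute_list \<sigma> Ys"
      if "\<sigma> permutes {..<length Xs}" for \<sigma>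
      using permute_list_map[of \<sigma> "zip ys Ys" snd] that len by simp
    then show "scale (1 / fact (length Ys)) (\<Sum>\<sigma> | \<sigma> permutes {..<length Ys}.
          scale (msign n \<sigma> ys) (K (permute_list \<sigma> Ys))) = alt (lift K) (zip ys Ys)"
      using len by (simp add: alt_def act_def lift_def)
  qed
qed

lemma alternator_ext_map:
  assumes "slot_linear F"
  shows "alternator n scale V (ext_map F) = ext_map (alt F)"
  unfolding alternator_eq
proof (rule ext_map_cong, rule alt_cong)
  fix zs ys :: "'v graded_list"
  assume "homogeneous zs" "set ys = set zs"
  then show "lift (ext_map F) ys = F ys" by (intro lift_ext_map assms) (simp add: homogeneous_def)
qed

abbreviation "Agr \<equiv> A_grade n scale V"

lemma A_grade_eq: "Agr p = alternator n scale V ` Msp p"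
  by (simp add: A_grade_def A_space_def wt_def)

lemma alternator_zero: "alternator n scale V 0 = 0"
proof -
  have "alt (\<lambda>zs. 0) = (\<lambda>zs. 0)" by (rule ext) (rule alt_zero)
  then show ?thesis by (simp add: alternator_eq lift_zero ext_map_zero)
qed

lemma A_grade_trivial: "p 0 < - 1 \<Longrightarrow> Agr p = {0}"
  by (simp add: A_grade_eq M_space_def alternator_zero)

lemma subspace_A_grade:
  assumes "p \<in> Zn (Suc n)"
  shows "fs.subspace (Agr p)"
proof (rule fs.subspaceI)
  note M = subspace_M[OF assms]
  have add: "alternator n scale V (K + L) = alternator n scale V K + alternator n scale V L" for K L
    unfolding alternator_eq lift_add
    by (subst ext_map_add[symmetric]) (simp add: alt_add[abs_def])
  have sc: "alternator n scale V (fscale scale c K) = fscale scale c (alternator n scale V K)" for c K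
    unfolding alternator_eq lift_fscale
    by (subst ext_map_scale[symmetric]) (simp add: alt_scale[abs_def])
  show "0 \<in> Agr p"
    using alternator_zero unfolding A_grade_eq using fs.subspace_0[OF M] by (metis imageI)
  show "K + L \<in> Agr p" if "K \<in> Agr p" "L \<in> Agr p" for K L
    using that fs.subspace_add[OF M] unfolding A_grade_eq by (auto simp: add[symmetric])
  show "fscale scale c K \<in> Agr p" if "K \<in> Agr p" for K c
    using that fs.subspace_scale[OF M] unfolding A_grade_eq by (auto simp: sc[symmetric])
qed

text \<open>The image of the projection \<open>\<alpha>\<close> consists of its fixed points.\<close>
lemma A_grade_iff:
  assumes p: "p \<in> Zn (Suc n)" "- 1 \<le> p 0"
  shows "K \<in> Agr p \<longleftrightarrow>
    K \<in> Msp p \<and> (\<forall>zs. homogeneous zs \<longrightarrow> length zs = ar p \<longrightarrow> alt (lift K) zs = lift K zs)"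
    (is "_ \<longleftrightarrow> ?R")
proof
  assume "K \<in> Agr p"
  then obtain L where L: "L \<in> Msp p" "K = ext_map (alt (lift L))"
    by (auto simp: A_grade_eq alternator_eq)
  have F: "graded_map p (alt (lift L))"
    by (rule graded_map_alt[OF graded_map_lift[OF L(1) p(2)] p(1)])
  have "alt (lift K) zs = lift K zs" if "homogeneous zs" for zs
  proof -
    have "alt (lift K) zs = alt (alt (lift L)) zs"
      unfolding L(2) using that homogeneous_set_eq
      by (intro alt_cong lift_ext_map graded_map_slot_linear[OF F]) blast
    also have "\<dots> = lift K zs"
      unfolding alt_alt L(2) by (rule lift_ext_map[OF graded_map_slot_linear[OF F] that, symmetric])
    finally show ?thesis .
  qed
  moreover have "K \<in> Msp p" unfolding L(2) by (rule ext_map_in_M[where p = p, OF F p(2)])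
  ultimately show ?R by blast
next
  assume R: ?R
  have F: "graded_map p (alt (lift K))"
    using R by (intro graded_map_alt graded_map_lift p) auto
  have "K = ext_map (alt (lift K))"
    using R ext_map_in_M[where p = p, OF F p(2)]
    by (intro M_eqI[where p = p, OF p]) (auto simp: lift_ext_map graded_map_slot_linear[OF F])
  then show "K \<in> Agr p" using R unfolding A_grade_eq alternator_eq by blast
qed

lemma A_grade_M: "p \<in> Zn (Suc n) \<Longrightarrow> K \<in> Agr p \<Longrightarrow> K \<in> Msp p"
  using A_grade_iff A_grade_trivial fs.subspace_0[OF subspace_M] by (metis insertE empty_iff not_less)

lemma graded_map_A:
  "p \<in> Zn (Suc n) \<Longrightarrow> - 1 \<le> p 0 \<Longrightarrow> K \<in> Agr p \<Longrightarrow> graded_map p (lift K)"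
  by (intro graded_map_lift A_grade_M)

section \<open>The bracket as an alternated commutator\<close>

abbreviation "jop p q \<equiv> j_op n scale V (p 0) (wt p) (q 0) (wt q)"
abbreviation "iop p q \<equiv> i_op n scale V (p 0) (wt p) (q 0) (wt q)"
abbreviation "hb p q \<equiv> hbracket n scale V (p 0) (wt p) (q 0) (wt q)"

text \<open>If \<open>k\<^sub>2 = -1\<close>, both sides vanish: there is no slot to insert into.\<close>
lemma j_op_eq:
  assumes p: "p \<in> Zn (Suc n)" "- 1 \<le> p 0" and q: "q \<in> Zn (Suc n)" "- 1 \<le> q 0"
    and K: "graded_map p (lift K)" and L: "graded_map q (lift L)"
  shows "jop p q K L = ext_map (\<lambda>zs. scale (sg n (wt p) (wt q)) (insertion p (lift K) (lift L) zs))"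
proof
  fix Xs
  have JJ: "graded_map (p + q) (insertion p (lift K) (lift L))"
    by (rule graded_map_insertion[OF K L p q])
  show "jop p q K L Xs = ext_map (\<lambda>zs. scale (sg n (wt p) (wt q)) (insertion p (lift K) (lift L) zs)) Xs"
  proof (cases "q 0 < 0 \<or> int (length Xs) \<noteq> p 0 + q 0 + 1")
    case True
    have "insertion p (lift K) (lift L) zs = 0" if "length zs = length Xs" for zs
    proof (cases "q 0 < 0")
      case True
      then show ?thesis
        by (intro insertion_arity_zero[OF graded_map_arity[OF L]]) (simp add: ar_def)
    next
      case False
      then have "length zs \<noteq> ar (p + q)"
        using \<open>q 0 < 0 \<or> _\<close> p(2) that by (auto simp: ar_def plus_fun_apply)
      then show ?thesis using graded_map_arity[OF JJ] by (simp add: arity_def)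
    qed
    then have "ext_map (\<lambda>zs. scale (sg n (wt p) (wt q)) (insertion p (lift K) (lift L) zs)) Xs =
        homog_ext n V (\<lambda>xs Xs. 0) Xs"
      unfolding ext_map_def by (intro homog_ext_cong) simp
    with True show ?thesis by (simp add: j_op_def homog_ext_zero)
  next
    case False
    have a: "nat (p 0 + 1) = ar p" by (simp add: ar_def)
    have slots: "{..nat (q 0)} = {i. i + ar p \<le> length Xs}"
      using False p(2) by (auto simp: ar_def)
    show ?thesis
      unfolding j_op_def ext_map_def if_not_P[OF False] a
    proof (rule homog_ext_cong)
      fix ys :: "(nat \<Rightarrow> int) list" and Ys :: "'v list"
      assume len: "length ys = length Xs" "length Ys = length Xs"
      have "scale ((- 1) powi (p 0 * int i + ip n (wt p) (wt q + sum_list (take i ys))))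
           (L (take i Ys @ [K (take (ar p) (drop i Ys))] @ drop (i + ar p) Ys)) =
          scale (sg n (wt p) (wt q)) (insert_at p (lift K) i (lift L) (zip ys Ys))"
        if i: "i + ar p \<le> length Xs" for i
      proof -
        have "(- 1 :: 'k) powi (p 0 * int i + ip n (wt p) (wt q + sum_list (take i ys))) =
            sg n (wt p) (wt q) * pass_signs p (take i (zip ys Ys))"
        proof -
          have "map fst (take i (zip ys Ys)) = take i ys" using len by (simp add: take_map[symmetric])
          moreover have "length (take i (zip ys Ys)) = i" using len i by simp
          ultimately show ?thesis
            by (simp add: pass_signs_eq power_int_add sg_add_right mult_ac flip: sg_def)
        qed
        moreover have "map snd (take i (zip ys Ys)) = take i Ys"
            "map snd (take (ar p) (drop i (zip ys Ys))) = take (ar p) (drop i Ys)"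
            "map snd (drop (i + ar p) (zip ys Ys)) = drop (i + ar p) Ys"
          using len by (simp_all add: take_map[symmetric] drop_map[symmetric])
        ultimately show ?thesis by (simp add: insert_at_def lift_def block_def)
      qed
      then show "(\<Sum>i\<le>nat (q 0). scale ((- 1) powi (p 0 * int i + ip n (wt p) (wt q + sum_list (take i ys))))
             (L (take i Ys @ [K (take (ar p) (drop i Ys))] @ drop (i + ar p) Ys))) =
          scale (sg n (wt p) (wt q)) (insertion p (lift K) (lift L) (zip ys Ys))"
        unfolding slots insertion_def scale_sum_right using len by (intro sum.cong) auto
    qed
  qed
qed

text \<open>The factorials in \<open>i(K\<^sub>1)K\<^sub>2\<close>, together with the constant sign missing from \<open>insertion\<close>.\<close>
definition coef :: "(nat \<Rightarrow> int) \<Rightarrow> (nat \<Rightarrow> int) \<Rightarrow> 'k" where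
  "coef p q = fact (ar (p + q)) / (fact (ar p) * fact (ar q)) * sg n (wt p) (wt q)"

lemma coef_commute: "coef p q = coef q p"
  by (simp add: coef_def sg_commute[of n "wt p"] add.commute[of p] mult.commute)

lemma i_op_eq:
  assumes p: "p \<in> Zn (Suc n)" "- 1 \<le> p 0" and q: "q \<in> Zn (Suc n)" "- 1 \<le> q 0"
    and K: "graded_map p (lift K)" and L: "graded_map q (lift L)"
  shows "iop p q K L = ext_map (\<lambda>zs. scale (coef p q) (alt (insertion p (lift K) (lift L)) zs))"
proof -
  have "slot_linear (\<lambda>zs. scale (sg n (wt p) (wt q)) (insertion p (lift K) (lift L) zs))"
    by (rule graded_map_slot_linear, rule graded_map_scale, rule Zn_add[OF p(1) q(1)], rule graded_map_insertion[OF K L p q])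
  then have "alternator n scale V (jop p q K L) =
      ext_map (alt (\<lambda>zs. scale (sg n (wt p) (wt q)) (insertion p (lift K) (lift L) zs)))"
    unfolding j_op_eq[OF assms] by (rule alternator_ext_map)
  then show ?thesis
    unfolding i_op_def coef_def
    by (simp add: alt_scale[abs_def] ar_def plus_fun_apply add.assoc flip: ext_map_scale)
qed

lemma hbracket_eq:
  assumes p: "p \<in> Zn (Suc n)" "- 1 \<le> p 0" and q: "q \<in> Zn (Suc n)" "- 1 \<le> q 0"
    and K: "graded_map p (lift K)" and L: "graded_map q (lift L)"
  shows "hb p q K L = ext_map (\<lambda>zs. scale (coef p q) (alt (commutator p (lift K) q (lift L)) zs))"
proof -
  have "hb p q K L = ext_map (\<lambda>zs. scale (coef p q) (alt (insertion p (lift K) (lift L)) zs) -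
      scale (csg p q) (scale (coef p q) (alt (insertion q (lift L) (lift K)) zs)))"
    unfolding hbracket_def i_op_eq[OF p q K L] i_op_eq[OF q p L K] ext_map_diff ext_map_scale
    by (simp add: sg_def ip_Suc coef_commute[of q p] wt_def flip: ext_map_scale)
  also have "\<dots> = ext_map (\<lambda>zs. scale (coef p q) (alt (commutator p (lift K) q (lift L)) zs))"
    by (simp add: commutator_def[abs_def] alt_diff alt_scale scale_right_diff_distrib mult.commute)
  finally show ?thesis .
qed

lemma A_grade_slot_zero:
  assumes q: "q \<in> Zn (Suc n)" and L: "L \<in> Agr q"
  shows "L (Us @ 0 # Ws) = 0"
proof (cases "q 0 < - 1")
  case True
  then have "L = 0" using L A_grade_trivial by blast
  then show ?thesis by (simp add: zero_fun_apply)
next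
  case False
  then have "slot_linear (lift L)"
    using graded_map_slot_linear[OF graded_map_A[of q L]] q L by simp
  from slot_linear_zero[OF this, of "map (Pair undefined) Us" undefined "map (Pair undefined) Ws"]
  show ?thesis by (simp add: lift_def comp_def)
qed

lemma i_op_zero_right: "iop p q K 0 = 0"
proof -
  have "jop p q K 0 = 0"
    by (simp add: fun_eq_iff j_op_def homog_ext_zero zero_fun_apply)
  then show ?thesis by (simp add: i_op_def alternator_zero)
qed

lemma i_op_zero_left:
  assumes "q \<in> Zn (Suc n)" "L \<in> Agr q"
  shows "iop p q 0 L = 0"
proof -
  have "jop p q 0 L = 0"
    using A_grade_slot_zero[OF assms]
    by (simp add: fun_eq_iff j_op_def homog_ext_zero zero_fun_apply)
  then show ?thesis by (simp add: i_op_def alternator_zero)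
qed

lemma hbracket_zero:
  assumes "r \<in> Zn (Suc n)" "L \<in> Agr r"
  shows "hb p r 0 L = 0" "hb r p L 0 = 0"
  by (simp_all add: hbracket_def i_op_zero_right i_op_zero_left[OF assms])

lemma hbracket_anticommute: "hb p q K L = - fscale scale (csg p q) (hb q p L K)"
proof -
  have s: "(- 1 :: 'k) powi (p 0 * q 0 + ip n (wt p) (wt q)) = csg p q"
    "(- 1 :: 'k) powi (q 0 * p 0 + ip n (wt q) (wt p)) = csg p q"
    by (simp_all add: sg_def ip_Suc wt_def ip_commute[of n "q \<circ> Suc"] mult.commute)
  show ?thesis
    unfolding hbracket_def s by (simp add: fs.scale_right_diff_distrib)
qed

lemma commutator_graded:
  assumes p: "p \<in> Zn (Suc n)" "- 1 \<le> p 0" and q: "q \<in> Zn (Suc n)" "- 1 \<le> q 0"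
    and K: "graded_map p K" and L: "graded_map q L"
  shows "graded_map (p + q) (commutator p K q L)"
proof -
  have pq: "p + q \<in> Zn (Suc n)" using p q by (intro Zn_add)
  have "graded_map (p + q) (insertion q L K)"
    using graded_map_insertion[OF L K q p] by (simp only: add.commute[of p])
  then show ?thesis
    unfolding commutator_def[abs_def]
    by (intro graded_map_diff graded_map_scale pq graded_map_insertion[OF K L p q])
qed

lemma commutator_constants:
  assumes "p 0 = - 1" "q 0 = - 1" "graded_map p K" "graded_map q L"
  shows "commutator p K q L zs = 0"
  using assms by (simp add: commutator_def insertion_arity_zero[OF graded_map_arity] ar_def)

text \<open>
  The degenerate degrees are separate.  Below \<open>k = -1\<close> there is only the zero map, and the bracket of
  two constants would have degree \<open>k = -2\<close> and is zero.
\<close>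
lemma hbracket_A:
  assumes p: "p \<in> Zn (Suc n)" and q: "q \<in> Zn (Suc n)" and K: "K \<in> Agr p" and L: "L \<in> Agr q"
  shows "hb p q K L \<in> Agr (p + q)"
proof -
  have pq: "p + q \<in> Zn (Suc n)" by (rule Zn_add[OF p q])
  have 0: "0 \<in> Agr (p + q)" by (rule fs.subspace_0[OF subspace_A_grade[OF pq]])
  consider "p 0 < - 1" | "q 0 < - 1" | "p 0 = - 1" "q 0 = - 1"
    | "- 1 \<le> p 0" "- 1 \<le> q 0" "- 1 \<le> (p + q) 0"
    by (fastforce simp: plus_fun_apply)
  then show ?thesis
  proof cases
    case 1
    then have "K = 0" using K A_grade_trivial by blast
    then show ?thesis using hbracket_zero[OF q L] 0 by simp
  next
    case 2
    then have "L = 0" using L A_grade_trivial by blast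
    then show ?thesis using hbracket_zero[OF p K] 0 by simp
  next
    case 3
    then have g: "graded_map p (lift K)" "graded_map q (lift L)"
      using p q K L by (auto intro: graded_map_A)
    have "commutator p (lift K) q (lift L) = (\<lambda>zs. 0)"
      by (rule ext) (rule commutator_constants[OF 3 g])
    moreover have "hb p q K L = ext_map (\<lambda>zs. scale (coef p q) (alt (commutator p (lift K) q (lift L)) zs))"
      by (rule hbracket_eq[OF p _ q _ g]) (use 3 in simp_all)
    ultimately show ?thesis using 0 by (simp add: ext_map_zero)
  next
    case 4
    have g: "graded_map p (lift K)" "graded_map q (lift L)"
      using 4 p q K L by (auto intro: graded_map_A)
    define F where "F = (\<lambda>zs. scale (coef p q) (alt (commutator p (lift K) q (lift L)) zs))"
    have F: "graded_map (p + q) F"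
      unfolding F_def
      by (intro graded_map_scale graded_map_alt pq commutator_graded[OF p 4(1) q 4(2) g])
    have "hb p q K L = ext_map F"
      unfolding F_def by (rule hbracket_eq[OF p 4(1) q 4(2) g])
    moreover have "ext_map F \<in> Agr (p + q)"
      unfolding A_grade_iff[OF pq 4(3)]
    proof (intro conjI allI impI)
      show "ext_map F \<in> Msp (p + q)" by (rule ext_map_in_M[OF F 4(3)])
      fix zs assume zs: "homogeneous zs"
      have "alt (lift (ext_map F)) zs = alt F zs"
        using zs by (intro alt_cong lift_ext_map graded_map_slot_linear[OF F]) (simp add: homogeneous_def)
      also have "\<dots> = F zs" unfolding F_def alt_scale alt_alt ..
      finally show "alt (lift (ext_map F)) zs = lift (ext_map F) zs"
        by (simp only: lift_ext_map[OF graded_map_slot_linear[OF F] zs])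
    qed
    ultimately show ?thesis by simp
  qed
qed

lemma hbracket_add_left:
  assumes p: "p \<in> Zn (Suc n)" and q: "q \<in> Zn (Suc n)" and K: "K \<in> Agr p" "K' \<in> Agr p" and L: "L \<in> Agr q"
  shows "hb p q (K + K') L = hb p q K L + hb p q K' L"
proof (cases "- 1 \<le> p 0 \<and> - 1 \<le> q 0")
  case True
  have KK: "K + K' \<in> Agr p" by (rule fs.subspace_add[OF subspace_A_grade[OF p] K])
  have g: "graded_map p (lift K)" "graded_map p (lift K')" "graded_map q (lift L)"
    "graded_map p (lift (K + K'))"
    using True p q K L KK by (auto intro: graded_map_A)
  have "commutator p (lift (K + K')) q (lift L) = (\<lambda>zs. commutator p (lift K) q (lift L) zs + commutator p (lift K') q (lift L) zs)"
    by (rule ext)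
      (simp add: commutator_def lift_add insertion_add_left[OF graded_map_slot_linear[OF g(3)]] insertion_add_right scale_right_distrib)
  then show ?thesis
    using True p q g
    by (simp add: hbracket_eq alt_add scale_right_distrib ext_map_add)
next
  case False
  then consider "K = 0" "K' = 0" | "L = 0"
    using A_grade_trivial[of p] A_grade_trivial[of q] K L by fastforce
  then show ?thesis
  proof cases
    case 1
    then show ?thesis using hbracket_zero(1)[OF q L] by simp
  next
    case 2
    have "K + K' \<in> Agr p" by (rule fs.subspace_add[OF subspace_A_grade[OF p] K])
    with 2 show ?thesis using hbracket_zero(2)[OF p] K by simp
  qed
qed

lemma hbracket_scale_left:
  assumes p: "p \<in> Zn (Suc n)" and q: "q \<in> Zn (Suc n)" and K: "K \<in> Agr p" and L: "L \<in> Agr q"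
  shows "hb p q (fscale scale c K) L = fscale scale c (hb p q K L)"
proof (cases "- 1 \<le> p 0 \<and> - 1 \<le> q 0")
  case True
  have KK: "fscale scale c K \<in> Agr p" by (rule fs.subspace_scale[OF subspace_A_grade[OF p] K])
  have g: "graded_map p (lift K)" "graded_map q (lift L)" "graded_map p (lift (fscale scale c K))"
    using True p q K L KK by (auto intro: graded_map_A)
  have "commutator p (lift (fscale scale c K)) q (lift L) = (\<lambda>zs. scale c (commutator p (lift K) q (lift L) zs))"
    by (rule ext)
      (simp add: commutator_def lift_fscale insertion_scale_left[OF graded_map_slot_linear[OF g(2)]] insertion_scale_right
        scale_right_diff_distrib mult.commute)
  then show ?thesis
    using True p q g
    by (simp add: hbracket_eq alt_scale mult.commute flip: ext_map_scale)
next
  case False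
  then consider "K = 0" | "L = 0"
    using A_grade_trivial[of p] A_grade_trivial[of q] K L by fastforce
  then show ?thesis
  proof cases
    case 1
    then show ?thesis using hbracket_zero(1)[OF q L] by simp
  next
    case 2
    have "fscale scale c K \<in> Agr p" by (rule fs.subspace_scale[OF subspace_A_grade[OF p] K])
    with 2 show ?thesis using hbracket_zero(2)[OF p] K by simp
  qed
qed

lemma hbracket_add_right:
  assumes "p \<in> Zn (Suc n)" "q \<in> Zn (Suc n)" "K \<in> Agr p" "L \<in> Agr q" "L' \<in> Agr q"
  shows "hb p q K (L + L') = hb p q K L + hb p q K L'"
  unfolding hbracket_anticommute[of p q] hbracket_add_left[OF assms(2,1,4,5,3)]
  by (simp add: fs.scale_right_distrib)

lemma hbracket_scale_right:
  assumes "p \<in> Zn (Suc n)" "q \<in> Zn (Suc n)" "K \<in> Agr p" "L \<in> Agr q"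
  shows "hb p q K (fscale scale c L) = fscale scale c (hb p q K L)"
  unfolding hbracket_anticommute[of p q] hbracket_scale_left[OF assms(2,1,4,3)]
  by (simp add: mult.commute)

lemma insertion_cong_homogeneous:
  assumes K: "graded_map p K" "p \<in> Zn (Suc n)" and zs: "homogeneous zs"
    and F: "\<And>ys. homogeneous ys \<Longrightarrow> F ys = G ys"
  shows "insertion p K F zs = insertion p K G zs"
  unfolding insertion_def
proof (intro sum.cong refl)
  fix i assume "i \<in> {i. i + ar p \<le> length zs}"
  then obtain us ws vs where s: "zs = us @ ws @ vs" "length us = i" "length ws = ar p"
    using split_block[of i "ar p" zs] by blast
  have "homogeneous (us @ block p K ws # vs)"
    using zs homogeneous_block[OF K, of ws] s by simp
  then show "insert_at p K i F zs = insert_at p K i G zs"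
    unfolding s(1) insert_at_split[OF s(2,3)] by (simp only: F)
qed

lemma insertion_cong_homogeneous_left:
  assumes zs: "homogeneous zs" and K: "\<And>ys. homogeneous ys \<Longrightarrow> K ys = L ys"
  shows "insertion p K F zs = insertion p L F zs"
  unfolding insertion_def
proof (intro sum.cong refl)
  fix i assume "i \<in> {i. i + ar p \<le> length zs}"
  then obtain us ws vs where s: "zs = us @ ws @ vs" "length us = i" "length ws = ar p"
    using split_block[of i "ar p" zs] by blast
  then have "K ws = L ws" using zs K by simp
  then show "insert_at p K i F zs = insert_at p L i F zs"
    unfolding s(1) insert_at_split[OF s(2,3)] by (simp only: block_def)
qed

text \<open>
  The factor of a double bracket.  Its factorials depend only on the three arities and the total
  arity, and its sign on the three pairs of weights, so it is the same for all bracketings.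
\<close>
definition coef3 :: "(nat \<Rightarrow> int) \<Rightarrow> (nat \<Rightarrow> int) \<Rightarrow> (nat \<Rightarrow> int) \<Rightarrow> 'k" where
  "coef3 p q r = fact (ar (p + q + r)) / (fact (ar p) * fact (ar q) * fact (ar r)) *
     (sg n (wt p) (wt q) * sg n (wt p) (wt r) * sg n (wt q) (wt r))"

lemma coef3_permute: "coef3 q p r = coef3 p q r" "coef3 r p q = coef3 p q r"
  by (simp_all add: coef3_def sg_commute[of n "wt q" "wt p"] sg_commute[of n "wt r"] add_ac mult_ac)

lemma coef_coef: "coef p (q + r) * coef q r = coef3 p q r"
  by (simp add: coef_def coef3_def wt_add sg_add_right add_ac mult_ac)

text \<open>
  The inner bracket is an alternated commutator, and the inner alternation may be omitted since the
  outer one absorbs it.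
\<close>
lemma hbracket_hbracket:
  assumes p: "p \<in> Zn (Suc n)" "- 1 \<le> p 0" and q: "q \<in> Zn (Suc n)" "- 1 \<le> q 0"
    and r: "r \<in> Zn (Suc n)" "- 1 \<le> r 0"
    and K: "K \<in> Agr p" and L: "L \<in> Agr q" and M: "M \<in> Agr r"
  shows "hb p (q + r) K (hb q r L M) =
    ext_map (\<lambda>zs. scale (coef3 p q r) (alt (commutator p (lift K) (q + r) (commutator q (lift L) r (lift M))) zs))"
proof -
  have g: "graded_map p (lift K)" "graded_map q (lift L)" "graded_map r (lift M)"
    using assms by (auto intro: graded_map_A)
  have qr: "q + r \<in> Zn (Suc n)" using q r by (intro Zn_add)
  show ?thesis
  proof (cases "q 0 = - 1 \<and> r 0 = - 1")
    case True
    then have "hb q r L M \<in> {0}"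
      using hbracket_A[OF q(1) r(1) L M] A_grade_trivial[of "q + r"] by (simp add: plus_fun_apply)
    then have "hb p (q + r) K (hb q r L M) = 0" using hbracket_zero(2)[OF p(1) K] by simp
    moreover have "commutator q (lift L) r (lift M) = (\<lambda>zs. 0)"
      using True by (intro ext commutator_constants g) auto
    moreover have "commutator p (lift K) (q + r) (\<lambda>zs. 0) = (\<lambda>zs. 0)"
      by (rule ext)
        (simp add: commutator_def insertion_def insert_at_def block_def slot_linear_zero[OF graded_map_slot_linear[OF g(1)]])
    ultimately show ?thesis by (simp add: ext_map_zero)
  next
    case False
    then have qr': "- 1 \<le> (q + r) 0" using q r by (auto simp: plus_fun_apply)
    define B where "B = commutator q (lift L) r (lift M)"
    define G where "G = (\<lambda>zs. scale (coef q r) (alt B zs))"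
    have G: "graded_map (q + r) G"
      unfolding G_def B_def
      by (intro graded_map_scale graded_map_alt qr commutator_graded q r g)
    have LM: "hb q r L M = ext_map G"
      unfolding G_def B_def by (rule hbracket_eq[OF q r g(2,3)])
    have LMA: "graded_map (q + r) (lift (hb q r L M))"
      by (rule graded_map_A[OF qr qr' hbracket_A[OF q(1) r(1) L M]])
    have lift_LM: "lift (hb q r L M) zs = G zs" if "homogeneous zs" for zs
      unfolding LM by (rule lift_ext_map[OF graded_map_slot_linear[OF G] that])
    have "alt (commutator p (lift K) (q + r) (lift (hb q r L M))) zs =
        scale (coef q r) (alt (commutator p (lift K) (q + r) B) zs)" if zs: "homogeneous zs" for zs
    proof -
      have "alt (commutator p (lift K) (q + r) (lift (hb q r L M))) zs = alt (commutator p (lift K) (q + r) G) zs"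
      proof (rule alt_cong)
        fix ys :: "'v graded_list" assume "set ys = set zs"
        then have ys: "homogeneous ys" using zs by (simp add: homogeneous_def)
        show "commutator p (lift K) (q + r) (lift (hb q r L M)) ys = commutator p (lift K) (q + r) G ys"
          unfolding commutator_def
          by (simp only: insertion_cong_homogeneous[OF g(1) p(1) ys lift_LM] insertion_cong_homogeneous_left[OF ys lift_LM])
      qed
      also have "commutator p (lift K) (q + r) G = (\<lambda>ys. scale (coef q r) (commutator p (lift K) (q + r) (alt B) ys))"
        by (rule ext) (simp add: G_def commutator_def insertion_scale_right insertion_scale_left[OF graded_map_slot_linear[OF g(1)]]
            scale_right_diff_distrib mult.commute)
      finally show ?thesis
        by (simp only: alt_scale alt_commutator_alt[where p = p, OF p(2) graded_map_slot_linear[OF g(1)]])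
    qed
    then show ?thesis
      unfolding hbracket_eq[OF p qr qr' g(1) LMA] B_def
      by (intro ext_map_cong) (simp add: coef_coef)
  qed
qed

text \<open>
  All three double brackets carry the factor \<open>coef3\<close>, so this is the alternation of the Jacobi
  identity for the commutator.  The double bracket with the inner bracket on the left is first
  reversed by anticommutativity, to bring it into the form of \<open>hbracket_hbracket\<close>.
\<close>
lemma hbracket_Jacobi:
  assumes p: "p \<in> Zn (Suc n)" and q: "q \<in> Zn (Suc n)" and r: "r \<in> Zn (Suc n)"
    and K: "K \<in> Agr p" and L: "L \<in> Agr q" and M: "M \<in> Agr r"
  shows "hb p (q + r) K (hb q r L M) =
    hb (p + q) r (hb p q K L) M + fscale scale (csg p q) (hb q (p + r) L (hb p r K M))"
proof -
  have sums: "p + q \<in> Zn (Suc n)" "p + r \<in> Zn (Suc n)" "q + r \<in> Zn (Suc n)"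
    using p q r by (auto intro: Zn_add)
  have A: "hb p q K L \<in> Agr (p + q)" "hb p r K M \<in> Agr (p + r)" "hb q r L M \<in> Agr (q + r)"
    using assms by (auto intro: hbracket_A)
  show ?thesis
  proof (cases "- 1 \<le> p 0 \<and> - 1 \<le> q 0 \<and> - 1 \<le> r 0")
    case True
    then have d: "- 1 \<le> p 0" "- 1 \<le> q 0" "- 1 \<le> r 0" by auto
    have g: "graded_map p (lift K)" "graded_map q (lift L)" "graded_map r (lift M)"
      using d assms by (auto intro: graded_map_A)
    let ?K = "lift K" and ?L = "lift L" and ?M = "lift M"
    have Jac: "commutator p ?K (q + r) (commutator q ?L r ?M) =
        (\<lambda>zs. commutator (p + q) (commutator p ?K q ?L) r ?M zs + scale (csg p q) (commutator q ?L (p + r) (commutator p ?K r ?M) zs))"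
      by (intro ext commutator_Jacobi d g[THEN graded_map_slot_linear] g[THEN graded_map_arity])
    have "hb (p + q) r (hb p q K L) M = - fscale scale (csg (p + q) r) (hb r (p + q) M (hb p q K L))"
      by (rule hbracket_anticommute)
    also have "\<dots> = ext_map (\<lambda>zs. scale (- csg (p + q) r)
        (scale (coef3 p q r) (alt (commutator r ?M (p + q) (commutator p ?K q ?L)) zs)))"
      unfolding hbracket_hbracket[OF r d(3) p d(1) q d(2) M K L] coef3_permute(2)[where p = p and q = q and r = r]
        ext_map_scale[of "- csg (p + q) r"] by (rule fs.scale_minus_left[symmetric])
    also have "\<dots> = ext_map (\<lambda>zs. scale (coef3 p q r) (alt (commutator (p + q) (commutator p ?K q ?L) r ?M) zs))"
    proof -
      have "commutator (p + q) (commutator p ?K q ?L) r ?M = (\<lambda>zs. scale (- csg (p + q) r) (commutator r ?M (p + q) (commutator p ?K q ?L) zs))"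
        by (rule ext) (subst commutator_anticommute, simp)
      then show ?thesis by (simp only: alt_scale scale_left_commute[of "coef3 p q r"])
    qed
    finally have KLM: "hb (p + q) r (hb p q K L) M = \<dots>" .
    show ?thesis
      unfolding KLM hbracket_hbracket[OF p d(1) q d(2) r d(3) K L M]
        hbracket_hbracket[OF q d(2) p d(1) r d(3) L K M] coef3_permute(1)[where p = p and q = q and r = r] Jac
      by (simp only: alt_add alt_scale scale_right_distrib ext_map_add ext_map_scale[symmetric]
          scale_left_commute[of "csg p q"])
  next
    case False
    then have "p 0 < - 1 \<or> q 0 < - 1 \<or> r 0 < - 1" by linarith
    then consider "K = 0" | "L = 0" | "M = 0"
      using K L M A_grade_trivial by blast
    then show ?thesis
    proof cases
      case 1
      then show ?thesis
        using hbracket_zero(1)[OF q L] hbracket_zero(1)[OF r M] hbracket_zero(1)[OF sums(3) A(3)]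
          hbracket_zero(2)[OF q L] by simp
    next
      case 2
      then show ?thesis
        using hbracket_zero(1)[OF r M] hbracket_zero(2)[OF p K] hbracket_zero(1)[OF sums(2) A(2)] by simp
    next
      case 3
      then show ?thesis
        using hbracket_zero(2)[OF q L] hbracket_zero(2)[OF p K] hbracket_zero(2)[OF sums(1) A(1)] by simp
    qed
  qed
qed

section \<open>The graded Lie algebra of alternating maps\<close>

lemma Zn_Suc_eqI: "p 0 = q 0 \<Longrightarrow> wt p = wt q \<Longrightarrow> p = q"
proof
  fix i
  assume "p 0 = q 0" and "wt p = wt q"
  then have "p (Suc j) = q (Suc j)" for j by (metis comp_apply wt_def)
  with \<open>p 0 = q 0\<close> show "p i = q i" by (cases i) simp_all
qed

text \<open>
  The sum over \<open>(k, \<kappa>)\<close> is direct.  The number of arguments separates different \<open>k\<close>, and on given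
  homogeneous arguments the values of maps of different weights \<open>\<kappa>\<close> have different degrees in \<open>V\<close>.
\<close>
lemma A_grade_sum_eq_0:
  assumes S: "finite S" "S \<subseteq> Zn (Suc n)" and h: "\<And>p. p \<in> S \<Longrightarrow> h p \<in> Agr p"
    and sum: "(\<Sum>p\<in>S. h p) = 0" and p: "p \<in> S"
  shows "h p = 0"
proof (cases "p 0 < - 1")
  case True
  then show ?thesis using h[OF p] A_grade_trivial by blast
next
  case False
  then have d: "- 1 \<le> p 0" by simp
  have pZ: "p \<in> Zn (Suc n)" using S p by blast
  show ?thesis
  proof (rule M_eq_0I[OF A_grade_M[OF pZ h[OF p]] d])
    fix zs assume zs: "homogeneous zs" "length zs = ar p"
    let ?T = "{q \<in> S. q 0 = p 0}"
    have "lift (h q) zs = 0" if "q \<in> S - ?T" for q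
    proof (cases "q 0 < - 1")
      case True
      then have "h q = 0" using that h A_grade_trivial by blast
      then show ?thesis by (simp add: lift_zero)
    next
      case False
      then have "arity (ar q) (lift (h q))"
        using that S h by (intro graded_map_arity graded_map_A) auto
      moreover have "ar q \<noteq> ar p" using that False d by (auto simp: ar_def)
      ultimately show ?thesis using zs by (simp add: arity_def)
    qed
    then have "(\<Sum>q\<in>?T. lift (h q) zs) = (\<Sum>q\<in>S. lift (h q) zs)"
      using S by (intro sum.mono_neutral_left) auto
    also have "\<dots> = lift (\<Sum>q\<in>S. h q) zs"
      using S(1) by (induction S rule: finite_induct) (simp_all add: lift_zero lift_add)
    also have "\<dots> = 0" by (simp add: sum lift_zero)
    finally have 0: "(\<Sum>q\<in>?T. lift (h q) zs) = 0" .
    show "lift (h p) zs = 0"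
    proof (rule sum_homogeneous_eq_0[where d = "\<lambda>q. sum_list (map fst zs) + wt q", OF _ _ _ _ 0])
      show "inj_on (\<lambda>q. sum_list (map fst zs) + wt q) ?T"
        by (auto simp: inj_on_def intro: Zn_Suc_eqI)
      show "(\<lambda>q. sum_list (map fst zs) + wt q) ` ?T \<subseteq> Zn n"
        using S zs by (auto intro!: Zn_add homogeneous_Zn wt_Zn)
      show "lift (h q) zs \<in> V (sum_list (map fst zs) + wt q)" if "q \<in> ?T" for q
        using that S d zs by (intro graded_map_in[OF graded_map_A[OF _ _ h]]) (auto simp: ar_def)
    qed (use S p in auto)
  qed
qed

abbreviation "Atot \<equiv> A_total n scale V"

lemma graded_space_A: "graded_space (Suc n) (fscale scale) Atot Agr"
  unfolding graded_space_def
proof (intro conjI ballI ex_ex1I)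
  show "vector_space (fscale scale :: 'k \<Rightarrow> ('v list \<Rightarrow> 'v) \<Rightarrow> 'v list \<Rightarrow> 'v)" by (rule vector_space_fscale)
  show "fs.subspace Atot" by (simp add: A_total_def)
  show "fs.subspace (Agr p)" if "p \<in> Zn (Suc n)" for p by (rule subspace_A_grade[OF that])
  show "Agr p \<subseteq> Atot" if "p \<in> Zn (Suc n)" for p
    unfolding A_total_def using that by (auto intro: fs.span_base)
  have sub: "fs.subspace {K. \<exists>f. is_decomp (Suc n) Agr K f}"
  proof (rule fs.subspaceI)
    show "0 \<in> {K. \<exists>f. is_decomp (Suc n) Agr K f}"
      using fs.is_decomp_homogeneous[of "Suc n" Agr 0 0, OF subspace_A_grade Zn_zero
          fs.subspace_0[OF subspace_A_grade[OF Zn_zero]]] by blast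
  qed (use fs.is_decomp_add[of "Suc n" Agr, OF subspace_A_grade]
      fs.is_decomp_scale[of "Suc n" Agr, OF subspace_A_grade] in blast)+
  have "Atot \<subseteq> {K. \<exists>f. is_decomp (Suc n) Agr K f}"
    unfolding A_total_def
    by (rule fs.span_minimal[OF _ sub])
      (use fs.is_decomp_homogeneous[of "Suc n" Agr, OF subspace_A_grade] in blast)
  then show "\<exists>f. is_decomp (Suc n) Agr K f" if "K \<in> Atot" for K using that by blast
  show "f = g" if f: "is_decomp (Suc n) Agr K f" and g: "is_decomp (Suc n) Agr K g" for K f g
  proof
    fix p
    let ?S = "{p. f p \<noteq> 0} \<union> {p. g p \<noteq> 0}"
    have S: "finite ?S" "?S \<subseteq> Zn (Suc n)" using f g by (auto simp: is_decomp_def)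
    have "(\<Sum>p\<in>?S. f p - g p) = 0"
      using is_decomp_sum[OF f S(1)] is_decomp_sum[OF g S(1)] by (simp add: sum_subtractf)
    moreover have "f p - g p \<in> Agr p" if "p \<in> ?S" for p
      using that S f g by (intro fs.subspace_diff subspace_A_grade) (auto simp: is_decomp_def)
    ultimately have "f p - g p = 0" if "p \<in> ?S" using A_grade_sum_eq_0[OF S, of "\<lambda>p. f p - g p" p] that by blast
    then show "f p = g p" by (cases "p \<in> ?S") auto
  qed
qed

sublocale GA: graded "fscale scale :: 'k \<Rightarrow> ('v list \<Rightarrow> 'v) \<Rightarrow> 'v list \<Rightarrow> 'v" "Suc n" Atot Agr
  by unfold_locales (rule graded_space_A)

text \<open>The bracket of homogeneous elements, in the form in which \<open>A_bracket\<close> extends it bilinearly.\<close>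
definition bracket_form :: "(nat \<Rightarrow> int) list \<Rightarrow> ('v list \<Rightarrow> 'v) list \<Rightarrow> 'v list \<Rightarrow> 'v" where
  "bracket_form ps Ks = hb (ps ! 0) (ps ! 1) (Ks ! 0) (Ks ! 1)"

lemma A_bracket_eq: "A_bracket n scale V K L = homog_ext (Suc n) Agr bracket_form [K, L]"
  by (simp add: A_bracket_def bracket_form_def[abs_def] wt_def)

lemma homog_list_two:
  assumes "homog_list m W ps Ks" "length Ks = 2"
  obtains p q K L where "ps = [p, q]" "Ks = [K, L]" "p \<in> Zn m" "q \<in> Zn m" "K \<in> W p" "L \<in> W q"
proof -
  have len: "length ps = 2" using homog_list_length[OF assms(1)] assms(2) by simp
  have all: "ps ! i \<in> Zn m \<and> Ks ! i \<in> W (ps ! i)" if "i < 2" for i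
    using list_all2_nthD[OF assms(1)[unfolded homog_list_def], of i] that len by simp
  have two: "xs = [xs ! 0, xs ! 1]" if "length xs = 2" for xs :: "'x list"
    by (rule nth_equalityI) (use that in \<open>auto simp: less_Suc_eq numeral_2_eq_2\<close>)
  show ?thesis
    by (rule that[OF two[OF len] two[OF assms(2)]]) (use all[of 0] all[of 1] in simp_all)
qed

lemma hmultilinear_bracket_form: "hmultilinear (Suc n) (fscale scale) Agr 2 bracket_form"
  unfolding hmultilinear_def
proof (intro conjI allI impI)
  fix ps Ks i X Y
  assume a: "homog_list (Suc n) Agr ps Ks \<and> length Ks = 2 \<and> i < 2 \<and> X \<in> Agr (ps ! i) \<and> Y \<in> Agr (ps ! i)"
  then obtain p q K L where "ps = [p, q]" "Ks = [K, L]" "p \<in> Zn (Suc n)" "q \<in> Zn (Suc n)" "K \<in> Agr p" "L \<in> Agr q"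
    by (blast elim: homog_list_two)
  moreover from a have "i = 0 \<or> i = 1" by auto
  ultimately show "bracket_form ps (Ks[i := X + Y]) = bracket_form ps (Ks[i := X]) + bracket_form ps (Ks[i := Y])"
    using a by (elim disjE) (simp_all add: bracket_form_def hbracket_add_left hbracket_add_right)
next
  fix ps Ks i X c
  assume a: "homog_list (Suc n) Agr ps Ks \<and> length Ks = 2 \<and> i < 2 \<and> X \<in> Agr (ps ! i)"
  then obtain p q K L where "ps = [p, q]" "Ks = [K, L]" "p \<in> Zn (Suc n)" "q \<in> Zn (Suc n)" "K \<in> Agr p" "L \<in> Agr q"
    by (blast elim: homog_list_two)
  moreover from a have "i = 0 \<or> i = 1" by auto
  ultimately show "bracket_form ps (Ks[i := fscale scale c X]) = fscale scale c (bracket_form ps (Ks[i := X]))"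
    using a by (elim disjE) (simp_all add: bracket_form_def hbracket_scale_left hbracket_scale_right)
qed

lemma A_bracket_homogeneous:
  assumes "p \<in> Zn (Suc n)" "q \<in> Zn (Suc n)" "K \<in> Agr p" "L \<in> Agr q"
  shows "A_bracket n scale V K L = hb p q K L"
proof -
  have "homog_list (Suc n) Agr [p, q] [K, L]" using assms by (simp add: homog_list_def)
  from GA.homog_ext_homogeneous[OF hmultilinear_bracket_form this] show ?thesis
    by (simp add: A_bracket_eq bracket_form_def)
qed

lemma A_bracket_closed:
  assumes "K \<in> Atot" "L \<in> Atot"
  shows "A_bracket n scale V K L \<in> Atot"
  unfolding A_bracket_eq homog_ext_def
proof (rule fs.subspace_sum[OF GA.subspace_C])
  fix ps assume "ps \<in> {ps. list_all2 (\<lambda>p K. hcomp (Suc n) Agr K p \<noteq> 0) ps [K, L]}"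
  then obtain p q where ps: "ps = [p, q]" "hcomp (Suc n) Agr K p \<noteq> 0" "hcomp (Suc n) Agr L q \<noteq> 0"
    by (auto simp: list_all2_Cons2)
  then have pq: "p \<in> Zn (Suc n)" "q \<in> Zn (Suc n)" using assms GA.hcomp_outside by blast+
  then have "hb p q (hcomp (Suc n) Agr K p) (hcomp (Suc n) Agr L q) \<in> Agr (p + q)"
    using assms by (intro hbracket_A GA.hcomp_in)
  then show "bracket_form ps (GA.comps ps [K, L]) \<in> Atot"
    using GA.V_subset[OF Zn_add[OF pq]] ps by (auto simp: bracket_form_def)
qed

lemma graded_Lie_algebra_A:
  "graded_Lie_algebra (Suc n) (fscale scale) Atot Agr (A_bracket n scale V)"
  unfolding graded_Lie_algebra_def
proof (intro conjI ballI allI)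
  show "graded_space (Suc n) (fscale scale) Atot Agr" by (rule graded_space_A)
  fix X Y Z c
  assume XY: "X \<in> Atot" "Y \<in> Atot"
  show "A_bracket n scale V X Y \<in> Atot" by (rule A_bracket_closed[OF XY])
  show "A_bracket n scale V (fscale scale c X) Y = fscale scale c (A_bracket n scale V X Y)"
    using GA.homog_ext_scale[OF hmultilinear_bracket_form, of "[X, Y]" 0 X c] XY by (simp add: A_bracket_eq)
  show "A_bracket n scale V X (fscale scale c Y) = fscale scale c (A_bracket n scale V X Y)"
    using GA.homog_ext_scale[OF hmultilinear_bracket_form, of "[X, Y]" 1 Y c] XY by (simp add: A_bracket_eq)
  assume Z: "Z \<in> Atot"
  show "A_bracket n scale V (X + Y) Z = A_bracket n scale V X Z + A_bracket n scale V Y Z"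
    using GA.homog_ext_add[OF hmultilinear_bracket_form, of "[X, Z]" 0 X Y] XY Z by (simp add: A_bracket_eq)
  show "A_bracket n scale V Z (X + Y) = A_bracket n scale V Z X + A_bracket n scale V Z Y"
    using GA.homog_ext_add[OF hmultilinear_bracket_form, of "[Z, X]" 1 X Y] XY Z by (simp add: A_bracket_eq)
next
  fix p q K L
  assume a: "p \<in> Zn (Suc n)" "q \<in> Zn (Suc n)" "K \<in> Agr p" "L \<in> Agr q"
  show "A_bracket n scale V K L \<in> Agr (p + q)"
    unfolding A_bracket_homogeneous[OF a] by (rule hbracket_A[OF a])
  show "A_bracket n scale V K L = - fscale scale ((- 1) powi ip (Suc n) p q) (A_bracket n scale V L K)"
    unfolding A_bracket_homogeneous[OF a] A_bracket_homogeneous[OF a(2,1,4,3)]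
    using hbracket_anticommute[of p q K L] by (simp only: sg_def)
next
  fix p q r K L M
  assume a: "p \<in> Zn (Suc n)" "q \<in> Zn (Suc n)" "r \<in> Zn (Suc n)" "K \<in> Agr p" "L \<in> Agr q" "M \<in> Agr r"
  have s: "p + q \<in> Zn (Suc n)" "p + r \<in> Zn (Suc n)" "q + r \<in> Zn (Suc n)" using a by (auto intro: Zn_add)
  have A: "hb p q K L \<in> Agr (p + q)" "hb p r K M \<in> Agr (p + r)" "hb q r L M \<in> Agr (q + r)"
    using a by (auto intro: hbracket_A)
  show "A_bracket n scale V K (A_bracket n scale V L M) =
      A_bracket n scale V (A_bracket n scale V K L) M +
      fscale scale ((- 1) powi ip (Suc n) p q) (A_bracket n scale V L (A_bracket n scale V K M))"
    unfolding A_bracket_homogeneous[OF a(2,3,5,6)] A_bracket_homogeneous[OF a(1,2,4,5)]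
      A_bracket_homogeneous[OF a(1,3,4,6)] A_bracket_homogeneous[OF a(1) s(3) a(4) A(3)]
      A_bracket_homogeneous[OF s(1) a(3) A(1) a(6)] A_bracket_homogeneous[OF a(2) s(2) a(5) A(2)]
    using hbracket_Jacobi[OF a] by (simp only: sg_def)
qed

lemma alt_lift_A:
  assumes p: "p \<in> Zn (Suc n)" "- 1 \<le> p 0" and K: "K \<in> Agr p" and zs: "homogeneous zs"
  shows "alt (lift K) zs = lift K zs"
proof (cases "length zs = ar p")
  case True
  then show ?thesis using K zs unfolding A_grade_iff[OF p] by blast
next
  case False
  have g: "graded_map p (lift K)" by (rule graded_map_A[OF p K])
  show ?thesis
    using graded_map_arity[OF g] graded_map_arity[OF graded_map_alt[OF g p(1)]] False
    by (simp add: arity_def)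
qed

section \<open>The formula for alternating maps\<close>

text \<open>
  All \<open>ar q\<close> slots contribute the same as the first one.  To use this, the outer map is replaced by its
  alternation, which is invariant on all lists of pairs; the map itself is so on homogeneous ones.
\<close>
lemma lift_i_op:
  assumes p: "p \<in> Zn (Suc n)" "- 1 \<le> p 0" and q: "q \<in> Zn (Suc n)" "0 \<le> q 0"
    and K: "K \<in> Agr p" and L: "L \<in> Agr q"
    and zs: "homogeneous zs" "length zs = ar (p + q)"
  shows "lift (iop p q K L) zs = scale (coef p q * of_nat (ar q)) (alt (insert_at p (lift K) 0 (lift L)) zs)"
proof -
  have q': "- 1 \<le> q 0" using q by simp
  have g: "graded_map p (lift K)" "graded_map q (lift L)"
    using p q' q(1) K L by (auto intro: graded_map_A)
  have m: "ar p \<le> length zs" "Suc (length zs - ar p) = ar q"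
    using zs(2) p q by (auto simp: ar_def plus_fun_apply)
  have "alt (insertion p (lift K) (lift L)) zs = alt (insertion p (lift K) (alt (lift L))) zs"
  proof (rule alt_cong)
    fix ys :: "'v graded_list" assume "set ys = set zs"
    then have "homogeneous ys" using zs by (simp add: homogeneous_def)
    then show "insertion p (lift K) (lift L) ys = insertion p (lift K) (alt (lift L)) ys"
      by (rule insertion_cong_homogeneous[OF g(1) p(1)]) (rule alt_lift_A[OF q(1) q' L, symmetric])
  qed
  also have "\<dots> = alt (\<lambda>ys. scale (of_nat (ar q)) (insert_at p (lift K) 0 (alt (lift L)) ys)) zs"
    using alteq_insertion_alternating[where p = p and m = "length zs" and F = "alt (lift L)" and K = "lift K",
        OF p(2) m(1) act_alt]
    unfolding m(2) alteq_def by blast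
  also have "\<dots> = alt (\<lambda>ys. scale (of_nat (ar q)) (insert_at p (lift K) 0 (lift L) ys)) zs"
  proof (rule alt_cong)
    fix ys :: "'v graded_list" assume ys: "length ys = length zs" "set ys = set zs"
    then have h: "homogeneous ys" using zs by (simp add: homogeneous_def)
    have "homogeneous (take (ar p) ys)" "homogeneous (drop (ar p) ys)"
      using h by (auto simp: homogeneous_def dest: in_set_takeD in_set_dropD)
    then have "homogeneous (block p (lift K) (take (ar p) ys) # drop (ar p) ys)"
      using homogeneous_block[OF g(1) p(1), of "take (ar p) ys"] ys m by simp
    then have "alt (lift L) (block p (lift K) (take (ar p) ys) # drop (ar p) ys) =
        lift L (block p (lift K) (take (ar p) ys) # drop (ar p) ys)"
      by (rule alt_lift_A[OF q(1) q' L])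
    then show "scale (of_nat (ar q)) (insert_at p (lift K) 0 (alt (lift L)) ys) =
        scale (of_nat (ar q)) (insert_at p (lift K) 0 (lift L) ys)"
      by (simp add: insert_at_def)
  qed
  finally have alt: "alt (insertion p (lift K) (lift L)) zs =
      scale (of_nat (ar q)) (alt (insert_at p (lift K) 0 (lift L)) zs)" by (simp only: alt_scale)
  have "slot_linear (\<lambda>zs. scale (coef p q) (alt (insertion p (lift K) (lift L)) zs))"
    by (rule graded_map_slot_linear, rule graded_map_scale, rule Zn_add[OF p(1) q(1)], rule graded_map_alt,
        rule graded_map_insertion[OF g p q(1) q'], rule Zn_add[OF p(1) q(1)])
  then have "lift (iop p q K L) zs = scale (coef p q) (alt (insertion p (lift K) (lift L)) zs)"
    unfolding i_op_eq[OF p q(1) q' g] by (rule lift_ext_map) (rule zs(1))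
  then show ?thesis by (simp add: alt)
qed

lemma i_op_formula:
  assumes p: "p \<in> Zn (Suc n)" and q: "q \<in> Zn (Suc n)" "0 \<le> q 0"
    and K: "K \<in> Agr p" and L: "L \<in> Agr q"
    and xs: "homog_list n V xs Xs" and len: "int (length Xs) = p 0 + q 0 + 1"
  shows "iop p q K L Xs = scale (1 / (fact (ar p) * fact (nat (q 0))))
     (\<Sum>\<sigma> | \<sigma> permutes {..<length Xs}. scale (msign n \<sigma> xs * sg n (wt p) (wt q))
       (L (K (take (ar p) (permute_list \<sigma> Xs)) # drop (ar p) (permute_list \<sigma> Xs))))"
proof (cases "p 0 < - 1")
  case True
  then have "K = 0" using K A_grade_trivial by blast
  then show ?thesis
    using A_grade_slot_zero[OF q(1) L, of "[]"]
    by (simp add: i_op_zero_left[OF q(1) L] zero_fun_apply)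
next
  case False
  then have p': "- 1 \<le> p 0" by simp
  define zs where "zs = zip xs Xs"
  have zs: "homogeneous zs" "length zs = length Xs" "map fst zs = xs" "map snd zs = Xs"
    using xs by (simp_all add: homog_list_iff zs_def)
  have m: "length Xs = ar (p + q)" and q1: "ar q = Suc (nat (q 0))"
    using len p' q by (auto simp: ar_def plus_fun_apply)
  define T where "T \<sigma> = L (K (take (ar p) (permute_list \<sigma> Xs)) # drop (ar p) (permute_list \<sigma> Xs))" for \<sigma>
  have "act \<sigma> (insert_at p (lift K) 0 (lift L)) zs = scale (msign n \<sigma> xs) (T \<sigma>)"
    if "\<sigma> permutes {..<length Xs}" for \<sigma>
  proof -
    have "map snd (permute_list \<sigma> zs) = permute_list \<sigma> Xs"
      using permute_list_map[of \<sigma> zs snd] that zs by simp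
    then show ?thesis
      by (simp add: act_def insert_at_def T_def zs lift_def block_def flip: take_map drop_map)
  qed
  then have "alt (insert_at p (lift K) 0 (lift L)) zs =
      scale (1 / fact (length Xs)) (\<Sum>\<sigma> | \<sigma> permutes {..<length Xs}. scale (msign n \<sigma> xs) (T \<sigma>))"
    by (simp add: alt_def zs(2))
  then have "iop p q K L Xs = scale (coef p q * of_nat (ar q) / fact (length Xs))
      (\<Sum>\<sigma> | \<sigma> permutes {..<length Xs}. scale (msign n \<sigma> xs) (T \<sigma>))"
    using lift_i_op[OF p p' q K L zs(1)] by (simp add: lift_def zs m)
  also have "coef p q * of_nat (ar q) / fact (length Xs) =
      1 / (fact (ar p) * fact (nat (q 0))) * sg n (wt p) (wt q)"
  proof -
    have "(of_nat (Suc (nat (q 0))) :: 'k) \<noteq> 0" by (rule of_nat_neq_0)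
    then show ?thesis by (simp add: coef_def q1 m fact_Suc del: of_nat_Suc)
  qed
  finally show ?thesis
    by (simp add: T_def scale_sum_right mult_ac)
qed

section \<open>Alternating maps of two arguments and Lie brackets on V\<close>

lemma homogeneous_two:
  assumes "homogeneous zs" "length zs = 2"
  obtains x y X Y where "zs = [(x, X), (y, Y)]" "x \<in> Zn n" "y \<in> Zn n" "X \<in> V x" "Y \<in> V y"
proof -
  obtain a b where "zs = [a, b]"
    using assms(2) by (auto simp: numeral_2_eq_2 length_Suc_conv)
  with assms(1) show ?thesis by (intro that[of "fst a" "snd a" "fst b" "snd b"]) simp_all
qed

lemma homogeneous_three:
  assumes "homogeneous zs" "length zs = 3"
  obtains x y z X Y Z where "zs = [(x, X), (y, Y), (z, Z)]"
    "x \<in> Zn n" "y \<in> Zn n" "z \<in> Zn n" "X \<in> V x" "Y \<in> V y" "Z \<in> V z"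
proof -
  obtain a b c where "zs = [a, b, c]"
    using assms(2) by (auto simp: numeral_3_eq_3 length_Suc_conv)
  with assms(1) show ?thesis by (intro that[of "fst a" "snd a" "fst b" "snd b" "fst c" "snd c"]) simp_all
qed

text \<open>The group of permutations of two arguments is generated by the transposition.\<close>
lemma A_one_iff:
  assumes p: "p \<in> Zn (Suc n)" "p 0 = 1"
  shows "\<mu> \<in> Agr p \<longleftrightarrow> \<mu> \<in> Msp p \<and>
    (\<forall>x\<in>Zn n. \<forall>y\<in>Zn n. \<forall>X\<in>V x. \<forall>Y\<in>V y. \<mu> [X, Y] = - scale (sg n x y) (\<mu> [Y, X]))"
    (is "_ \<longleftrightarrow> _ \<and> ?anti")
proof -
  have ar: "ar p = 2" using p by (simp add: ar_def)
  have p': "- 1 \<le> p 0" using p by simp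
  let ?s = "transpose 0 (Suc 0) :: nat \<Rightarrow> nat"
  have s: "?s permutes {..<2}" by (auto intro!: permutes_swap_id)
  have s_act: "act ?s G [a, b] = scale (eps n (fst a) (fst b)) (G [b, a])" for G a b
    using act_adjacent[of "[]" G a b "[]"] by simp
  have anti_iff: "?anti \<longleftrightarrow> (\<forall>zs. homogeneous zs \<longrightarrow> length zs = 2 \<longrightarrow> act ?s (lift \<mu>) zs = lift \<mu> zs)"
  proof
    assume anti: ?anti
    show "\<forall>zs. homogeneous zs \<longrightarrow> length zs = 2 \<longrightarrow> act ?s (lift \<mu>) zs = lift \<mu> zs"
    proof (intro allI impI)
      fix zs assume "homogeneous zs" "length zs = 2"
      then obtain x y X Y where zs: "zs = [(x, X), (y, Y)]" "x \<in> Zn n" "y \<in> Zn n" "X \<in> V x" "Y \<in> V y"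
        by (rule homogeneous_two)
      have "\<mu> [X, Y] = - scale (sg n x y) (\<mu> [Y, X])" using anti zs(2-5) by blast
      then show "act ?s (lift \<mu>) zs = lift \<mu> zs"
        unfolding zs(1) s_act by (simp add: lift_def eps_def)
    qed
  next
    assume inv: "\<forall>zs. homogeneous zs \<longrightarrow> length zs = 2 \<longrightarrow> act ?s (lift \<mu>) zs = lift \<mu> zs"
    show ?anti
    proof (intro ballI)
      fix x y X Y assume "x \<in> Zn n" "y \<in> Zn n" "X \<in> V x" "Y \<in> V y"
      then have "act ?s (lift \<mu>) [(x, X), (y, Y)] = lift \<mu> [(x, X), (y, Y)]" using inv by simp
      then show "\<mu> [X, Y] = - scale (sg n x y) (\<mu> [Y, X])"
        unfolding s_act by (simp add: lift_def eps_def)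
    qed
  qed
  have "(\<forall>zs. homogeneous zs \<longrightarrow> length zs = 2 \<longrightarrow> alt (lift \<mu>) zs = lift \<mu> zs) \<longleftrightarrow>
      (\<forall>zs. homogeneous zs \<longrightarrow> length zs = 2 \<longrightarrow> act ?s (lift \<mu>) zs = lift \<mu> zs)"
  proof (intro iffI allI impI)
    fix zs assume inv: "\<forall>zs. homogeneous zs \<longrightarrow> length zs = 2 \<longrightarrow> alt (lift \<mu>) zs = lift \<mu> zs" and zs: "homogeneous zs" "length zs = 2"
    have "act ?s (lift \<mu>) zs = act ?s (alt (lift \<mu>)) zs"
    proof (rule act_cong)
      show "?s permutes {..<length zs}" using s zs by simp
      fix ys :: "'v graded_list" assume "length ys = length zs" "set ys = set zs"
      then have "homogeneous ys" "length ys = 2" using zs by (simp_all add: homogeneous_def)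
      with inv show "lift \<mu> ys = alt (lift \<mu>) ys" by simp
    qed
    also have "\<dots> = alt (lift \<mu>) zs" using s zs by (intro act_alt) simp
    also have "\<dots> = lift \<mu> zs" using inv zs by blast
    finally show "act ?s (lift \<mu>) zs = lift \<mu> zs" .
  next
    fix zs assume inv: "\<forall>zs. homogeneous zs \<longrightarrow> length zs = 2 \<longrightarrow> act ?s (lift \<mu>) zs = lift \<mu> zs" and zs: "homogeneous zs" "length zs = 2"
    have "\<forall>zs. homogeneous zs \<longrightarrow> length zs = 2 \<longrightarrow> act \<sigma> (lift \<mu>) zs = lift \<mu> zs" if "\<sigma> permutes {..<2}" for \<sigma>
      using that
    proof (induction rule: permutes_adjacent_induct)
      case id
      then show ?case by (simp only: act_id simp_thms)
    next
      case (swap r \<sigma>)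
      then have r: "r = 0" by simp
      show ?case
      proof (intro allI impI)
        fix zs assume zs: "homogeneous zs" "length zs = 2"
        have "act (?s \<circ> \<sigma>) (lift \<mu>) zs = act ?s (act \<sigma> (lift \<mu>)) zs"
          using act_act[of ?s zs \<sigma>] s swap.hyps zs by simp
        also have "\<dots> = act ?s (lift \<mu>) zs"
        proof (rule act_cong)
          show "?s permutes {..<length zs}" using s zs by simp
          fix ys :: "'v graded_list" assume "length ys = length zs" "set ys = set zs"
          then have "homogeneous ys" "length ys = 2" using zs by (simp_all add: homogeneous_def)
          with swap.IH show "act \<sigma> (lift \<mu>) ys = lift \<mu> ys" by blast
        qed
        also have "\<dots> = lift \<mu> zs" using inv zs by blast
        finally show "act (transpose r (Suc r) \<circ> \<sigma>) (lift \<mu>) zs = lift \<mu> zs" unfolding r .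
      qed
    qed
    then show "alt (lift \<mu>) zs = lift \<mu> zs" using zs by (intro alt_invariant) simp
  qed
  then show ?thesis unfolding A_grade_iff[OF p(1) p'] ar anti_iff by blast
qed

text \<open>
  For \<open>k = 1\<close> and weight \<open>0\<close> the sign \<open>(-1)\<^sup>k\<^sup>k\<close> is \<open>-1\<close>, so \<open>[\<mu>, \<mu>] = 2 i(\<mu>)\<mu>\<close>.  Twice the value of \<open>i(\<mu>)\<mu>\<close>
  on \<open>X, Y, Z\<close> is the signed sum of \<open>\<mu>(\<mu>(\<cdot>,\<cdot>),\<cdot>)\<close> over all permutations, hence twice a signed sum of the
  three terms \<open>T\<close>, \<open>Q\<close>, \<open>R\<close> below.
\<close>
lemma A_bracket_self_eq_0_iff:
  assumes p: "p \<in> Zn (Suc n)" "p 0 = 1" "wt p = 0" and \<mu>: "\<mu> \<in> Agr p"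
  shows "A_bracket n scale V \<mu> \<mu> = 0 \<longleftrightarrow>
    (\<forall>x\<in>Zn n. \<forall>y\<in>Zn n. \<forall>z\<in>Zn n. \<forall>X\<in>V x. \<forall>Y\<in>V y. \<forall>Z\<in>V z.
      \<mu> [X, \<mu> [Y, Z]] = \<mu> [\<mu> [X, Y], Z] + scale (sg n x y) (\<mu> [Y, \<mu> [X, Z]]))"
    (is "_ \<longleftrightarrow> ?Jac")
proof -
  have ar: "ar p = 2" "ar (p + p) = 3" using p by (simp_all add: ar_def plus_fun_apply)
  have p': "- 1 \<le> p 0" "0 \<le> p 0" "- 1 \<le> (p + p) 0" using p by (simp_all add: plus_fun_apply)
  have pp: "p + p \<in> Zn (Suc n)" using p by (intro Zn_add)
  have g: "graded_map p (lift \<mu>)" by (rule graded_map_A[OF p(1) p'(1) \<mu>])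
  have anti: "\<mu> [X, Y] = scale (eps n x y) (\<mu> [Y, X])"
    if "x \<in> Zn n" "y \<in> Zn n" "X \<in> V x" "Y \<in> V y" for x y X Y
  proof -
    have "\<mu> [X, Y] = - scale (sg n x y) (\<mu> [Y, X])"
      using \<mu> that unfolding A_one_iff[OF p(1,2)] by blast
    then show ?thesis unfolding eps_def scale_minus_left .
  qed
  have slot: "\<mu> [scale c X, Y] = scale c (\<mu> [X, Y])" for c X Y
    using slot_linear_scale[OF graded_map_slot_linear[OF g], of "[]" undefined c X "[(undefined, Y)]"] by (simp add: lift_def)
  have deg: "\<mu> [X, Y] \<in> V (x + y)" if "x \<in> Zn n" "y \<in> Zn n" "X \<in> V x" "Y \<in> V y" for x y X Y
    using graded_map_in[OF g, of "[(x, X), (y, Y)]"] that by (simp add: ar lift_def p(3))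
  define I where "I = iop p p \<mu> \<mu>"
  have I: "I \<in> Msp (p + p)"
    unfolding I_def i_op_eq[OF p(1) p'(1) p(1) p'(1) g g]
    by (intro ext_map_in_M graded_map_scale graded_map_alt graded_map_insertion g pp p' p(1))
  have "(- 1 :: 'k) powi (p 0 * p 0 + ip n (wt p) (wt p)) = - 1"
    by (simp add: p ip_def zero_fun_apply)
  then have two: "A_bracket n scale V \<mu> \<mu> = fscale scale 2 I"
    unfolding A_bracket_homogeneous[OF p(1) p(1) \<mu> \<mu>] hbracket_def I_def[symmetric]
    using fs.scale_left_distrib[of 1 1 I] by simp
  have I0: "A_bracket n scale V \<mu> \<mu> = 0 \<longleftrightarrow> I = 0"
    unfolding two using fs.scale_eq_0_iff[of 2 I] by simp
  have key: "scale 2 (lift I [(x, X), (y, Y), (z, Z)]) = scale 2 (\<mu> [\<mu> [X, Y], Z]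
      + scale (sg n x y) (\<mu> [Y, \<mu> [X, Z]]) - \<mu> [X, \<mu> [Y, Z]])"
    if h: "x \<in> Zn n" "y \<in> Zn n" "z \<in> Zn n" "X \<in> V x" "Y \<in> V y" "Z \<in> V z" for x y z X Y Z
  proof -
    define G where "G = insert_at p (lift \<mu>) 0 (lift \<mu>)"
    have G: "G [(x, X), (y, Y), (z, Z)] = \<mu> [\<mu> [X, Y], Z]" for x y z X Y Z
      by (simp add: G_def insert_at_def block_def lift_def ar numeral_2_eq_2)
    define T Q R where "T = \<mu> [\<mu> [X, Y], Z]" and "Q = \<mu> [\<mu> [X, Z], Y]" and "R = \<mu> [\<mu> [Y, Z], X]"
    have e: "scale (eps n x y) (\<mu> [\<mu> [Y, X], Z]) = T"
      "scale (eps n x z) (\<mu> [\<mu> [Z, X], Y]) = Q"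
      "scale (eps n y z) (\<mu> [\<mu> [Z, Y], X]) = R"
      "Q = scale (eps n (x + z) y) (\<mu> [Y, \<mu> [X, Z]])"
      "R = scale (eps n (y + z) x) (\<mu> [X, \<mu> [Y, Z]])"
    proof -
      show "scale (eps n x y) (\<mu> [\<mu> [Y, X], Z]) = T" "scale (eps n x z) (\<mu> [\<mu> [Z, X], Y]) = Q"
        "scale (eps n y z) (\<mu> [\<mu> [Z, Y], X]) = R"
        unfolding T_def Q_def R_def slot
          anti[OF h(1,2,4,5)] anti[OF h(1,3,4,6)] anti[OF h(2,3,5,6)] by (rule refl)+
      show "Q = scale (eps n (x + z) y) (\<mu> [Y, \<mu> [X, Z]])"
        unfolding Q_def using h by (intro anti deg Zn_add)
      show "R = scale (eps n (y + z) x) (\<mu> [X, \<mu> [Y, Z]])"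
        unfolding R_def using h by (intro anti deg Zn_add)
    qed
    have c: "eps n y z * eps n (x + z) y = sg n x y"
      "eps n x y * eps n x z * eps n (y + z) x = - 1"
      by (simp_all add: eps_def sg_add_left sg_commute[of n z y] sg_commute[of n z x] sg_commute[of n y x]
          mult.left_commute[of _ "sg n x y"] mult.assoc)
    have double: "P + P = scale 2 P" for P
      using scale_left_distrib[of 1 1 P] by simp
    have "coef p p * of_nat (ar p) = 3"
      unfolding coef_def ar p(3) by (simp add: fact_numeral)
    moreover have "homogeneous [(x, X), (y, Y), (z, Z)]" "length [(x, X), (y, Y), (z, Z)] = ar (p + p)"
      unfolding ar(2) using h by simp_all
    ultimately have "lift I [(x, X), (y, Y), (z, Z)] = scale 3 (alt G [(x, X), (y, Y), (z, Z)])"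
      unfolding I_def G_def by (metis lift_i_op[OF p(1) p'(1) p(1) p'(2) \<mu> \<mu>])
    then have "scale 2 (lift I [(x, X), (y, Y), (z, Z)]) = scale 6 (alt G [(x, X), (y, Y), (z, Z)])"
      by simp
    also have "\<dots> = \<mu> [\<mu> [X, Y], Z] + scale (eps n x y) (\<mu> [\<mu> [Y, X], Z])
      + scale (eps n y z) (\<mu> [\<mu> [X, Z], Y] + scale (eps n x z) (\<mu> [\<mu> [Z, X], Y]))
      + scale (eps n x y * eps n x z) (\<mu> [\<mu> [Y, Z], X] + scale (eps n y z) (\<mu> [\<mu> [Z, Y], X]))"
      unfolding alt_three by (simp add: G)
    also have "\<dots> = T + T + scale (eps n y z) (Q + Q) + scale (eps n x y * eps n x z) (R + R)"
      unfolding e(1-3) T_def Q_def R_def ..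
    also have "\<dots> = scale 2 (T + scale (eps n y z) Q + scale (eps n x y * eps n x z) R)"
      by (simp add: double scale_right_distrib mult.commute[of 2])
    also have "scale (eps n y z) Q = scale (sg n x y) (\<mu> [Y, \<mu> [X, Z]])"
      unfolding e(4) scale_scale c(1) ..
    also have "scale (eps n x y * eps n x z) R = scale (- 1) (\<mu> [X, \<mu> [Y, Z]])"
      unfolding e(5) scale_scale c(2) ..
    finally show ?thesis by (simp add: T_def)
  qed
  have key': "lift I [(x, X), (y, Y), (z, Z)] = \<mu> [\<mu> [X, Y], Z]
      + scale (sg n x y) (\<mu> [Y, \<mu> [X, Z]]) - \<mu> [X, \<mu> [Y, Z]]"
    if "x \<in> Zn n" "y \<in> Zn n" "z \<in> Zn n" "X \<in> V x" "Y \<in> V y" "Z \<in> V z" for x y z X Y Z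
    using key[OF that] scale_cancel_left[of 2] by simp
  show ?thesis
    unfolding I0
  proof
    assume "I = 0"
    show ?Jac
    proof (intro ballI)
      fix x y z X Y Z assume "x \<in> Zn n" "y \<in> Zn n" "z \<in> Zn n" "X \<in> V x" "Y \<in> V y" "Z \<in> V z"
      from key'[OF this] \<open>I = 0\<close>
      show "\<mu> [X, \<mu> [Y, Z]] = \<mu> [\<mu> [X, Y], Z] + scale (sg n x y) (\<mu> [Y, \<mu> [X, Z]])"
        by (simp add: lift_zero)
    qed
  next
    assume Jac: ?Jac
    show "I = 0"
    proof (rule M_eq_0I[OF I p'(3)])
      fix zs assume "homogeneous zs" "length zs = ar (p + p)"
      then have "homogeneous zs" "length zs = 3" unfolding ar(2) by simp_all
      then obtain x y z X Y Z where zs: "zs = [(x, X), (y, Y), (z, Z)]"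
        "x \<in> Zn n" "y \<in> Zn n" "z \<in> Zn n" "X \<in> V x" "Y \<in> V y" "Z \<in> V z" by (rule homogeneous_three)
      have "\<mu> [X, \<mu> [Y, Z]] = \<mu> [\<mu> [X, Y], Z] + scale (sg n x y) (\<mu> [Y, \<mu> [X, Z]])"
        using Jac zs(2-7) by blast
      then show "lift I zs = 0" unfolding zs(1) key'[OF zs(2-7)] by simp
    qed
  qed
qed

lemma graded_Lie_algebra_V_iff:
  assumes p: "p \<in> Zn (Suc n)" "p 0 = 1" "wt p = 0" and \<mu>: "\<mu> \<in> Agr p"
  shows "graded_Lie_algebra n scale UNIV V (\<lambda>X Y. \<mu> [X, Y]) \<longleftrightarrow>
    (\<forall>x\<in>Zn n. \<forall>y\<in>Zn n. \<forall>z\<in>Zn n. \<forall>X\<in>V x. \<forall>Y\<in>V y. \<forall>Z\<in>V z.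
      \<mu> [X, \<mu> [Y, Z]] = \<mu> [\<mu> [X, Y], Z] + scale (sg n x y) (\<mu> [Y, \<mu> [X, Z]]))"
    (is "_ \<longleftrightarrow> ?Jac")
proof
  assume "graded_Lie_algebra n scale UNIV V (\<lambda>X Y. \<mu> [X, Y])"
  then show ?Jac unfolding graded_Lie_algebra_def sg_def by blast
next
  assume Jac: ?Jac
  have ar: "ar p = 2" using p by (simp add: ar_def)
  have p': "- 1 \<le> p 0" using p by simp
  have g: "graded_map p (lift \<mu>)" by (rule graded_map_A[OF p(1) p' \<mu>])
  note is_linear = graded_map_slot_linear[OF g]
  show "graded_Lie_algebra n scale UNIV V (\<lambda>X Y. \<mu> [X, Y])"
    unfolding graded_Lie_algebra_def
  proof (intro conjI)
    show "graded_space n scale UNIV V" by (rule graded_V)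
    show "\<forall>X\<in>UNIV. \<forall>Y\<in>UNIV. \<mu> [X, Y] \<in> UNIV" by simp
    show "\<forall>X\<in>UNIV. \<forall>Y\<in>UNIV. \<forall>Z\<in>UNIV. \<mu> [X + Y, Z] = \<mu> [X, Z] + \<mu> [Y, Z] \<and> \<mu> [Z, X + Y] = \<mu> [Z, X] + \<mu> [Z, Y]"
      using slot_linear_add[OF is_linear, of "[]" undefined _ _ "[(undefined, _)]"]
        slot_linear_add[OF is_linear, of "[(undefined, _)]" undefined _ _ "[]"] by (simp add: lift_def)
    show "\<forall>c. \<forall>X\<in>UNIV. \<forall>Y\<in>UNIV. \<mu> [scale c X, Y] = scale c (\<mu> [X, Y]) \<and> \<mu> [X, scale c Y] = scale c (\<mu> [X, Y])"
      using slot_linear_scale[OF is_linear, of "[]" undefined _ _ "[(undefined, _)]"]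
        slot_linear_scale[OF is_linear, of "[(undefined, _)]" undefined _ _ "[]"] by (simp add: lift_def)
    show "\<forall>x\<in>Zn n. \<forall>y\<in>Zn n. \<forall>X\<in>V x. \<forall>Y\<in>V y. \<mu> [X, Y] \<in> V (x + y)"
    proof (intro ballI)
      fix x y X Y assume "x \<in> Zn n" "y \<in> Zn n" "X \<in> V x" "Y \<in> V y"
      then show "\<mu> [X, Y] \<in> V (x + y)"
        using graded_map_in[OF g, of "[(x, X), (y, Y)]"] by (simp add: ar lift_def p(3))
    qed
    show "\<forall>x\<in>Zn n. \<forall>y\<in>Zn n. \<forall>X\<in>V x. \<forall>Y\<in>V y. \<mu> [X, Y] = - scale ((- 1) powi ip n x y) (\<mu> [Y, X])"
      using \<mu> unfolding A_one_iff[OF p(1,2)] sg_def by blast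
    show "\<forall>x\<in>Zn n. \<forall>y\<in>Zn n. \<forall>z\<in>Zn n. \<forall>X\<in>V x. \<forall>Y\<in>V y. \<forall>Z\<in>V z.
        \<mu> [X, \<mu> [Y, Z]] = \<mu> [\<mu> [X, Y], Z] + scale ((- 1) powi ip n x y) (\<mu> [Y, \<mu> [X, Z]])"
      using Jac unfolding sg_def .
  qed
qed

end

theorem theorem3p3:
  fixes n :: nat
    and scale :: "'k::field_char_0 \<Rightarrow> 'v::ab_group_add \<Rightarrow> 'v"
    and V :: "(nat \<Rightarrow> int) \<Rightarrow> 'v set"
  assumes "graded_space n scale UNIV V"
  shows
    "(\<forall>k\<^sub>1 k\<^sub>2. \<forall>\<kappa>\<^sub>1\<in>Zn n. \<forall>\<kappa>\<^sub>2\<in>Zn n.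
        \<forall>K\<^sub>1\<in>A_space n scale V k\<^sub>1 \<kappa>\<^sub>1. \<forall>K\<^sub>2\<in>A_space n scale V k\<^sub>2 \<kappa>\<^sub>2. k\<^sub>2 \<ge> 0 \<longrightarrow>
        (\<forall>xs Xs. homog_list n V xs Xs \<and> int (length Xs) = k\<^sub>1 + k\<^sub>2 + 1 \<longrightarrow>
           i_op n scale V k\<^sub>1 \<kappa>\<^sub>1 k\<^sub>2 \<kappa>\<^sub>2 K\<^sub>1 K\<^sub>2 Xs =
             scale (1 / (fact (nat (k\<^sub>1 + 1)) * fact (nat k\<^sub>2)))
               (\<Sum>\<sigma> | \<sigma> permutes {..<length Xs}.
                  scale (msign n \<sigma> xs * (- 1) powi ip n \<kappa>\<^sub>1 \<kappa>\<^sub>2)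
                    (K\<^sub>2 (K\<^sub>1 (take (nat (k\<^sub>1 + 1)) (permute_list \<sigma> Xs))
                         # drop (nat (k\<^sub>1 + 1)) (permute_list \<sigma> Xs))))))
     \<and> graded_Lie_algebra (Suc n) (fscale scale) (A_total n scale V) (A_grade n scale V)
         (A_bracket n scale V)
     \<and> (\<forall>\<mu>. \<mu> \<in> A_space n scale V 1 0 \<longleftrightarrow>
          \<mu> \<in> M_space n scale V 1 0 \<and>
          (\<forall>x\<in>Zn n. \<forall>y\<in>Zn n. \<forall>X\<in>V x. \<forall>Y\<in>V y.
             \<mu> [X, Y] = - scale ((- 1) powi ip n x y) (\<mu> [Y, X])))
     \<and> (\<forall>\<mu>\<in>A_space n scale V 1 0.
          A_bracket n scale V \<mu> \<mu> = 0 \<longleftrightarrow> graded_Lie_algebra n scale UNIV V (\<lambda>X Y. \<mu> [X, Y]))"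
proof -
  interpret vector_space scale using assms by (simp add: graded_space_def)
  interpret graded_maps n scale V by unfold_locales (rule assms)
  define deg :: "int \<Rightarrow> (nat \<Rightarrow> int) \<Rightarrow> nat \<Rightarrow> int" where "deg = case_nat"
  have deg: "deg k \<kappa> 0 = k" "wt (deg k \<kappa>) = \<kappa>" for k \<kappa>
    by (simp_all add: deg_def wt_def fun_eq_iff)
  have degZ: "deg k \<kappa> \<in> Zn (Suc n)" if "\<kappa> \<in> Zn n" for k \<kappa>
    using that by (auto simp: deg_def Zn_def split: nat.split)
  have A: "A_space n scale V k \<kappa> = A_grade n scale V (deg k \<kappa>)" for k \<kappa>
    using deg by (simp add: A_grade_def wt_def)
  have one: "deg 1 0 \<in> Zn (Suc n)" by (rule degZ[OF Zn_zero])
  show ?thesis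
  proof (intro conjI)
    show "\<forall>k\<^sub>1 k\<^sub>2. \<forall>\<kappa>\<^sub>1\<in>Zn n. \<forall>\<kappa>\<^sub>2\<in>Zn n.
        \<forall>K\<^sub>1\<in>A_space n scale V k\<^sub>1 \<kappa>\<^sub>1. \<forall>K\<^sub>2\<in>A_space n scale V k\<^sub>2 \<kappa>\<^sub>2. k\<^sub>2 \<ge> 0 \<longrightarrow>
        (\<forall>xs Xs. homog_list n V xs Xs \<and> int (length Xs) = k\<^sub>1 + k\<^sub>2 + 1 \<longrightarrow>
           i_op n scale V k\<^sub>1 \<kappa>\<^sub>1 k\<^sub>2 \<kappa>\<^sub>2 K\<^sub>1 K\<^sub>2 Xs =
             scale (1 / (fact (nat (k\<^sub>1 + 1)) * fact (nat k\<^sub>2)))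
               (\<Sum>\<sigma> | \<sigma> permutes {..<length Xs}.
                  scale (msign n \<sigma> xs * (- 1) powi ip n \<kappa>\<^sub>1 \<kappa>\<^sub>2)
                    (K\<^sub>2 (K\<^sub>1 (take (nat (k\<^sub>1 + 1)) (permute_list \<sigma> Xs))
                         # drop (nat (k\<^sub>1 + 1)) (permute_list \<sigma> Xs)))))"
    proof (intro allI ballI impI, elim conjE)
      fix k\<^sub>1 k\<^sub>2 \<kappa>\<^sub>1 \<kappa>\<^sub>2 K\<^sub>1 K\<^sub>2 xs Xs
      assume "\<kappa>\<^sub>1 \<in> Zn n" "\<kappa>\<^sub>2 \<in> Zn n" "K\<^sub>1 \<in> A_space n scale V k\<^sub>1 \<kappa>\<^sub>1" "K\<^sub>2 \<in> A_space n scale V k\<^sub>2 \<kappa>\<^sub>2"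
        "0 \<le> k\<^sub>2" "homog_list n V xs Xs" "int (length Xs) = k\<^sub>1 + k\<^sub>2 + 1"
      then show "i_op n scale V k\<^sub>1 \<kappa>\<^sub>1 k\<^sub>2 \<kappa>\<^sub>2 K\<^sub>1 K\<^sub>2 Xs =
             scale (1 / (fact (nat (k\<^sub>1 + 1)) * fact (nat k\<^sub>2)))
               (\<Sum>\<sigma> | \<sigma> permutes {..<length Xs}.
                  scale (msign n \<sigma> xs * (- 1) powi ip n \<kappa>\<^sub>1 \<kappa>\<^sub>2)
                    (K\<^sub>2 (K\<^sub>1 (take (nat (k\<^sub>1 + 1)) (permute_list \<sigma> Xs))
                         # drop (nat (k\<^sub>1 + 1)) (permute_list \<sigma> Xs))))"
        using i_op_formula[OF degZ degZ, of \<kappa>\<^sub>1 \<kappa>\<^sub>2 k\<^sub>2 K\<^sub>1 k\<^sub>1 K\<^sub>2 xs Xs]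
        unfolding A deg ar_def sg_def by blast
    qed
    show "graded_Lie_algebra (Suc n) (fscale scale) (A_total n scale V) (A_grade n scale V)
         (A_bracket n scale V)"
      by (rule graded_Lie_algebra_A)
    show "\<forall>\<mu>. \<mu> \<in> A_space n scale V 1 0 \<longleftrightarrow>
          \<mu> \<in> M_space n scale V 1 0 \<and>
          (\<forall>x\<in>Zn n. \<forall>y\<in>Zn n. \<forall>X\<in>V x. \<forall>Y\<in>V y.
             \<mu> [X, Y] = - scale ((- 1) powi ip n x y) (\<mu> [Y, X]))"
      using A_one_iff[OF one deg(1)] unfolding A deg sg_def by blast
    show "\<forall>\<mu>\<in>A_space n scale V 1 0.
          A_bracket n scale V \<mu> \<mu> = 0 \<longleftrightarrow> graded_Lie_algebra n scale UNIV V (\<lambda>X Y. \<mu> [X, Y])"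
      unfolding A
      using A_bracket_self_eq_0_iff[OF one deg] graded_Lie_algebra_V_iff[OF one deg] by blast
  qed
qed

end
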